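(* Let $k$ be a field, $q\in k$, and let $\Lambda=\Lambda_q$ be the quiver algebra and $\mathbb{K}_\bullet$ the projective bimodule resolution of $\Lambda$ described in the context. Let $\phi:\mathbb{K}_m\to\Lambda$ and $\mu:\mathbb{K}_n\to\Lambda$ be two Hochschild cocycles, of homological degrees $m$ and $n$ respectively, and write $\phi(\varepsilon^m_r)=\phi^m_r$ for $0\le r\le m+1$ and $\mu(\varepsilon^n_r)=\mu^n_r$ for $0\le r\le n+1$, where $\{\varepsilon^m_r\}_{r=0}^{m+1}$ and $\{\varepsilon^n_r\}_{r=0}^{n+1}$ are the free basis elements of $\mathbb{K}_m$ and $\mathbb{K}_n$. Then the cup product $\phi\smile\mu:\mathbb{K}_{m+n}\to\Lambda$ is given by $$(\phi\smile\mu)(\varepsilon^{m+n}_k)=\begin{cases}(-1)^{mn}\phi^m_0\mu^n_0, & k=0,\\ (-1)^{mn}\,T^{m+n}_k, & 0<k<m+n,\\ (-1)^{mn}\phi^m_m\mu^n_n, & k=m+n,\\ (-1)^{mn}\phi^m_0\mu^n_{n+1}, & k=m+n+1,\end{cases}$$ where $$T^{m+n}_k=\sum_{j=\max\{0,k-n\}}^{\min\{m,k\}}(-q)^{j(n-k+j)}\phi^m_j\mu^n_{k-j},\qquad 0<k<m+n.$$ (Here the subscript $k$ denotes an integer index, not the field.)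
   Context: Algebra. $Q$ is the quiver with two vertices $1,2$, two loops $a,b$ at vertex $1$, and one arrow $c:1\to 2$. For a path $x$, $o(x)$ and $t(x)$ denote the idempotents of its origin and terminal vertex; the product $xy$ of paths is concatenation if $t(x)=o(y)$ and $0$ otherwise. $e_1,e_2$ are the idempotents of the vertices. $\Lambda=\Lambda_q=kQ/I$ with $I=\langle a^2,\,b^2,\,ab-qba,\,ac\rangle$. $\Lambda^e=\Lambda\otimes_k\Lambda^{op}$. Elements $f^n_i$. Let $\Lambda_0$ be the subalgebra of $\Lambda$ spanned by the vertices and $\Lambda_1$ the $\Lambda_0$-bimodule spanned by the arrows; below $\otimes$ between arrows is $\otimes_{\Lambda_0}$. Set $f^0_0=e_1$, $f^0_1=e_2$; $f^1_0=a$, $f^1_1=b$, $f^1_2=c$; and for $n\ge 2$: $f^n_0=a^{\otimes n}$, $f^n_i=f^{n-1}_{i-1}\otimes b+(-q)^i f^{n-1}_i\otimes a$ for $0<i<n$, $f^n_n=b^{\otimes n}$, $f^n_{n+1}=a^{\otimes(n-1)}\otimes c$. Resolution. $\mathbb{K}_n=\bigoplus_{i=0}^{n+1}\Lambda\, o(f^n_i)\otimes_k t(f^n_i)\,\Lambda$, and $\varepsilon^n_i$ is the element with $o(f^n_i)\otimes_k t(f^n_i)$ in position $i$ (counting from $0$) and $0$ elsewhere. With $\partial_{i,j}=1$ if $i=j$ and $0$ otherwise, the differentials are $d_1(\varepsilon^1_2)=c\varepsilon^0_1-\varepsilon^0_0c$; $d_n(\varepsilon^n_i)=(1-\partial_{n,i})[a\varepsilon^{n-1}_i+(-1)^{n-i}q^i\varepsilon^{n-1}_ia]+(1-\partial_{i,0})[(-q)^{n-i}b\varepsilon^{n-1}_{i-1}+(-1)^n\varepsilon^{n-1}_{i-1}b]$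 for $i\le n$; $d_n(\varepsilon^n_{n+1})=a\varepsilon^{n-1}_n+(-1)^n\varepsilon^{n-1}_0c$ for $n\ge2$. With the multiplication map $\mathbb{K}_0\to\Lambda$ this is a minimal projective resolution of $\Lambda$ over $\Lambda^e$. A Hochschild $n$-cocycle is a $\Lambda^e$-homomorphism $\phi:\mathbb{K}_n\to\Lambda$ with $\phi d_{n+1}=0$. Such $\phi$ is determined by the values $\phi^n_i=\phi(\varepsilon^n_i)\in o(f^n_i)\Lambda t(f^n_i)$. Cup product. Let $\mathbb{B}_\bullet$ be the bar resolution, $\mathbb{B}_n=\Lambda^{\otimes(n+2)}$, with standard comultiplication $\Delta_{\mathbb{B}}(1\otimes a_1\otimes\cdots\otimes a_n\otimes 1)=\sum_{r=0}^n(1\otimes a_1\otimes\cdots\otimes a_r\otimes1)\otimes_\Lambda(1\otimes a_{r+1}\otimes\cdots\otimes a_n\otimes1)$. There is an embedding of complexes $\iota:\mathbb{K}_\bullet\to\mathbb{B}_\bullet$, $\iota(\varepsilon^n_i)=1\otimes f^n_i\otimes1$, lifting the identity of $\Lambda$, and a comultiplication $\Delta_{\mathbb{K}}:\mathbb{K}\to\mathbb{K}\otimes_\Lambda\mathbb{K}$ with $(\iota\otimes\iota)\Delta_{\mathbb{K}}=\Delta_{\mathbb{B}}\iota$. For cocycles $\phi,\mu$ of degrees $m,n$ on $\mathbb{K}$, the cup product is $\phi\smile\mu=\pi(\phi\otimes\mu)\Delta_{\mathbb{K}}$, where $\pi:\Lambda\otimes_\Lambda\Lambda\simeq\Lambda$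 is multiplication and $(\phi\otimes\mu)(x\otimes y)=(-1)^{|\mu||x|}\phi(x)\otimes\mu(y)$ with $|\mu|=n$.
   Formalization: The case k=m+n+1 is stated only for n≥1: for n=0 the printed value φ^m_0 μ^0_1 is always 0, while the cup product takes the value φ^m_{m+1} μ^0_1, which is e_2≠0 for m=n=0 with both cocycles the multiplication map. *)

theory Defs
  imports "HOL-Algebra.Free_Abelian_Groups" "HOL-Algebra.QuotRing"
begin

section \<open>The quiver algebra\<close>

datatype vertex = V1 | V2

datatype arrow = Arr_a | Arr_b | Arr_c

fun src :: "arrow \<Rightarrow> vertex" where
  "src Arr_a = V1" | "src Arr_b = V1" | "src Arr_c = V1"

fun tgt :: "arrow \<Rightarrow> vertex" where
  "tgt Arr_a = V1" | "tgt Arr_b = V1" | "tgt Arr_c = V2"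

text \<open>A path is its origin together with its arrows, listed from the origin to the end.\<close>

type_synonym path = "vertex \<times> arrow list"

fun chain_from :: "vertex \<Rightarrow> arrow list \<Rightarrow> bool" where
  "chain_from v [] = True"
| "chain_from v (x # xs) = (src x = v \<and> chain_from (tgt x) xs)"

definition is_path :: "path \<Rightarrow> bool" where
  "is_path p = chain_from (fst p) (snd p)"

definition path_end :: "path \<Rightarrow> vertex" where
  "path_end p = (if snd p = [] then fst p else tgt (last (snd p)))"

type_synonym 'k pathalg = "path \<Rightarrow>\<^sub>0 'k"

definition path_mult :: "'k::field pathalg \<Rightarrow> 'k pathalg \<Rightarrow> 'k pathalg" where
  "path_mult f g =
     (\<Sum>p\<in>Poly_Mapping.keys f. \<Sum>r\<in>Poly_Mapping.keys g.
        if path_end p = fst r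
        then Poly_Mapping.single (fst p, snd p @ snd r)
               (Poly_Mapping.lookup f p * Poly_Mapping.lookup g r)
        else 0)"

definition path_scalar :: "'k::field \<Rightarrow> 'k pathalg" where
  "path_scalar t = Poly_Mapping.single (V1, []) t + Poly_Mapping.single (V2, []) t"

definition path_algebra :: "'k::field pathalg ring" where
  "path_algebra =
     \<lparr>carrier = {f. Poly_Mapping.keys f \<subseteq> {p. is_path p}},
      monoid.mult = path_mult, one = path_scalar 1, zero = 0, add = (+)\<rparr>"

definition path_elem :: "vertex \<Rightarrow> arrow list \<Rightarrow> 'k::field pathalg" where
  "path_elem v xs = Poly_Mapping.single (v, xs) 1"

definition relations :: "'k::field \<Rightarrow> 'k pathalg set" where
  "relations q =
     {path_elem V1 [Arr_a, Arr_a],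
      path_elem V1 [Arr_b, Arr_b],
      path_elem V1 [Arr_a, Arr_b] - path_mult (path_scalar q) (path_elem V1 [Arr_b, Arr_a]),
      path_elem V1 [Arr_a, Arr_c]}"

definition rel_ideal :: "'k::field \<Rightarrow> 'k pathalg set" where
  "rel_ideal q = genideal path_algebra (relations q)"

type_synonym 'k quot = "'k pathalg set"

definition Lam :: "'k::field \<Rightarrow> 'k quot ring" where
  "Lam q = path_algebra Quot rel_ideal q"

definition lam_class :: "'k::field \<Rightarrow> 'k pathalg \<Rightarrow> 'k quot" where
  "lam_class q f = rel_ideal q +>\<^bsub>path_algebra\<^esub> f"

definition lam_idem :: "'k::field \<Rightarrow> vertex \<Rightarrow> 'k quot" where
  "lam_idem q v = lam_class q (path_elem v [])"

definition lam_arrow :: "'k::field \<Rightarrow> arrow \<Rightarrow> 'k quot" where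
  "lam_arrow q x = lam_class q (path_elem (src x) [x])"

definition lam_scalar :: "'k::field \<Rightarrow> 'k \<Rightarrow> 'k quot" where
  "lam_scalar q t = lam_class q (path_scalar t)"

definition lam_smult :: "'k::field \<Rightarrow> 'k \<Rightarrow> 'k quot \<Rightarrow> 'k quot" where
  "lam_smult q t x = lam_scalar q t \<otimes>\<^bsub>Lam q\<^esub> x"

text \<open>The subrings \<open>k\<close>, \<open>\<Lambda>\<^sub>0\<close> and \<open>\<Lambda>\<close> of \<open>\<Lambda>\<close>; all tensor products below are over one of them.\<close>

definition Scal :: "'k::field \<Rightarrow> 'k quot set" where
  "Scal q = range (lam_scalar q)"

definition Lam0 :: "'k::field \<Rightarrow> 'k quot set" where
  "Lam0 q = {lam_smult q s (lam_idem q V1) \<oplus>\<^bsub>Lam q\<^esub> lam_smult q t (lam_idem q V2) | s t. True}"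


section \<open>Abelian groups given by generators and relations\<close>

definition pres_group :: "'x set \<Rightarrow> ('x \<Rightarrow>\<^sub>0 int) set \<Rightarrow> ('x \<Rightarrow>\<^sub>0 int) set monoid" where
  "pres_group X R = free_Abelian_group X Mod generate (free_Abelian_group X) R"

definition pres_class :: "'x set \<Rightarrow> ('x \<Rightarrow>\<^sub>0 int) set \<Rightarrow> ('x \<Rightarrow>\<^sub>0 int) \<Rightarrow> ('x \<Rightarrow>\<^sub>0 int) set" where
  "pres_class X R z = generate (free_Abelian_group X) R #>\<^bsub>free_Abelian_group X\<^esub> z"

text \<open>
  The value at the coset \<open>T\<close> of the homomorphism from a presented group to the abelian group \<open>G\<close>
  sending each generator \<open>x\<close> to \<open>\<beta> x\<close>. It is meaningful only when \<open>\<beta>\<close> respects the relations, so that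
  the image under \<^const>\<open>the_elem\<close> is a singleton; this is the case wherever it is used below.
\<close>

definition pres_lift :: "('c, 'd) monoid_scheme \<Rightarrow> ('x \<Rightarrow> 'c) \<Rightarrow> ('x \<Rightarrow>\<^sub>0 int) set \<Rightarrow> 'c" where
  "pres_lift G \<beta> T =
     the_elem ((\<lambda>z. finprod G (\<lambda>x. \<beta> x [^]\<^bsub>G\<^esub> Poly_Mapping.lookup z x) (Poly_Mapping.keys z)) ` T)"


section \<open>Bimodules and tensor products\<close>

text \<open>
  The additive group of a bimodule is written with the fields of \<^type>\<open>monoid\<close>, as in the library's
  free abelian groups and product groups: \<open>x \<otimes>\<^bsub>M\<^esub> y\<close> is the sum, \<open>\<one>\<^bsub>M\<^esub>\<close> is zero and
  \<open>x [^]\<^bsub>M\<^esub> z\<close> is the integer multiple of elements of \<open>M\<close>.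
\<close>

record ('l, 'm) bimodule = "'m monoid" +
  lact :: "'l \<Rightarrow> 'm \<Rightarrow> 'm"
  ract :: "'m \<Rightarrow> 'l \<Rightarrow> 'm"

definition bimod_hom ::
  "('l, 'r) ring_scheme \<Rightarrow> ('l, 'm) bimodule \<Rightarrow> ('l, 'n) bimodule \<Rightarrow> ('m \<Rightarrow> 'n) set" where
  "bimod_hom L M N =
     {h \<in> hom M N. \<forall>l\<in>carrier L. \<forall>x\<in>carrier M.
        h (lact M l x) = lact N l (h x) \<and> h (ract M x l) = ract N (h x) l}"

definition regular :: "('l, 'r) ring_scheme \<Rightarrow> ('l, 'l) bimodule" where
  "regular L = \<lparr>carrier = carrier L, monoid.mult = add L, one = zero L,
                lact = monoid.mult L, ract = monoid.mult L\<rparr>"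

definition bimod_sum :: "'i set \<Rightarrow> ('i \<Rightarrow> ('l, 'm) bimodule) \<Rightarrow> ('l, 'i \<Rightarrow> 'm) bimodule" where
  \<comment> \<open>used for finite index sets only, where the direct sum is the product\<close>
  "bimod_sum J M =
     \<lparr>carrier = carrier (product_group J M), monoid.mult = monoid.mult (product_group J M),
      one = one (product_group J M),
      lact = (\<lambda>l x. \<lambda>i\<in>J. lact (M i) l (x i)),
      ract = (\<lambda>x l. \<lambda>i\<in>J. ract (M i) (x i) l)\<rparr>"

text \<open>\<open>M \<otimes>\<^sub>S N\<close> for a set \<open>S\<close> of ring elements acting on the right of \<open>M\<close> and on the left of \<open>N\<close>.\<close>

definition tensor_rels ::
  "'l set \<Rightarrow> ('l, 'm) bimodule \<Rightarrow> ('l, 'n) bimodule \<Rightarrow> (('m \<times> 'n) \<Rightarrow>\<^sub>0 int) set" where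
  "tensor_rels S M N =
     {frag_of (x \<otimes>\<^bsub>M\<^esub> x', y) - frag_of (x, y) - frag_of (x', y) | x x' y.
        x \<in> carrier M \<and> x' \<in> carrier M \<and> y \<in> carrier N} \<union>
     {frag_of (x, y \<otimes>\<^bsub>N\<^esub> y') - frag_of (x, y) - frag_of (x, y') | x y y'.
        x \<in> carrier M \<and> y \<in> carrier N \<and> y' \<in> carrier N} \<union>
     {frag_of (ract M x s, y) - frag_of (x, lact N s y) | x s y.
        x \<in> carrier M \<and> s \<in> S \<and> y \<in> carrier N}"

definition tensor_group ::
  "'l set \<Rightarrow> ('l, 'm) bimodule \<Rightarrow> ('l, 'n) bimodule \<Rightarrow> (('m \<times> 'n) \<Rightarrow>\<^sub>0 int) set monoid" where
  "tensor_group S M N = pres_group (carrier M \<times> carrier N) (tensor_rels S M N)"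

definition pure_tensor ::
  "'l set \<Rightarrow> ('l, 'm) bimodule \<Rightarrow> ('l, 'n) bimodule \<Rightarrow> 'm \<Rightarrow> 'n \<Rightarrow> (('m \<times> 'n) \<Rightarrow>\<^sub>0 int) set" where
  "pure_tensor S M N x y =
     pres_class (carrier M \<times> carrier N) (tensor_rels S M N) (frag_of (x, y))"

definition tensor ::
  "'l set \<Rightarrow> ('l, 'm) bimodule \<Rightarrow> ('l, 'n) bimodule \<Rightarrow> ('l, (('m \<times> 'n) \<Rightarrow>\<^sub>0 int) set) bimodule" where
  "tensor S M N =
     \<lparr>carrier = carrier (tensor_group S M N), monoid.mult = monoid.mult (tensor_group S M N),
      one = one (tensor_group S M N),
      lact = (\<lambda>l. pres_lift (tensor_group S M N) (\<lambda>(x, y). pure_tensor S M N (lact M l x) y)),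
      ract = (\<lambda>t l. pres_lift (tensor_group S M N) (\<lambda>(x, y). pure_tensor S M N x (ract N y l)) t)\<rparr>"

text \<open>The map \<open>f \<otimes> g\<close> into \<open>M' \<otimes>\<^sub>S N'\<close>, without sign.\<close>

definition tensor_map ::
  "'l set \<Rightarrow> ('l, 'm2) bimodule \<Rightarrow> ('l, 'n2) bimodule \<Rightarrow> ('m \<Rightarrow> 'm2) \<Rightarrow> ('n \<Rightarrow> 'n2) \<Rightarrow>
   (('m \<times> 'n) \<Rightarrow>\<^sub>0 int) set \<Rightarrow> (('m2 \<times> 'n2) \<Rightarrow>\<^sub>0 int) set" where
  "tensor_map S M' N' f g =
     pres_lift (tensor S M' N') (\<lambda>(x, y). pure_tensor S M' N' (f x) (g y))"

text \<open>Degree \<open>n\<close> of \<open>X \<otimes>\<^sub>L X\<close>; component \<open>r\<close> of an element lies in \<open>X r \<otimes>\<^sub>L X (n - r)\<close>.\<close>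

definition tensor_square ::
  "('l, 'r) ring_scheme \<Rightarrow> (nat \<Rightarrow> ('l, 'm) bimodule) \<Rightarrow> nat \<Rightarrow>
   ('l, nat \<Rightarrow> (('m \<times> 'm) \<Rightarrow>\<^sub>0 int) set) bimodule" where
  "tensor_square L X n = bimod_sum {0..n} (\<lambda>r. tensor (carrier L) (X r) (X (n - r)))"

text \<open>
  The differential from degree \<open>Suc n\<close> to degree \<open>n\<close>:
  \<open>x \<otimes> y \<mapsto> d x \<otimes> y + (-1)\<^bsup>|x|\<^esup> x \<otimes> d y\<close>.
\<close>

definition tensor_square_diff ::
  "('l, 'r) ring_scheme \<Rightarrow> (nat \<Rightarrow> ('l, 'm) bimodule) \<Rightarrow> (nat \<Rightarrow> 'm \<Rightarrow> 'm) \<Rightarrow> nat \<Rightarrow>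
   (nat \<Rightarrow> (('m \<times> 'm) \<Rightarrow>\<^sub>0 int) set) \<Rightarrow> nat \<Rightarrow> (('m \<times> 'm) \<Rightarrow>\<^sub>0 int) set" where
  "tensor_square_diff L X d n z =
     (\<lambda>r\<in>{0..n}.
        tensor_map (carrier L) (X r) (X (n - r)) (d (Suc r)) (\<lambda>y. y) (z (Suc r))
        \<otimes>\<^bsub>tensor (carrier L) (X r) (X (n - r))\<^esub>
        tensor_map (carrier L) (X r) (X (n - r)) (\<lambda>x. x) (d (Suc n - r)) (z r)
          [^]\<^bsub>tensor (carrier L) (X r) (X (n - r))\<^esub> ((-1) ^ r :: int))"


section \<open>The elements \<open>f n i\<close>\<close>

text \<open>
  \<open>\<Lambda>\<^sub>1 \<otimes>\<^bsub>\<Lambda>\<^sub>0\<^esub> \<dots> \<otimes>\<^bsub>\<Lambda>\<^sub>0\<^esub> \<Lambda>\<^sub>1\<close> (\<open>n\<close> factors) has the paths of length \<open>n\<close> as a \<open>k\<close>-basis,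
  so it is identified with the degree \<open>n\<close> part of the path algebra, \<open>\<otimes>\<^bsub>\<Lambda>\<^sub>0\<^esub>\<close> becoming the
  product of the path algebra.
\<close>

fun f_elem :: "'k::field \<Rightarrow> nat \<Rightarrow> nat \<Rightarrow> 'k pathalg" where
  "f_elem q 0 i = (if i = 0 then path_elem V1 [] else if i = 1 then path_elem V2 [] else 0)"
| "f_elem q (Suc 0) i =
     (if i = 0 then path_elem V1 [Arr_a] else if i = 1 then path_elem V1 [Arr_b]
      else if i = 2 then path_elem V1 [Arr_c] else 0)"
| "f_elem q (Suc (Suc n)) i =
     (if i = 0 then path_elem V1 (replicate (Suc (Suc n)) Arr_a)
      else if i < Suc (Suc n) then
        path_mult (f_elem q (Suc n) (i - 1)) (path_elem V1 [Arr_b])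
        + path_mult (path_scalar ((- q) ^ i))
            (path_mult (f_elem q (Suc n) i) (path_elem V1 [Arr_a]))
      else if i = Suc (Suc n) then path_elem V1 (replicate (Suc (Suc n)) Arr_b)
      else if i = Suc (Suc (Suc n)) then path_elem V1 (replicate (Suc n) Arr_a @ [Arr_c])
      else 0)"

text \<open>Origin and terminal vertex of \<open>f n i\<close>.\<close>

definition f_org :: "nat \<Rightarrow> nat \<Rightarrow> vertex" where
  "f_org n i = (if n = 0 \<and> i = 1 then V2 else V1)"

definition f_end :: "nat \<Rightarrow> nat \<Rightarrow> vertex" where
  "f_end n i = (if i = n + 1 then V2 else V1)"


section \<open>The resolution\<close>

text \<open>
  \<open>\<Lambda> e\<^sub>v\<close> and \<open>e\<^sub>v \<Lambda>\<close>. The former is stable under the left action and under right multiplication by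
  scalars only, and symmetrically for the latter; no other action is used.
\<close>

definition left_proj :: "'k::field \<Rightarrow> vertex \<Rightarrow> ('k quot, 'k quot) bimodule" where
  "left_proj q v =
     (regular (Lam q))\<lparr>carrier := (\<lambda>x. x \<otimes>\<^bsub>Lam q\<^esub> lam_idem q v) ` carrier (Lam q)\<rparr>"

definition right_proj :: "'k::field \<Rightarrow> vertex \<Rightarrow> ('k quot, 'k quot) bimodule" where
  "right_proj q v =
     (regular (Lam q))\<lparr>carrier := (\<lambda>x. lam_idem q v \<otimes>\<^bsub>Lam q\<^esub> x) ` carrier (Lam q)\<rparr>"

type_synonym 'k kcarr = "nat \<Rightarrow> (('k quot \<times> 'k quot) \<Rightarrow>\<^sub>0 int) set"

definition K :: "'k::field \<Rightarrow> nat \<Rightarrow> ('k quot, 'k kcarr) bimodule" where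
  "K q n =
     bimod_sum {0..n + 1} (\<lambda>i. tensor (Scal q) (left_proj q (f_org n i)) (right_proj q (f_end n i)))"

definition eps :: "'k::field \<Rightarrow> nat \<Rightarrow> nat \<Rightarrow> 'k kcarr" where
  "eps q n i =
     (\<lambda>j\<in>{0..n + 1}.
        if j = i
        then pure_tensor (Scal q) (left_proj q (f_org n i)) (right_proj q (f_end n i))
               (lam_idem q (f_org n i)) (lam_idem q (f_end n i))
        else \<one>\<^bsub>tensor (Scal q) (left_proj q (f_org n j)) (right_proj q (f_end n j))\<^esub>)"

text \<open>
  The bimodule homomorphism from \<open>K q n\<close> to \<open>N\<close> sending \<open>eps q n i\<close> to \<open>g i\<close>, where
  \<open>g i\<close> lies in \<open>o(f n i) N t(f n i)\<close>.
\<close>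

definition K_extend ::
  "'k::field \<Rightarrow> nat \<Rightarrow> ('k quot, 'm) bimodule \<Rightarrow> (nat \<Rightarrow> 'm) \<Rightarrow> 'k kcarr \<Rightarrow> 'm" where
  "K_extend q n N g x =
     finprod N (\<lambda>i. pres_lift N (\<lambda>(u, v). ract N (lact N u (g i)) v) (x i)) {0..n + 1}"

definition K_diff_basis :: "'k::field \<Rightarrow> nat \<Rightarrow> nat \<Rightarrow> 'k kcarr" where
  "K_diff_basis q n i =
     (let M = K q (n - 1);
          e = eps q (n - 1);
          a = lam_arrow q Arr_a; b = lam_arrow q Arr_b; c = lam_arrow q Arr_c;
          sc = (\<lambda>t. lact M (lam_scalar q t))
      in if i \<le> n then
           (if i \<noteq> n
            then lact M a (e i) \<otimes>\<^bsub>M\<^esub> sc ((-1) ^ (n - i) * q ^ i) (ract M (e i) a)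
            else \<one>\<^bsub>M\<^esub>)
           \<otimes>\<^bsub>M\<^esub>
           (if i \<noteq> 0
            then sc ((- q) ^ (n - i)) (lact M b (e (i - 1)))
                 \<otimes>\<^bsub>M\<^esub> sc ((-1) ^ n) (ract M (e (i - 1)) b)
            else \<one>\<^bsub>M\<^esub>)
         else if n = 1 then lact M c (e 1) \<otimes>\<^bsub>M\<^esub> sc (-1) (ract M (e 0) c)
         else lact M a (e n) \<otimes>\<^bsub>M\<^esub> sc ((-1) ^ n) (ract M (e 0) c))"

text \<open>The differential from degree \<open>n\<close> to degree \<open>n - 1\<close>, for \<open>n \<ge> 1\<close>.\<close>

definition K_diff :: "'k::field \<Rightarrow> nat \<Rightarrow> 'k kcarr \<Rightarrow> 'k kcarr" where
  "K_diff q n = K_extend q n (K q (n - 1)) (K_diff_basis q n)"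

definition cocycle :: "'k::field \<Rightarrow> nat \<Rightarrow> ('k kcarr \<Rightarrow> 'k quot) \<Rightarrow> bool" where
  "cocycle q n \<phi> \<longleftrightarrow>
     \<phi> \<in> bimod_hom (Lam q) (K q n) (regular (Lam q)) \<and>
     (\<forall>x\<in>carrier (K q (n + 1)). \<phi> (K_diff q (n + 1) x) = \<zero>\<^bsub>Lam q\<^esub>)"


section \<open>The bar resolution\<close>

text \<open>
  The tensor powers are taken over \<open>\<Lambda>\<^sub>0\<close>, as for the elements \<open>f n i\<close>. With tensor powers over \<open>k\<close>
  the element \<open>1 \<otimes> f \<otimes> 1\<close> is not fixed by \<open>o(f)\<close> and \<open>t(f)\<close>, so that it is not the image of
  \<open>eps q n i\<close> under a bimodule homomorphism.
\<close>

definition bar_gens :: "'k::field \<Rightarrow> nat \<Rightarrow> 'k quot list set" where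
  "bar_gens q n = {xs. length xs = n + 2 \<and> set xs \<subseteq> carrier (Lam q)}"

definition bar_rels :: "'k::field \<Rightarrow> nat \<Rightarrow> ('k quot list \<Rightarrow>\<^sub>0 int) set" where
  "bar_rels q n =
     {frag_of (us @ [x \<oplus>\<^bsub>Lam q\<^esub> y] @ vs) - frag_of (us @ [x] @ vs) - frag_of (us @ [y] @ vs) | us x y vs.
        us @ [x] @ vs \<in> bar_gens q n \<and> y \<in> carrier (Lam q)} \<union>
     {frag_of (us @ [x \<otimes>\<^bsub>Lam q\<^esub> s, y] @ vs) - frag_of (us @ [x, s \<otimes>\<^bsub>Lam q\<^esub> y] @ vs) | us x s y vs.
        us @ [x, y] @ vs \<in> bar_gens q n \<and> s \<in> Lam0 q}"

type_synonym 'k bcarr = "('k quot list \<Rightarrow>\<^sub>0 int) set"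

definition bar_group :: "'k::field \<Rightarrow> nat \<Rightarrow> 'k bcarr monoid" where
  "bar_group q n = pres_group (bar_gens q n) (bar_rels q n)"

text \<open>\<open>bar_pure q n [x\<^sub>0, \<dots>, x\<^bsub>n+1\<^esub>]\<close> is \<open>x\<^sub>0 \<otimes> \<dots> \<otimes> x\<^bsub>n+1\<^esub>\<close>.\<close>

definition bar_pure :: "'k::field \<Rightarrow> nat \<Rightarrow> 'k quot list \<Rightarrow> 'k bcarr" where
  "bar_pure q n xs = pres_class (bar_gens q n) (bar_rels q n) (frag_of xs)"

definition Bar :: "'k::field \<Rightarrow> nat \<Rightarrow> ('k quot, 'k bcarr) bimodule" where
  "Bar q n =
     \<lparr>carrier = carrier (bar_group q n), monoid.mult = monoid.mult (bar_group q n),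
      one = one (bar_group q n),
      lact = (\<lambda>l. pres_lift (bar_group q n) (\<lambda>xs. bar_pure q n ((l \<otimes>\<^bsub>Lam q\<^esub> hd xs) # tl xs))),
      ract = (\<lambda>t l. pres_lift (bar_group q n)
                      (\<lambda>xs. bar_pure q n (butlast xs @ [last xs \<otimes>\<^bsub>Lam q\<^esub> l])) t)\<rparr>"

text \<open>
  \<open>1 \<otimes> f \<otimes> 1\<close>, extended linearly from paths. A path is entered as
  \<open>e\<^sub>v \<otimes> x\<^sub>1 \<otimes> \<dots> \<otimes> x\<^sub>n \<otimes> 1\<close> with \<open>v\<close> its origin; over \<open>\<Lambda>\<^sub>0\<close> this equals
  \<open>1 \<otimes> x\<^sub>1 \<otimes> \<dots> \<otimes> x\<^sub>n \<otimes> 1\<close> when \<open>n \<ge> 1\<close>, and it is \<open>1 \<otimes> e\<^sub>v \<otimes> 1\<close> in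
  \<open>\<Lambda> \<otimes> \<Lambda>\<^sub>0 \<otimes> \<Lambda> = \<Lambda> \<otimes> \<Lambda>\<close> when \<open>n = 0\<close>.
\<close>

definition bar_of_f :: "'k::field \<Rightarrow> nat \<Rightarrow> 'k pathalg \<Rightarrow> 'k bcarr" where
  "bar_of_f q n f =
     finprod (Bar q n)
       (\<lambda>p. bar_pure q n
              (lam_smult q (Poly_Mapping.lookup f p) (lam_idem q (fst p))
               # map (lam_arrow q) (snd p) @ [\<one>\<^bsub>Lam q\<^esub>]))
       (Poly_Mapping.keys f)"

definition iota :: "'k::field \<Rightarrow> nat \<Rightarrow> 'k kcarr \<Rightarrow> 'k bcarr" where
  "iota q n = K_extend q n (Bar q n) (\<lambda>i. bar_of_f q n (f_elem q n i))"

definition bar_comult :: "'k::field \<Rightarrow> nat \<Rightarrow> 'k bcarr \<Rightarrow> nat \<Rightarrow> (('k bcarr \<times> 'k bcarr) \<Rightarrow>\<^sub>0 int) set" where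
  "bar_comult q n =
     pres_lift (tensor_square (Lam q) (Bar q) n)
       (\<lambda>xs. \<lambda>r\<in>{0..n}.
          pure_tensor (carrier (Lam q)) (Bar q r) (Bar q (n - r))
            (bar_pure q r (take (r + 1) xs @ [\<one>\<^bsub>Lam q\<^esub>]))
            (bar_pure q (n - r) (\<one>\<^bsub>Lam q\<^esub> # drop (r + 1) xs)))"


section \<open>Comultiplication on the resolution and cup product\<close>

definition iota_square ::
  "'k::field \<Rightarrow> nat \<Rightarrow> (nat \<Rightarrow> (('k kcarr \<times> 'k kcarr) \<Rightarrow>\<^sub>0 int) set) \<Rightarrow>
   nat \<Rightarrow> (('k bcarr \<times> 'k bcarr) \<Rightarrow>\<^sub>0 int) set" where
  "iota_square q n z =
     (\<lambda>r\<in>{0..n}. tensor_map (carrier (Lam q)) (Bar q r) (Bar q (n - r))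
                    (iota q r) (iota q (n - r)) (z r))"

text \<open>
  A chain map of bimodules \<open>\<Delta>\<close> from \<open>K\<close> to \<open>K \<otimes>\<^sub>\<Lambda> K\<close> with
  \<open>(\<iota> \<otimes> \<iota>) \<circ> \<Delta> = \<Delta>\<^sub>B \<circ> \<iota>\<close>.
\<close>

definition K_comult ::
  "'k::field \<Rightarrow> (nat \<Rightarrow> 'k kcarr \<Rightarrow> nat \<Rightarrow> (('k kcarr \<times> 'k kcarr) \<Rightarrow>\<^sub>0 int) set) \<Rightarrow> bool" where
  "K_comult q \<Delta> \<longleftrightarrow>
     (\<forall>n. \<Delta> n \<in> bimod_hom (Lam q) (K q n) (tensor_square (Lam q) (K q) n)) \<and>
     (\<forall>n. \<forall>x\<in>carrier (K q (Suc n)).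
        \<Delta> n (K_diff q (Suc n) x) = tensor_square_diff (Lam q) (K q) (K_diff q) n (\<Delta> (Suc n) x)) \<and>
     (\<forall>n. \<forall>x\<in>carrier (K q n). iota_square q n (\<Delta> n x) = bar_comult q n (iota q n x))"

text \<open>
  \<open>\<phi> \<otimes> \<mu>\<close> from degree \<open>m + n\<close> of \<open>K \<otimes>\<^sub>\<Lambda> K\<close> to \<open>\<Lambda> \<otimes>\<^sub>\<Lambda> \<Lambda>\<close>, for \<open>\<phi>\<close> of degree \<open>m\<close> and
  \<open>\<mu>\<close> of degree \<open>n\<close>: it vanishes on all components other than \<open>K m \<otimes>\<^sub>\<Lambda> K n\<close>, on which it is
  \<open>x \<otimes> y \<mapsto> (-1)\<^bsup>nm\<^esup> \<phi> x \<otimes> \<mu> y\<close>.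
\<close>

definition cochain_tensor ::
  "'k::field \<Rightarrow> nat \<Rightarrow> nat \<Rightarrow> ('k kcarr \<Rightarrow> 'k quot) \<Rightarrow> ('k kcarr \<Rightarrow> 'k quot) \<Rightarrow>
   (nat \<Rightarrow> (('k kcarr \<times> 'k kcarr) \<Rightarrow>\<^sub>0 int) set) \<Rightarrow> (('k quot \<times> 'k quot) \<Rightarrow>\<^sub>0 int) set" where
  "cochain_tensor q m n \<phi> \<mu> z =
     tensor_map (carrier (Lam q)) (regular (Lam q)) (regular (Lam q)) \<phi> \<mu> (z m)
       [^]\<^bsub>tensor (carrier (Lam q)) (regular (Lam q)) (regular (Lam q))\<^esub> ((-1) ^ (n * m) :: int)"

definition mult_map :: "'k::field \<Rightarrow> (('k quot \<times> 'k quot) \<Rightarrow>\<^sub>0 int) set \<Rightarrow> 'k quot" where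
  "mult_map q = pres_lift (regular (Lam q)) (\<lambda>(x, y). x \<otimes>\<^bsub>Lam q\<^esub> y)"

definition cup ::
  "'k::field \<Rightarrow> (nat \<Rightarrow> 'k kcarr \<Rightarrow> nat \<Rightarrow> (('k kcarr \<times> 'k kcarr) \<Rightarrow>\<^sub>0 int) set) \<Rightarrow>
   nat \<Rightarrow> nat \<Rightarrow> ('k kcarr \<Rightarrow> 'k quot) \<Rightarrow> ('k kcarr \<Rightarrow> 'k quot) \<Rightarrow> 'k kcarr \<Rightarrow> 'k quot" where
  "cup q \<Delta> m n \<phi> \<mu> x = mult_map q (cochain_tensor q m n \<phi> \<mu> (\<Delta> (m + n) x))"

end

theory Submission
  imports Defs
begin

text \<open>
  Since \<open>\<Delta>\<close> is only known through \<open>(\<iota> \<otimes> \<iota>) \<circ> \<Delta> = \<Delta>\<^sub>B \<circ> \<iota>\<close>, every bimodule homomorphism \<open>\<phi>\<close> on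
  \<open>K\<close> is extended along \<open>\<iota>\<close> to a bimodule homomorphism on the bar resolution. The word
  \<open>a\<^bsup>m-i\<^esup> b\<^bsup>i\<^esup>\<close> occurs in \<open>f m i\<close> with coefficient \<open>1\<close> and in no other \<open>f m j\<close>, and so does
  \<open>a\<^bsup>m-1\<^esup> c\<close> for \<open>i = m + 1\<close>; hence it suffices to send these words to the values of \<open>\<phi>\<close> and all
  other words to \<open>0\<close>. The cup product is then the pairing of the two extensions applied to
  \<open>\<Delta>\<^sub>B (\<iota> (eps q (m + n) k))\<close>, in which \<open>\<phi>\<^sub>i \<mu>\<^sub>j\<close> has as coefficient that of
  \<open>a\<^bsup>m-i\<^esup> b\<^bsup>i\<^esup> a\<^bsup>n-j\<^esup> b\<^bsup>j\<^esup>\<close> in \<open>f (m + n) k\<close>: moving the \<open>n - j\<close> later letters \<open>a\<close> past the \<open>i\<close>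
  earlier letters \<open>b\<close> costs \<open>(-q)\<^bsup>i(n-j)\<^esup>\<close>.
\<close>

section \<open>Presented abelian groups\<close>

text \<open>Solving the equation for \<Delta> itself would require \<iota> \<otimes> \<iota> to be
  injective over \<Lambda>. Writing each cochain as an extension composed with \<iota> avoids this:
  \<phi> \<otimes> \<mu> then factors through \<iota> \<otimes> \<iota>. Two facts make the
  extension well defined. The ideal contains only combinations of paths of length at least two, so
  the coefficient of an arrow is a function on \<Lambda>. The bar tensors are balanced over
  \<Lambda>_0, whose elements multiply that coefficient by a factor depending only on the source or
  target of the arrow; the factors agree across each tensor sign because the chosen words are paths,
  and at the two ends because these paths run from o(f) to t(f). In degree 0 the words are empty and
  carry no vertex. Therefore words are compared together with their origins, composability of the
  two factors is a separate case distinction, and the last formula is stated for n \<ge> 1: for n =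
  0 the path f m (m+1) splits as itself followed by vertex 2, and the pairing yields \<phi>_(m+1)
  \<mu>_1.\<close>

definition frag_ext :: "('c, 'd) monoid_scheme \<Rightarrow> ('x \<Rightarrow> 'c) \<Rightarrow> ('x \<Rightarrow>\<^sub>0 int) \<Rightarrow> 'c" where
  "frag_ext G \<beta> z = finprod G (\<lambda>x. \<beta> x [^]\<^bsub>G\<^esub> Poly_Mapping.lookup z x) (Poly_Mapping.keys z)"

lemma group_homI: "\<lbrakk>group G; group H; h \<in> hom G H\<rbrakk> \<Longrightarrow> group_hom G H h"
  by (simp add: group_hom_def group_hom_axioms_def)

context comm_group
begin

text \<open>Keys can cancel in a sum, so \<open>frag_ext\<close>, the map inside
  \<open>pres_lift\<close>, is compared over a fixed finite set containing the supports; each extra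
  factor is a zeroth power.\<close>

lemma frag_ext_superset:
  assumes "finite A" "Poly_Mapping.keys z \<subseteq> A" "\<beta> \<in> A \<rightarrow> carrier G"
  shows "frag_ext G \<beta> z = finprod G (\<lambda>x. \<beta> x [^] Poly_Mapping.lookup z x) A"
  unfolding frag_ext_def using assms
  by (intro finprod_mono_neutral_cong_left) (auto simp: in_keys_iff Pi_iff)

lemma frag_ext_closed:
  "\<lbrakk>Poly_Mapping.keys z \<subseteq> X; \<beta> \<in> X \<rightarrow> carrier G\<rbrakk> \<Longrightarrow> frag_ext G \<beta> z \<in> carrier G"
  unfolding frag_ext_def by (intro finprod_closed) (auto simp: Pi_iff)

lemma frag_ext_add:
  assumes "Poly_Mapping.keys z \<subseteq> X" "Poly_Mapping.keys w \<subseteq> X" "\<beta> \<in> X \<rightarrow> carrier G"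
  shows "frag_ext G \<beta> (z + w) = frag_ext G \<beta> z \<otimes> frag_ext G \<beta> w"
proof -
  let ?A = "Poly_Mapping.keys z \<union> Poly_Mapping.keys w"
  have b: "\<beta> \<in> ?A \<rightarrow> carrier G"
    using assms by auto
  have "frag_ext G \<beta> (z + w) = finprod G (\<lambda>x. \<beta> x [^] Poly_Mapping.lookup (z + w) x) ?A"
    using b by (intro frag_ext_superset) (auto dest: subsetD [OF keys_add])
  also have "\<dots> = finprod G (\<lambda>x. \<beta> x [^] Poly_Mapping.lookup z x \<otimes> \<beta> x [^] Poly_Mapping.lookup w x) ?A"
    using b by (intro finprod_cong') (auto simp: lookup_add int_pow_mult Pi_iff)
  also have "\<dots> = finprod G (\<lambda>x. \<beta> x [^] Poly_Mapping.lookup z x) ?A \<otimes>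
                  finprod G (\<lambda>x. \<beta> x [^] Poly_Mapping.lookup w x) ?A"
    using b by (intro finprod_multf) (auto simp: Pi_iff)
  also have "\<dots> = frag_ext G \<beta> z \<otimes> frag_ext G \<beta> w"
    using b by (simp add: frag_ext_superset [of ?A])
  finally show ?thesis .
qed

lemma frag_ext_hom: "\<beta> \<in> X \<rightarrow> carrier G \<Longrightarrow> frag_ext G \<beta> \<in> hom (free_Abelian_group X) G"
  by (intro homI) (auto intro: frag_ext_closed frag_ext_add)

lemma frag_ext_of: "\<beta> x \<in> carrier G \<Longrightarrow> frag_ext G \<beta> (frag_of x) = \<beta> x"
  by (simp add: frag_ext_def keys_frag_of finprod_singleton)

lemma frag_ext_diff:
  assumes "Poly_Mapping.keys z \<subseteq> X" "Poly_Mapping.keys w \<subseteq> X" "\<beta> \<in> X \<rightarrow> carrier G"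
  shows "frag_ext G \<beta> (z - w) = frag_ext G \<beta> z \<otimes> inv frag_ext G \<beta> w"
proof -
  interpret h: group_hom "free_Abelian_group X" G "frag_ext G \<beta>"
    using frag_ext_hom [OF assms(3)] by (intro group_homI) (auto intro: is_group)
  have "Poly_Mapping.keys (- w) \<subseteq> X"
    using assms(2) by (simp add: keys_minus)
  then show ?thesis
    using frag_ext_add [of z X "- w" \<beta>] h.hom_inv [of w] assms by simp
qed

end

section \<open>Universal property of an abelian group given by generators and relations\<close>

locale presentation =
  fixes X :: "'x set" and R :: "('x \<Rightarrow>\<^sub>0 int) set"
  assumes rels: "r \<in> R \<Longrightarrow> Poly_Mapping.keys r \<subseteq> X"
begin

abbreviation "F \<equiv> free_Abelian_group X"

interpretation F: comm_group F
  by (rule abelian_free_Abelian_group)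

lemma subgroup_rels: "subgroup (generate F R) F"
  using rels by (intro F.generate_is_subgroup) auto

lemma normal_rels: "generate F R \<lhd> F"
  by (rule F.subgroup_imp_normal [OF subgroup_rels])

lemma comm_group_pres: "comm_group (pres_group X R)"
  unfolding pres_group_def by (rule F.abelian_FactGroup [OF subgroup_rels])

lemma pres_class_hom: "pres_class X R \<in> hom F (pres_group X R)"
  using normal.r_coset_hom_Mod [OF normal_rels] unfolding pres_group_def pres_class_def .

lemma pres_class_closed: "Poly_Mapping.keys z \<subseteq> X \<Longrightarrow> pres_class X R z \<in> carrier (pres_group X R)"
  using hom_in_carrier [OF pres_class_hom] by simp

lemma carrier_presE:
  assumes "T \<in> carrier (pres_group X R)"
  obtains z where "Poly_Mapping.keys z \<subseteq> X" "T = pres_class X R z"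
  using assms unfolding pres_group_def pres_class_def by (auto simp: FactGroup_def RCOSETS_def)

lemma pres_class_add:
  "\<lbrakk>Poly_Mapping.keys z \<subseteq> X; Poly_Mapping.keys w \<subseteq> X\<rbrakk> \<Longrightarrow>
    pres_class X R (z + w) = pres_class X R z \<otimes>\<^bsub>pres_group X R\<^esub> pres_class X R w"
  using hom_mult [OF pres_class_hom, of z w] by simp

lemma pres_class_diff:
  assumes "Poly_Mapping.keys z \<subseteq> X" "Poly_Mapping.keys w \<subseteq> X"
  shows "pres_class X R (z - w) = pres_class X R z \<otimes>\<^bsub>pres_group X R\<^esub> inv\<^bsub>pres_group X R\<^esub> pres_class X R w"
proof -
  interpret P: comm_group "pres_group X R" by (rule comm_group_pres)
  interpret h: group_hom F "pres_group X R" "pres_class X R"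
    using pres_class_hom by (intro group_homI) (auto intro: P.is_group)
  have "Poly_Mapping.keys (- w) \<subseteq> X"
    using assms(2) by (simp add: keys_minus)
  then show ?thesis
    using pres_class_add [of z "- w"] h.hom_inv [of w] assms by simp
qed

lemma pres_class_rel: "r \<in> R \<Longrightarrow> pres_class X R r = \<one>\<^bsub>pres_group X R\<^esub>"
proof -
  assume r: "r \<in> R"
  then have "r \<in> generate F R"
    by (rule generate.incl)
  then show ?thesis
    using F.coset_join2 [of r "generate F R"] subgroup_rels rels [OF r]
    by (simp add: pres_class_def pres_group_def FactGroup_def)
qed

lemma pres_class_eqI:
  assumes "z - w \<in> R" "Poly_Mapping.keys z \<subseteq> X" "Poly_Mapping.keys w \<subseteq> X"
  shows "pres_class X R z = pres_class X R w"
proof -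
  interpret P: comm_group "pres_group X R" by (rule comm_group_pres)
  show ?thesis
    using pres_class_rel [OF assms(1)] pres_class_diff [OF assms(2,3)]
      pres_class_closed [OF assms(2)] pres_class_closed [OF assms(3)]
    by (metis P.inv_equality P.inv_inv P.inv_closed)
qed

lemma pres_class_add_eqI:
  assumes "x \<in> X" "y \<in> X" "w \<in> X" "frag_of x - frag_of y - frag_of w \<in> R"
  shows "pres_class X R (frag_of x) = pres_class X R (frag_of y) \<otimes>\<^bsub>pres_group X R\<^esub> pres_class X R (frag_of w)"
proof -
  have k: "Poly_Mapping.keys (frag_of y + frag_of w) \<subseteq> X"
    using assms keys_add [of "frag_of y" "frag_of w"] by (auto simp: keys_frag_of)
  have "frag_of x - (frag_of y + frag_of w) \<in> R"
    using assms by (simp add: algebra_simps)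
  then have "pres_class X R (frag_of x) = pres_class X R (frag_of y + frag_of w)"
    using pres_class_eqI k assms(1) by (simp add: keys_frag_of)
  then show ?thesis
    using assms by (simp add: pres_class_add keys_frag_of)
qed

text \<open>Uniqueness half of the universal property: every class has a representative in the free
  group, whose elements arise from the generators by forming differences.\<close>

lemma pres_hom_eqI:
  assumes G: "group G" and f: "f \<in> hom (pres_group X R) G" and g: "g \<in> hom (pres_group X R) G"
    and eq: "\<And>x. x \<in> X \<Longrightarrow> f (pres_class X R (frag_of x)) = g (pres_class X R (frag_of x))"
    and T: "T \<in> carrier (pres_group X R)"
  shows "f T = g T"
proof -
  interpret P: comm_group "pres_group X R" by (rule comm_group_pres)
  interpret G: group G by (rule G)
  interpret f: group_hom "pres_group X R" G f using f by (intro group_homI P.is_group G)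
  interpret g: group_hom "pres_group X R" G g using g by (intro group_homI P.is_group G)
  obtain z where z: "Poly_Mapping.keys z \<subseteq> X" "T = pres_class X R z"
    using T by (rule carrier_presE)
  have "f (pres_class X R z) = g (pres_class X R z)"
  proof (rule free_Abelian_group_induct [OF z(1)])
    have "pres_class X R 0 = \<one>\<^bsub>pres_group X R\<^esub>"
      using hom_one [OF pres_class_hom] P.is_group by simp
    then show "f (pres_class X R 0) = g (pres_class X R 0)"
      by simp
  qed (auto simp: pres_class_diff pres_class_closed eq)
  with z show ?thesis
    by simp
qed

context
  fixes G :: "('c, 'd) monoid_scheme" and \<beta> :: "'x \<Rightarrow> 'c"
  assumes G: "comm_group G" and \<beta>: "\<beta> \<in> X \<rightarrow> carrier G"
    and vanish: "\<And>r. r \<in> R \<Longrightarrow> frag_ext G \<beta> r = \<one>\<^bsub>G\<^esub>"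
begin

interpretation G: comm_group G by (rule G)

text \<open>Existence half: the kernel of \<open>frag_ext G \<beta>\<close> is a subgroup containing
  \<open>R\<close>, hence all of \<open>generate F R\<close>. So the map is constant on each coset,
  and \<open>the_elem\<close> in \<open>pres_lift\<close> is applied to a singleton.\<close>

lemma pres_lift_class:
  assumes "Poly_Mapping.keys z \<subseteq> X"
  shows "pres_lift G \<beta> (pres_class X R z) = frag_ext G \<beta> z"
proof -
  interpret h: group_hom F G "frag_ext G \<beta>"
    using G.frag_ext_hom [OF \<beta>] by (intro group_homI) (auto intro: G.is_group)
  have sub: "generate F R \<subseteq> kernel F G (frag_ext G \<beta>)"
    using rels vanish by (intro F.generate_subgroup_incl h.subgroup_kernel) (auto simp: kernel_def)
  \<comment> \<open>The coset must be nonempty for its image to be a singleton and not merely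
    contained in one.\<close>
  have "0 \<in> generate F R"
    using subgroup.one_closed [OF subgroup_rels] by simp
  moreover have "frag_ext G \<beta> (n + z) = frag_ext G \<beta> z" if "n \<in> generate F R" for n
  proof -
    have "Poly_Mapping.keys n \<subseteq> X" "frag_ext G \<beta> n = \<one>\<^bsub>G\<^esub>"
      using subsetD [OF sub that] by (auto simp: kernel_def)
    then show ?thesis
      using G.frag_ext_add [OF _ assms \<beta>] G.frag_ext_closed [OF assms \<beta>] by simp
  qed
  ultimately have "frag_ext G \<beta> ` pres_class X R z = {frag_ext G \<beta> z}"
    by (fastforce simp: pres_class_def r_coset_def)
  then have "the_elem (frag_ext G \<beta> ` pres_class X R z) = frag_ext G \<beta> z"
    by simp
  then show ?thesis
    by (simp add: pres_lift_def frag_ext_def [abs_def])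
qed

lemma pres_lift_gen: "x \<in> X \<Longrightarrow> pres_lift G \<beta> (pres_class X R (frag_of x)) = \<beta> x"
  using \<beta> by (simp add: pres_lift_class keys_frag_of G.frag_ext_of Pi_iff)

lemma pres_lift_hom: "pres_lift G \<beta> \<in> hom (pres_group X R) G"
proof (rule homI)
  fix T assume "T \<in> carrier (pres_group X R)"
  then show "pres_lift G \<beta> T \<in> carrier G"
    by (elim carrier_presE) (auto simp: pres_lift_class G.frag_ext_closed [OF _ \<beta>])
next
  fix T U assume "T \<in> carrier (pres_group X R)" "U \<in> carrier (pres_group X R)"
  then obtain z w where z: "Poly_Mapping.keys z \<subseteq> X" "T = pres_class X R z"
    and w: "Poly_Mapping.keys w \<subseteq> X" "U = pres_class X R w"
    by (metis carrier_presE)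
  have "Poly_Mapping.keys (z + w) \<subseteq> X"
    using z w keys_add [of z w] by blast
  then show "pres_lift G \<beta> (T \<otimes>\<^bsub>pres_group X R\<^esub> U) = pres_lift G \<beta> T \<otimes>\<^bsub>G\<^esub> pres_lift G \<beta> U"
    using z w by (simp add: pres_lift_class G.frag_ext_add [OF _ _ \<beta>] flip: pres_class_add)
qed

end

end

text \<open>The shape shared by the bilinearity relations of \<open>tensor_rels\<close> and the
  additivity relations of \<open>bar_rels\<close>; the next lemma treats the relations that move a
  ring element across a tensor sign.\<close>

lemma (in comm_group) frag_ext_additive_rel:
  assumes "\<beta> x \<in> carrier G" "\<beta> y \<in> carrier G" "\<beta> w \<in> carrier G" "\<beta> x = \<beta> y \<otimes> \<beta> w"
  shows "frag_ext G \<beta> (frag_of x - frag_of y - frag_of w) = \<one>"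
proof -
  have b: "\<beta> \<in> {x, y, w} \<rightarrow> carrier G"
    using assms by auto
  have "Poly_Mapping.keys (frag_of x - frag_of y) \<subseteq> {x, y, w}"
    using keys_diff [of "frag_of x" "frag_of y"] by (auto simp: keys_frag_of)
  then have "frag_ext G \<beta> (frag_of x - frag_of y - frag_of w) = \<beta> x \<otimes> inv \<beta> y \<otimes> inv \<beta> w"
    using assms by (simp add: frag_ext_diff [OF _ _ b] keys_frag_of frag_ext_of)
  then show ?thesis
    using assms by (simp add: m_ac)
qed

lemma (in comm_group) frag_ext_balanced_rel:
  assumes "\<beta> x \<in> carrier G" "\<beta> x = \<beta> y"
  shows "frag_ext G \<beta> (frag_of x - frag_of y) = \<one>"
proof -
  have b: "\<beta> \<in> {x, y} \<rightarrow> carrier G"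
    using assms by auto
  show ?thesis
    using assms by (simp add: frag_ext_diff [OF _ _ b] keys_frag_of frag_ext_of)
qed

section \<open>Tensor products and direct sums of bimodules\<close>

text \<open>Bimodules, presented groups and product groups are different record types with the same
  group fields; the group laws are transported between them by this lemma and its commutative
  form.\<close>

lemma group_cong:
  assumes "group G" "carrier H = carrier G" "monoid.mult H = monoid.mult G" "one H = one G"
  shows "group H"
proof -
  interpret G: group G by fact
  show ?thesis
    using assms(2-) G.l_inv_ex by (intro groupI) (auto simp: G.m_assoc)
qed

lemma comm_group_cong:
  assumes "comm_group G" "carrier H = carrier G" "monoid.mult H = monoid.mult G" "one H = one G"
  shows "comm_group H"
proof -
  interpret G: comm_group G by fact
  show ?thesis
    using assms(2-) G.l_inv_ex by (intro comm_groupI) (auto simp: G.m_ac)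
qed

lemma hom_finprod:
  assumes "comm_group G" "comm_group H" "h \<in> hom G H" "f \<in> A \<rightarrow> carrier G"
  shows "h (finprod G f A) = finprod H (\<lambda>x. h (f x)) A"
proof -
  interpret G: comm_group G by fact
  interpret H: comm_group H by fact
  interpret h: group_hom G H h
    using assms(3) by (intro group_homI G.is_group H.is_group)
  show ?thesis
    using assms(4)
  proof (induction A rule: infinite_finite_induct)
    case (insert x A)
    then have "f \<in> A \<rightarrow> carrier G" "f x \<in> carrier G"
      by auto
    with insert show ?case
      by (simp add: Pi_iff)
  qed auto
qed

text \<open>Weaker than a pair of bimodules on purpose: \<open>left_proj q v\<close> is stable on
  the right under scalars only, and \<open>right_proj q v\<close> on the left likewise, yet they are
  tensored over \<open>Scal q\<close>.\<close>

locale tensor_data =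
  fixes S :: "'l set" and M :: "('l, 'm) bimodule" and N :: "('l, 'n) bimodule"
  assumes M: "comm_group M" and N: "comm_group N"
    and ract_closed: "\<lbrakk>x \<in> carrier M; s \<in> S\<rbrakk> \<Longrightarrow> ract M x s \<in> carrier M"
    and lact_closed: "\<lbrakk>y \<in> carrier N; s \<in> S\<rbrakk> \<Longrightarrow> lact N s y \<in> carrier N"
begin

interpretation M: comm_group M by (rule M)
interpretation N: comm_group N by (rule N)

sublocale presentation "carrier M \<times> carrier N" "tensor_rels S M N"
proof
  fix r assume "r \<in> tensor_rels S M N"
  then show "Poly_Mapping.keys r \<subseteq> carrier M \<times> carrier N"
    unfolding tensor_rels_def using ract_closed lact_closed
    by (auto dest!: subsetD [OF keys_diff] simp: keys_frag_of)
qed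

lemma tensor_simps:
  "carrier (tensor S M N) = carrier (tensor_group S M N)"
  "monoid.mult (tensor S M N) = monoid.mult (tensor_group S M N)"
  "one (tensor S M N) = one (tensor_group S M N)"
  by (simp_all add: tensor_def)

lemma hom_tensor: "hom (tensor S M N) G = hom (tensor_group S M N) G"
  by (simp add: hom_def tensor_simps)

text \<open>The actions on \<open>tensor S M N\<close> are lifts into
  \<open>tensor_group S M N\<close>, because their definition is part of building the bimodule
  record.\<close>

lemma hom_into_tensor: "hom G (tensor S M N) = hom G (tensor_group S M N)"
  by (simp add: hom_def tensor_simps)

lemma comm_group_tensor_group: "comm_group (tensor_group S M N)"
  unfolding tensor_group_def by (rule comm_group_pres)

lemma comm_group_tensor: "comm_group (tensor S M N)"
  by (rule comm_group_cong [OF comm_group_tensor_group]) (simp_all add: tensor_simps)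

lemma pure_tensor_closed:
  "\<lbrakk>x \<in> carrier M; y \<in> carrier N\<rbrakk> \<Longrightarrow> pure_tensor S M N x y \<in> carrier (tensor S M N)"
  unfolding pure_tensor_def tensor_simps tensor_group_def
  by (intro pres_class_closed) (auto simp: keys_frag_of)

lemma pure_tensor_add_left:
  assumes "x \<in> carrier M" "x' \<in> carrier M" "y \<in> carrier N"
  shows "pure_tensor S M N (x \<otimes>\<^bsub>M\<^esub> x') y =
         pure_tensor S M N x y \<otimes>\<^bsub>tensor S M N\<^esub> pure_tensor S M N x' y"
  unfolding pure_tensor_def tensor_simps tensor_group_def
  by (rule pres_class_add_eqI) (use assms in \<open>auto simp: tensor_rels_def\<close>)

lemma pure_tensor_add_right:
  assumes "x \<in> carrier M" "y \<in> carrier N" "y' \<in> carrier N"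
  shows "pure_tensor S M N x (y \<otimes>\<^bsub>N\<^esub> y') =
         pure_tensor S M N x y \<otimes>\<^bsub>tensor S M N\<^esub> pure_tensor S M N x y'"
  unfolding pure_tensor_def tensor_simps tensor_group_def
  by (rule pres_class_add_eqI) (use assms in \<open>auto simp: tensor_rels_def\<close>)

lemma pure_tensor_balanced:
  assumes "x \<in> carrier M" "s \<in> S" "y \<in> carrier N"
  shows "pure_tensor S M N (ract M x s) y = pure_tensor S M N x (lact N s y)"
  unfolding pure_tensor_def
  by (rule pres_class_eqI)
    (use assms ract_closed lact_closed in \<open>auto simp: tensor_rels_def keys_frag_of\<close>)

lemma tensor_hom_eqI:
  assumes "group G" "f \<in> hom (tensor S M N) G" "g \<in> hom (tensor S M N) G"
    "\<And>x y. \<lbrakk>x \<in> carrier M; y \<in> carrier N\<rbrakk> \<Longrightarrow> f (pure_tensor S M N x y) = g (pure_tensor S M N x y)"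
    "T \<in> carrier (tensor S M N)"
  shows "f T = g T"
  using assms unfolding hom_tensor unfolding pure_tensor_def tensor_simps tensor_group_def
  by (elim pres_hom_eqI) auto

lemma
  assumes G: "comm_group G"
    and closed: "\<And>x y. \<lbrakk>x \<in> carrier M; y \<in> carrier N\<rbrakk> \<Longrightarrow> \<beta> x y \<in> carrier G"
    and add_left: "\<And>x x' y. \<lbrakk>x \<in> carrier M; x' \<in> carrier M; y \<in> carrier N\<rbrakk> \<Longrightarrow>
                \<beta> (x \<otimes>\<^bsub>M\<^esub> x') y = \<beta> x y \<otimes>\<^bsub>G\<^esub> \<beta> x' y"
    and add_right: "\<And>x y y'. \<lbrakk>x \<in> carrier M; y \<in> carrier N; y' \<in> carrier N\<rbrakk> \<Longrightarrow>
                \<beta> x (y \<otimes>\<^bsub>N\<^esub> y') = \<beta> x y \<otimes>\<^bsub>G\<^esub> \<beta> x y'"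
    and balanced: "\<And>x s y. \<lbrakk>x \<in> carrier M; s \<in> S; y \<in> carrier N\<rbrakk> \<Longrightarrow>
                \<beta> (ract M x s) y = \<beta> x (lact N s y)"
  shows tensor_lift_hom: "pres_lift G (\<lambda>(x, y). \<beta> x y) \<in> hom (tensor S M N) G"
    and tensor_lift_pure: "\<lbrakk>x \<in> carrier M; y \<in> carrier N\<rbrakk> \<Longrightarrow>
           pres_lift G (\<lambda>(x, y). \<beta> x y) (pure_tensor S M N x y) = \<beta> x y"
proof -
  interpret G: comm_group G by (rule G)
  let ?\<beta> = "\<lambda>(x, y). \<beta> x y"
  have pi: "?\<beta> \<in> carrier M \<times> carrier N \<rightarrow> carrier G"
    using closed by auto
  have vanish: "frag_ext G ?\<beta> r = \<one>\<^bsub>G\<^esub>" if "r \<in> tensor_rels S M N" for r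
    using that unfolding tensor_rels_def
    by (auto intro!: G.frag_ext_additive_rel G.frag_ext_balanced_rel
        simp: closed add_left add_right balanced ract_closed lact_closed)
  show "pres_lift G ?\<beta> \<in> hom (tensor S M N) G"
    unfolding hom_tensor tensor_group_def by (rule pres_lift_hom [OF G pi vanish])
  show "pres_lift G ?\<beta> (pure_tensor S M N x y) = \<beta> x y" if "x \<in> carrier M" "y \<in> carrier N"
    unfolding pure_tensor_def using pres_lift_gen [OF G pi vanish, of "(x, y)"] that by simp
qed

lemma
  assumes "tensor_data S M' N'" and f: "f \<in> hom M M'" and g: "g \<in> hom N N'"
    and f_ract: "\<And>x s. \<lbrakk>x \<in> carrier M; s \<in> S\<rbrakk> \<Longrightarrow> f (ract M x s) = ract M' (f x) s"
    and g_lact: "\<And>y s. \<lbrakk>y \<in> carrier N; s \<in> S\<rbrakk> \<Longrightarrow> g (lact N s y) = lact N' s (g y)"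
  shows tensor_map_hom: "tensor_map S M' N' f g \<in> hom (tensor S M N) (tensor S M' N')"
    and tensor_map_pure: "\<lbrakk>x \<in> carrier M; y \<in> carrier N\<rbrakk> \<Longrightarrow>
           tensor_map S M' N' f g (pure_tensor S M N x y) = pure_tensor S M' N' (f x) (g y)"
proof -
  interpret T: tensor_data S M' N' by fact
  note closed = hom_in_carrier [OF f] hom_in_carrier [OF g]
  note facts = T.comm_group_tensor T.pure_tensor_closed T.pure_tensor_add_left
    T.pure_tensor_add_right T.pure_tensor_balanced closed hom_mult [OF f] hom_mult [OF g] f_ract g_lact
  show "tensor_map S M' N' f g \<in> hom (tensor S M N) (tensor S M' N')"
    unfolding tensor_map_def by (intro tensor_lift_hom) (simp_all add: facts)
  show "tensor_map S M' N' f g (pure_tensor S M N x y) = pure_tensor S M' N' (f x) (g y)"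
    if "x \<in> carrier M" "y \<in> carrier N"
    unfolding tensor_map_def by (rule tensor_lift_pure) (simp_all add: facts that)
qed

lemma
  assumes "lact M l \<in> hom M M"
    and "\<And>x s. \<lbrakk>x \<in> carrier M; s \<in> S\<rbrakk> \<Longrightarrow> lact M l (ract M x s) = ract M (lact M l x) s"
  shows tensor_lact_hom: "lact (tensor S M N) l \<in> hom (tensor S M N) (tensor S M N)"
    and tensor_lact_pure: "\<lbrakk>x \<in> carrier M; y \<in> carrier N\<rbrakk> \<Longrightarrow>
           lact (tensor S M N) l (pure_tensor S M N x y) = pure_tensor S M N (lact M l x) y"
proof -
  note facts = comm_group_tensor_group hom_in_carrier [OF assms(1)] hom_mult [OF assms(1)] assms(2)
    pure_tensor_closed [unfolded tensor_simps] pure_tensor_add_left [unfolded tensor_simps]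
    pure_tensor_add_right [unfolded tensor_simps] pure_tensor_balanced
  have eq: "lact (tensor S M N) l = pres_lift (tensor_group S M N) (\<lambda>(x, y). pure_tensor S M N (lact M l x) y)"
    by (simp add: tensor_def)
  show "lact (tensor S M N) l \<in> hom (tensor S M N) (tensor S M N)"
    unfolding eq hom_into_tensor by (intro tensor_lift_hom) (simp_all add: facts)
  show "lact (tensor S M N) l (pure_tensor S M N x y) = pure_tensor S M N (lact M l x) y"
    if "x \<in> carrier M" "y \<in> carrier N"
    unfolding eq by (rule tensor_lift_pure) (simp_all add: facts that)
qed

lemma
  assumes r: "(\<lambda>y. ract N y l) \<in> hom N N"
    and "\<And>y s. \<lbrakk>y \<in> carrier N; s \<in> S\<rbrakk> \<Longrightarrow> ract N (lact N s y) l = lact N s (ract N y l)"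
  shows tensor_ract_hom: "(\<lambda>t. ract (tensor S M N) t l) \<in> hom (tensor S M N) (tensor S M N)"
    and tensor_ract_pure: "\<lbrakk>x \<in> carrier M; y \<in> carrier N\<rbrakk> \<Longrightarrow>
           ract (tensor S M N) (pure_tensor S M N x y) l = pure_tensor S M N x (ract N y l)"
proof -
  note facts = comm_group_tensor_group hom_in_carrier [OF r] hom_mult [OF r] assms(2)
    pure_tensor_closed [unfolded tensor_simps] pure_tensor_add_left [unfolded tensor_simps]
    pure_tensor_add_right [unfolded tensor_simps] pure_tensor_balanced
  have eq: "(\<lambda>t. ract (tensor S M N) t l) =
      pres_lift (tensor_group S M N) (\<lambda>(x, y). pure_tensor S M N x (ract N y l))"
    by (simp add: tensor_def)
  show "(\<lambda>t. ract (tensor S M N) t l) \<in> hom (tensor S M N) (tensor S M N)"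
    unfolding eq hom_into_tensor by (intro tensor_lift_hom) (simp_all add: facts)
  show "ract (tensor S M N) (pure_tensor S M N x y) l = pure_tensor S M N x (ract N y l)"
    if "x \<in> carrier M" "y \<in> carrier N"
    using fun_cong [OF eq, of "pure_tensor S M N x y"]
    by (simp add: that, subst tensor_lift_pure) (simp_all add: facts that)
qed

end

section \<open>Finite direct sums of bimodules\<close>

lemma bimod_sum_simps:
  "carrier (bimod_sum J M) = (\<Pi>\<^sub>E i\<in>J. carrier (M i))"
  "x \<otimes>\<^bsub>bimod_sum J M\<^esub> y = (\<lambda>i\<in>J. x i \<otimes>\<^bsub>M i\<^esub> y i)"
  "\<one>\<^bsub>bimod_sum J M\<^esub> = (\<lambda>i\<in>J. \<one>\<^bsub>M i\<^esub>)"
  "lact (bimod_sum J M) l x = (\<lambda>i\<in>J. lact (M i) l (x i))"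
  "ract (bimod_sum J M) x l = (\<lambda>i\<in>J. ract (M i) (x i) l)"
  by (simp_all add: bimod_sum_def)

lemma comm_group_bimod_sum:
  assumes "\<And>i. i \<in> J \<Longrightarrow> comm_group (M i)"
  shows "comm_group (bimod_sum J M)"
proof -
  have "comm_group (product_group J M)"
  proof (rule group.group_comm_groupI)
    show "group (product_group J M)"
      using assms comm_group.axioms(2) by (intro product_group) auto
    fix x y assume "x \<in> carrier (product_group J M)" "y \<in> carrier (product_group J M)"
    then show "x \<otimes>\<^bsub>product_group J M\<^esub> y = y \<otimes>\<^bsub>product_group J M\<^esub> x"
      using assms by (auto simp: fun_eq_iff PiE_iff intro!: comm_monoid.m_comm comm_group.axioms(1))
  qed
  then show ?thesis
    by (rule comm_group_cong) (simp_all add: bimod_sum_def)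
qed

lemma bimod_sum_component_hom: "i \<in> J \<Longrightarrow> (\<lambda>x. x i) \<in> hom (bimod_sum J M) (M i)"
  by (rule homI) (auto simp: bimod_sum_simps)

definition sum_inj :: "'i set \<Rightarrow> ('i \<Rightarrow> ('l, 'm) bimodule) \<Rightarrow> 'i \<Rightarrow> 'm \<Rightarrow> 'i \<Rightarrow> 'm" where
  "sum_inj J M j t = (\<lambda>i\<in>J. if i = j then t else \<one>\<^bsub>M i\<^esub>)"

lemma sum_inj_hom:
  assumes "\<And>i. i \<in> J \<Longrightarrow> group (M i)"
  shows "sum_inj J M j \<in> hom (M j) (bimod_sum J M)"
proof (rule homI)
  show "sum_inj J M j t \<in> carrier (bimod_sum J M)" if "t \<in> carrier (M j)" for t
    using that assms by (auto simp: sum_inj_def bimod_sum_simps PiE_iff group.is_monoid)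
  show "sum_inj J M j (t \<otimes>\<^bsub>M j\<^esub> u) = sum_inj J M j t \<otimes>\<^bsub>bimod_sum J M\<^esub> sum_inj J M j u" for t u
    using assms by (auto simp: sum_inj_def bimod_sum_simps fun_eq_iff group.is_monoid)
qed

lemma bimod_sum_hom_eqI:
  assumes J: "finite J" and M: "\<And>i. i \<in> J \<Longrightarrow> group (M i)" and G: "group G"
    and f: "f \<in> hom (bimod_sum J M) G" and g: "g \<in> hom (bimod_sum J M) G"
    and eq: "\<And>j t. \<lbrakk>j \<in> J; t \<in> carrier (M j)\<rbrakk> \<Longrightarrow> f (sum_inj J M j t) = g (sum_inj J M j t)"
    and x: "x \<in> carrier (bimod_sum J M)"
  shows "f x = g x"
proof -
  interpret S: group "bimod_sum J M"
  proof -
    have "group (product_group J M)"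
      using M by (intro product_group) auto
    then show "group (bimod_sum J M)"
      by (rule group_cong) (simp_all add: bimod_sum_def)
  qed
  interpret f: group_hom "bimod_sum J M" G f
    using f by (intro group_homI S.is_group G)
  interpret g: group_hom "bimod_sum J M" G g
    using g by (intro group_homI S.is_group G)
  \<comment> \<open>\<open>part A\<close> keeps the components of \<open>x\<close> in
    \<open>A\<close> and is zero elsewhere, so it runs from zero at \<open>A = {}\<close> to
    \<open>x\<close> at \<open>A = J\<close>, gaining one \<open>sum_inj\<close> at each step of the
    induction.\<close>
  define part where "part A = (\<lambda>i\<in>J. if i \<in> A then x i else \<one>\<^bsub>M i\<^esub>)" for A
  have part_closed: "part A \<in> carrier (bimod_sum J M)" for A
    using x M by (auto simp: part_def bimod_sum_simps PiE_iff group.is_monoid)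
  have "f (part A) = g (part A)" if "A \<subseteq> J" for A
    using finite_subset [OF that J] that
  proof (induction A rule: finite_induct)
    case empty
    have "part {} = \<one>\<^bsub>bimod_sum J M\<^esub>"
      by (simp add: part_def bimod_sum_simps)
    then show ?case
      by simp
  next
    case (insert j A)
    have xj: "x j \<in> carrier (M j)"
      using x insert.prems by (auto simp: bimod_sum_simps PiE_iff)
    have "part (insert j A) = sum_inj J M j (x j) \<otimes>\<^bsub>bimod_sum J M\<^esub> part A"
      using x insert M
      by (auto simp: part_def sum_inj_def bimod_sum_simps fun_eq_iff PiE_iff group.is_monoid monoid.r_one monoid.l_one)
    moreover have "sum_inj J M j (x j) \<in> carrier (bimod_sum J M)"
      using M by (intro hom_in_carrier [OF sum_inj_hom [of J M j] xj])
    ultimately show ?case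
      using insert part_closed eq [OF _ xj] by simp
  qed
  moreover have "part J = x"
    using x by (auto simp: part_def bimod_sum_simps fun_eq_iff PiE_iff extensional_def)
  ultimately show ?thesis
    by (metis order_refl)
qed

section \<open>Bimodules over a ring, and the regular one\<close>

locale bimodule_on = ring L for L (structure) +
  fixes M :: "('l, 'm) bimodule"
  assumes bimod_group: "comm_group M"
    and lact_hom: "l \<in> carrier L \<Longrightarrow> lact M l \<in> hom M M"
    and ract_hom: "l \<in> carrier L \<Longrightarrow> (\<lambda>x. ract M x l) \<in> hom M M"
    and lact_add: "\<lbrakk>l \<in> carrier L; l' \<in> carrier L; x \<in> carrier M\<rbrakk> \<Longrightarrow>
                     lact M (l \<oplus> l') x = lact M l x \<otimes>\<^bsub>M\<^esub> lact M l' x"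
    and ract_add: "\<lbrakk>l \<in> carrier L; l' \<in> carrier L; x \<in> carrier M\<rbrakk> \<Longrightarrow>
                     ract M x (l \<oplus> l') = ract M x l \<otimes>\<^bsub>M\<^esub> ract M x l'"
    and lact_mult: "\<lbrakk>l \<in> carrier L; l' \<in> carrier L; x \<in> carrier M\<rbrakk> \<Longrightarrow>
                     lact M (l \<otimes> l') x = lact M l (lact M l' x)"
    and ract_mult: "\<lbrakk>l \<in> carrier L; l' \<in> carrier L; x \<in> carrier M\<rbrakk> \<Longrightarrow>
                     ract M x (l \<otimes> l') = ract M (ract M x l) l'"
    and lact_ract: "\<lbrakk>l \<in> carrier L; l' \<in> carrier L; x \<in> carrier M\<rbrakk> \<Longrightarrow>
                     lact M l (ract M x l') = ract M (lact M l x) l'"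
begin

lemma lact_closed: "\<lbrakk>l \<in> carrier L; x \<in> carrier M\<rbrakk> \<Longrightarrow> lact M l x \<in> carrier M"
  by (rule hom_in_carrier [OF lact_hom])

lemma ract_closed: "\<lbrakk>l \<in> carrier L; x \<in> carrier M\<rbrakk> \<Longrightarrow> ract M x l \<in> carrier M"
  by (rule hom_in_carrier [OF ract_hom])

end

lemma (in ring) comm_group_regular: "comm_group (regular R)"
  by (rule comm_group_cong [OF a_comm_group]) (simp_all add: regular_def)

lemma regular_simps:
  "carrier (regular L) = carrier L" "monoid.mult (regular L) = add L" "one (regular L) = zero L"
  "lact (regular L) = monoid.mult L" "ract (regular L) = monoid.mult L"
  by (simp_all add: regular_def)

lemma (in ring) bimodule_on_regular: "bimodule_on R (regular R)"
  by (intro bimodule_on.intro bimodule_on_axioms.intro ring_axioms)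
    (auto simp: regular_simps comm_group_regular hom_def l_distr r_distr m_assoc)

lemma bimodule_on_tensor_data:
  assumes "bimodule_on L M" "bimodule_on L N"
  shows "tensor_data (carrier L) M N"
proof -
  interpret M: bimodule_on L M by fact
  interpret N: bimodule_on L N by fact
  show ?thesis
    by (intro tensor_data.intro) (auto intro: M.bimod_group N.bimod_group M.ract_closed N.lact_closed)
qed

section \<open>The path algebra and its quotient\<close>

definition path_prod :: "path \<Rightarrow> path \<Rightarrow> 'k::field \<Rightarrow> 'k pathalg" where
  "path_prod p r c = (if path_end p = fst r then Poly_Mapping.single (fst p, snd p @ snd r) c else 0)"

text \<open>The supports of the factors are replaced by larger finite sets, so that bilinearity
  holds term by term even where coefficients cancel.\<close>

lemma path_mult_superset:
  assumes "finite A" "finite B" "Poly_Mapping.keys f \<subseteq> A" "Poly_Mapping.keys g \<subseteq> B"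
  shows "path_mult f g = (\<Sum>p\<in>A. \<Sum>r\<in>B. path_prod p r (Poly_Mapping.lookup f p * Poly_Mapping.lookup g r))"
proof -
  have "path_mult f g = (\<Sum>p\<in>Poly_Mapping.keys f. \<Sum>r\<in>B. path_prod p r (Poly_Mapping.lookup f p * Poly_Mapping.lookup g r))"
    unfolding path_mult_def path_prod_def using assms
    by (intro sum.cong sum.mono_neutral_left refl) (auto simp: in_keys_iff)
  also have "\<dots> = (\<Sum>p\<in>A. \<Sum>r\<in>B. path_prod p r (Poly_Mapping.lookup f p * Poly_Mapping.lookup g r))"
    using assms by (intro sum.mono_neutral_left) (auto simp: in_keys_iff path_prod_def intro!: sum.neutral)
  finally show ?thesis .
qed

lemma path_mult_add_left: "path_mult (f + f') g = path_mult f g + path_mult f' g"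
proof -
  let ?A = "Poly_Mapping.keys f \<union> Poly_Mapping.keys f'"
  have "Poly_Mapping.keys (f + f') \<subseteq> ?A"
    by (rule keys_add)
  then show ?thesis
    by (simp add: path_mult_superset [of ?A "Poly_Mapping.keys g"] path_prod_def lookup_add
        algebra_simps single_add if_distrib sum.distrib [symmetric] cong: if_cong)
qed

lemma path_mult_add_right: "path_mult f (g + g') = path_mult f g + path_mult f g'"
proof -
  let ?A = "Poly_Mapping.keys g \<union> Poly_Mapping.keys g'"
  have "Poly_Mapping.keys (g + g') \<subseteq> ?A"
    by (rule keys_add)
  then show ?thesis
    by (simp add: path_mult_superset [of "Poly_Mapping.keys f" ?A] path_prod_def lookup_add
        algebra_simps single_add if_distrib sum.distrib [symmetric] cong: if_cong)
qed

lemma path_mult_zero [simp]: "path_mult 0 g = 0" "path_mult f 0 = 0"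
  by (simp_all add: path_mult_def)

lemma path_mult_single:
  "path_mult (Poly_Mapping.single p x) (Poly_Mapping.single r y) = path_prod p r (x * y)"
  by (simp add: path_mult_superset [of "{p}" "{r}"])

text \<open>A weighted path already carries its scalar, so closure under sums is all that linearity
  has to supply.\<close>

lemma pathalg_induct [case_names zero single add]:
  assumes "P 0" "\<And>p c. P (Poly_Mapping.single p c)" "\<And>f g. P f \<Longrightarrow> P g \<Longrightarrow> P (f + g)"
  shows "P (f :: 'k::field pathalg)"
proof -
  have "f = (\<Sum>p\<in>Poly_Mapping.keys f. Poly_Mapping.single p (Poly_Mapping.lookup f p))"
    by (rule poly_mapping_eqI)
      (auto simp: lookup_sum lookup_single when_def in_keys_iff)
  moreover have "P (\<Sum>p\<in>A. Poly_Mapping.single p (c p))" for A c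
    by (induction A rule: infinite_finite_induct) (auto intro: assms)
  ultimately show ?thesis
    by metis
qed

lemma path_end_append: "path_end p = fst r \<Longrightarrow> path_end (fst p, snd p @ snd r) = path_end r"
  by (auto simp: path_end_def split: if_splits)

text \<open>Both sides are trilinear, so nested induction leaves three weighted paths, where
  associativity is that of concatenation and both sides vanish unless consecutive ends meet.\<close>

lemma path_mult_assoc: "path_mult (path_mult f g) h = path_mult f (path_mult g h)"
proof (induction f rule: pathalg_induct)
  case (single p x)
  show ?case
  proof (induction g rule: pathalg_induct)
    case (single r y)
    show ?case
    proof (induction h rule: pathalg_induct)
      case (single s z)
      show ?case
        by (auto simp: path_mult_single path_prod_def path_end_append mult.assoc)
    qed (auto simp: path_mult_add_left path_mult_add_right)
  qed (auto simp: path_mult_add_left path_mult_add_right)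
qed (auto simp: path_mult_add_left path_mult_add_right)

lemma lookup_path_mult_vertex_left:
  "Poly_Mapping.lookup (path_mult (Poly_Mapping.single (v, []) c) f) p =
     (if fst p = v then c * Poly_Mapping.lookup f p else 0)"
proof (induction f rule: pathalg_induct)
  case (single r y)
  show ?case
    by (auto simp: path_mult_single path_prod_def path_end_def lookup_single when_def)
qed (auto simp: path_mult_add_right lookup_add algebra_simps)

lemma lookup_path_mult_vertex_right:
  "Poly_Mapping.lookup (path_mult f (Poly_Mapping.single (v, []) c)) p =
     (if path_end p = v then Poly_Mapping.lookup f p * c else 0)"
proof (induction f rule: pathalg_induct)
  case (single r y)
  show ?case
    by (cases p; cases r) (auto simp: path_mult_single path_prod_def lookup_single when_def)
qed (auto simp: path_mult_add_left lookup_add algebra_simps)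

lemma vertex_cases: "v = V1 \<or> v = V2"
  by (cases v) auto

text \<open>A path has one origin and one end among the two vertices, so exactly one summand of
  \<open>path_scalar t\<close> contributes to each coefficient.\<close>

lemma lookup_path_scalar_mult:
  "Poly_Mapping.lookup (path_mult (path_scalar t) f) p = t * Poly_Mapping.lookup f p"
  "Poly_Mapping.lookup (path_mult f (path_scalar t)) p = t * Poly_Mapping.lookup f p"
  using vertex_cases [of "fst p"] vertex_cases [of "path_end p"]
  by (auto simp: path_scalar_def path_mult_add_left path_mult_add_right lookup_add
      lookup_path_mult_vertex_left lookup_path_mult_vertex_right)

lemma chain_from_append:
  "chain_from v (xs @ ys) \<longleftrightarrow> chain_from v xs \<and> chain_from (path_end (v, xs)) ys"
  by (induction xs arbitrary: v) (auto simp: path_end_def)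

lemma path_algebra_simps:
  "f \<in> carrier path_algebra \<longleftrightarrow> Poly_Mapping.keys f \<subseteq> {p. is_path p}"
  "monoid.mult path_algebra = path_mult" "one path_algebra = path_scalar 1"
  "zero path_algebra = 0" "add path_algebra = (+)"
  by (simp_all add: path_algebra_def)

lemma path_mult_closed:
  assumes "f \<in> carrier path_algebra" "g \<in> carrier path_algebra"
  shows "path_mult f g \<in> carrier path_algebra"
proof -
  have "Poly_Mapping.keys (path_prod p r c :: 'a pathalg) \<subseteq> {p. is_path p}" if "is_path p" "is_path r" for p r c
    using that by (auto simp: path_prod_def is_path_def chain_from_append)
  moreover have "path_mult f g = (\<Sum>p\<in>Poly_Mapping.keys f. \<Sum>r\<in>Poly_Mapping.keys g.
      path_prod p r (Poly_Mapping.lookup f p * Poly_Mapping.lookup g r))"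
    by (rule path_mult_superset) auto
  ultimately show ?thesis
    using assms unfolding path_algebra_simps
    by (auto dest!: subsetD [OF keys_sum]) blast
qed

lemma path_elem_closed: "chain_from v xs \<Longrightarrow> path_elem v xs \<in> carrier path_algebra"
  by (auto simp: path_elem_def path_algebra_simps is_path_def)

lemma path_scalar_closed: "path_scalar t \<in> carrier path_algebra"
  unfolding path_scalar_def path_algebra_simps
  by (auto dest!: subsetD [OF keys_add] simp: is_path_def split: if_splits)

lemma ring_path_algebra: "ring (path_algebra :: 'k::field pathalg ring)"
proof (rule ringI)
  show "abelian_group (path_algebra :: 'k pathalg ring)"
  proof (rule abelian_groupI; unfold path_algebra_simps)
    fix x :: "'k pathalg" assume x: "Poly_Mapping.keys x \<subseteq> {p. is_path p}"
    show "\<exists>y\<in>carrier path_algebra. y + x = 0"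
      using x by (intro bexI [of _ "- x"]) (auto simp: path_algebra_simps keys_minus)
  qed (auto dest!: subsetD [OF keys_add])
  show "monoid (path_algebra :: 'k pathalg ring)"
    by (rule monoidI)
      (auto simp: path_mult_assoc path_algebra_simps(2-) intro!: path_scalar_closed path_mult_closed
        poly_mapping_eqI simp: lookup_path_scalar_mult)
qed (auto simp: path_algebra_simps(2-) path_mult_add_left path_mult_add_right)

lemma relations_closed: "relations q \<subseteq> carrier path_algebra"
proof -
  interpret P: ring "path_algebra :: 'a pathalg ring"
    by (rule ring_path_algebra)
  have "f - g \<in> carrier path_algebra"
    if "f \<in> carrier path_algebra" "g \<in> carrier path_algebra" for f g :: "'a pathalg"
    using that by (auto simp: path_algebra_simps dest!: subsetD [OF keys_diff])
  note diff = this
  show ?thesis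
    unfolding relations_def by (auto intro!: diff path_elem_closed path_mult_closed path_scalar_closed)
qed

text \<open>An upper bound for \<open>rel_ideal q\<close>: an ideal that contains the four
  relations, while vertices and single arrows have coefficient zero in all its elements.\<close>

definition long_paths :: "'k::field pathalg set" where
  "long_paths = {f \<in> carrier path_algebra. \<forall>p. length (snd p) \<le> 1 \<longrightarrow> Poly_Mapping.lookup f p = 0}"

text \<open>The coefficient at \<open>p\<close> is a sum over the factorisations of \<open>p\<close>
  into two composable paths.\<close>

lemma lookup_path_mult_eq_0:
  assumes "\<And>r s. \<lbrakk>path_end r = fst s; p = (fst r, snd r @ snd s)\<rbrakk> \<Longrightarrow>
             Poly_Mapping.lookup f r * Poly_Mapping.lookup g s = 0"
  shows "Poly_Mapping.lookup (path_mult f g) p = 0"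
  using assms
  by (subst path_mult_superset [OF _ _ order_refl order_refl])
    (auto simp: lookup_sum path_prod_def lookup_single when_def intro!: sum.neutral)

lemma ideal_long_paths: "ideal (long_paths :: 'k::field pathalg set) path_algebra"
proof -
  interpret P: ring "path_algebra :: 'k pathalg ring"
    by (rule ring_path_algebra)
  show ?thesis
  proof (rule idealI [OF ring_path_algebra])
    show "subgroup (long_paths :: 'k pathalg set) (add_monoid path_algebra)"
    proof (rule P.add.subgroupI)
      fix f :: "'k pathalg" assume "f \<in> long_paths"
      moreover have "\<ominus>\<^bsub>path_algebra\<^esub> f = - f" if "f \<in> carrier path_algebra"
        using that by (intro P.minus_equality) (auto simp: path_algebra_simps keys_minus)
      ultimately show "\<ominus>\<^bsub>path_algebra\<^esub> f \<in> long_paths"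
        by (auto simp: long_paths_def path_algebra_simps keys_minus)
    next
      have "0 \<in> (long_paths :: 'k pathalg set)"
        by (auto simp: long_paths_def path_algebra_simps)
      then show "(long_paths :: 'k pathalg set) \<noteq> {}"
        by blast
    qed (auto simp: long_paths_def path_algebra_simps lookup_add dest!: subsetD [OF keys_add])
  \<comment> \<open>If a product path has length at most one, so has each factor, and the factor
    taken from the ideal has coefficient zero there.\<close>
  qed (auto simp: long_paths_def path_algebra_simps(2-) path_mult_closed intro!: lookup_path_mult_eq_0)
qed

text \<open>All four relations are combinations of paths of length two, and \<open>genideal\<close>
  is the least ideal containing them.\<close>

lemma rel_ideal_subset_long_paths: "rel_ideal q \<subseteq> long_paths"
proof -
  interpret P: ring "path_algebra :: 'a pathalg ring"
    by (rule ring_path_algebra)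
  have "r \<in> long_paths" if "r \<in> relations q" for r
    using that relations_closed
    by (auto simp: long_paths_def) (auto simp: relations_def lookup_minus lookup_path_scalar_mult path_elem_def lookup_single when_def)
  then show ?thesis
    unfolding rel_ideal_def by (intro P.genideal_minimal ideal_long_paths) auto
qed

section \<open>The algebra \<Lambda> with its scalars, idempotents and arrows\<close>

locale quiver_algebra =
  fixes q :: "'k::field"
begin

abbreviation "L \<equiv> Lam q"

sublocale P: ring "path_algebra :: 'k pathalg ring"
  by (rule ring_path_algebra)

sublocale I: ideal "rel_ideal q" "path_algebra :: 'k pathalg ring"
  unfolding rel_ideal_def by (rule P.genideal_ideal [OF relations_closed])

sublocale L: ring "Lam q"
  unfolding Lam_def by (rule I.quotient_is_ring)

lemma class_hom: "lam_class q \<in> ring_hom path_algebra L"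
  using I.rcos_ring_hom unfolding lam_class_def Lam_def .

lemma class_closed: "f \<in> carrier path_algebra \<Longrightarrow> lam_class q f \<in> carrier L"
  by (rule ring_hom_closed [OF class_hom])

lemma class_mult:
  "\<lbrakk>f \<in> carrier path_algebra; g \<in> carrier path_algebra\<rbrakk> \<Longrightarrow>
     lam_class q f \<otimes>\<^bsub>L\<^esub> lam_class q g = lam_class q (path_mult f g)"
  using ring_hom_mult [OF class_hom] by (simp add: path_algebra_simps(2))

lemma class_add:
  "\<lbrakk>f \<in> carrier path_algebra; g \<in> carrier path_algebra\<rbrakk> \<Longrightarrow>
     lam_class q f \<oplus>\<^bsub>L\<^esub> lam_class q g = lam_class q (f + g)"
  using ring_hom_add [OF class_hom] by (simp add: path_algebra_simps(5))

lemma class_one: "\<one>\<^bsub>L\<^esub> = lam_class q (path_scalar 1)"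
  using ring_hom_one [OF class_hom] by (simp add: path_algebra_simps)

lemma class_zero: "\<zero>\<^bsub>L\<^esub> = lam_class q 0"
proof -
  interpret h: ring_hom_ring path_algebra L "lam_class q"
    by (rule ring_hom_ringI2 [OF P.ring_axioms L.ring_axioms class_hom])
  show ?thesis
    using h.hom_zero by (simp add: path_algebra_simps)
qed

lemma carrier_LamE:
  assumes "x \<in> carrier L"
  obtains f where "f \<in> carrier path_algebra" "x = lam_class q f"
  using assms unfolding Lam_def lam_class_def
  by (auto simp: FactRing_def A_RCOSETS_def' a_r_coset_def)

lemma idem_closed [simp]: "lam_idem q v \<in> carrier L"
  unfolding lam_idem_def by (intro class_closed path_elem_closed) simp

lemma arrow_closed [simp]: "lam_arrow q \<alpha> \<in> carrier L"
  unfolding lam_arrow_def by (intro class_closed path_elem_closed) simp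

lemma scalar_closed [simp]: "lam_scalar q t \<in> carrier L"
  unfolding lam_scalar_def by (intro class_closed path_scalar_closed)

lemma smult_closed [simp]: "x \<in> carrier L \<Longrightarrow> lam_smult q t x \<in> carrier L"
  by (simp add: lam_smult_def)

lemma scalar_commute: "x \<in> carrier L \<Longrightarrow> x \<otimes>\<^bsub>L\<^esub> lam_scalar q t = lam_scalar q t \<otimes>\<^bsub>L\<^esub> x"
proof -
  have "path_mult f (path_scalar t) = path_mult (path_scalar t) f" for f :: "'k pathalg"
    by (rule poly_mapping_eqI) (simp add: lookup_path_scalar_mult)
  then show "x \<otimes>\<^bsub>L\<^esub> lam_scalar q t = lam_scalar q t \<otimes>\<^bsub>L\<^esub> x" if "x \<in> carrier L"
    using that by (elim carrier_LamE) (simp add: lam_scalar_def class_mult path_scalar_closed)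
qed

lemma path_scalar_add: "path_scalar (s + t) = path_scalar s + path_scalar t"
  by (simp add: path_scalar_def single_add algebra_simps)

lemma path_scalar_mult: "path_mult (path_scalar s) (path_scalar t) = path_scalar (s * t)"
  by (rule poly_mapping_eqI)
    (simp add: lookup_path_scalar_mult, simp add: path_scalar_def lookup_add lookup_single when_def)

lemma scalar_add: "lam_scalar q (s + t) = lam_scalar q s \<oplus>\<^bsub>L\<^esub> lam_scalar q t"
  by (simp add: lam_scalar_def class_add path_scalar_closed path_scalar_add)

lemma scalar_mult: "lam_scalar q (s * t) = lam_scalar q s \<otimes>\<^bsub>L\<^esub> lam_scalar q t"
  by (simp add: lam_scalar_def class_mult path_scalar_closed path_scalar_mult)

lemma scalar_0: "lam_scalar q 0 = \<zero>\<^bsub>L\<^esub>"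
  by (simp add: lam_scalar_def class_zero path_scalar_def)

lemma scalar_1: "lam_scalar q 1 = \<one>\<^bsub>L\<^esub>"
  by (simp add: lam_scalar_def class_one)

lemma smult_0 [simp]: "x \<in> carrier L \<Longrightarrow> lam_smult q 0 x = \<zero>\<^bsub>L\<^esub>"
  by (simp add: lam_smult_def scalar_0)

lemma smult_1 [simp]: "x \<in> carrier L \<Longrightarrow> lam_smult q 1 x = x"
  by (simp add: lam_smult_def scalar_1)

lemma smult_zero [simp]: "lam_smult q t \<zero>\<^bsub>L\<^esub> = \<zero>\<^bsub>L\<^esub>"
  by (simp add: lam_smult_def)

lemma smult_add_left: "x \<in> carrier L \<Longrightarrow> lam_smult q (s + t) x = lam_smult q s x \<oplus>\<^bsub>L\<^esub> lam_smult q t x"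
  by (simp add: lam_smult_def scalar_add L.l_distr)

lemma smult_add: "\<lbrakk>x \<in> carrier L; y \<in> carrier L\<rbrakk> \<Longrightarrow>
    lam_smult q t (x \<oplus>\<^bsub>L\<^esub> y) = lam_smult q t x \<oplus>\<^bsub>L\<^esub> lam_smult q t y"
  by (simp add: lam_smult_def L.r_distr)

lemma smult_smult: "x \<in> carrier L \<Longrightarrow> lam_smult q s (lam_smult q t x) = lam_smult q (s * t) x"
  by (simp add: lam_smult_def scalar_mult L.m_assoc)

lemma smult_mult_left: "\<lbrakk>x \<in> carrier L; y \<in> carrier L\<rbrakk> \<Longrightarrow>
    lam_smult q t x \<otimes>\<^bsub>L\<^esub> y = lam_smult q t (x \<otimes>\<^bsub>L\<^esub> y)"
  by (simp add: lam_smult_def L.m_assoc)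

lemma smult_mult_right: "\<lbrakk>x \<in> carrier L; y \<in> carrier L\<rbrakk> \<Longrightarrow>
    x \<otimes>\<^bsub>L\<^esub> lam_smult q t y = lam_smult q t (x \<otimes>\<^bsub>L\<^esub> y)"
  by (simp add: lam_smult_def scalar_commute L.m_assoc [symmetric])

lemma smult_finsum: "f \<in> A \<rightarrow> carrier L \<Longrightarrow>
    lam_smult q t (finsum L f A) = (\<Oplus>\<^bsub>L\<^esub>i\<in>A. lam_smult q t (f i))"
  by (induction A rule: infinite_finite_induct) (auto simp: smult_add Pi_iff)

lemma smult_sum: "x \<in> carrier L \<Longrightarrow> lam_smult q (sum c A) x = (\<Oplus>\<^bsub>L\<^esub>i\<in>A. lam_smult q (c i) x)"
  by (induction A rule: infinite_finite_induct) (auto simp: smult_add_left)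

lemma idem_mult: "lam_idem q v \<otimes>\<^bsub>L\<^esub> lam_idem q w = (if v = w then lam_idem q v else \<zero>\<^bsub>L\<^esub>)"
  by (simp add: lam_idem_def class_mult path_elem_closed class_zero)
    (simp add: path_elem_def path_mult_single path_prod_def path_end_def)

lemma scalar_eq: "lam_scalar q t = lam_smult q t (lam_idem q V1) \<oplus>\<^bsub>L\<^esub> lam_smult q t (lam_idem q V2)"
proof -
  have "path_scalar 1 = (path_elem V1 [] + path_elem V2 [] :: 'k pathalg)"
    by (simp add: path_scalar_def path_elem_def)
  then have "\<one>\<^bsub>L\<^esub> = lam_idem q V1 \<oplus>\<^bsub>L\<^esub> lam_idem q V2"
    by (simp add: class_one lam_idem_def class_add path_elem_closed)
  then show ?thesis
    by (simp add: lam_smult_def flip: L.r_distr) (metis L.r_one scalar_closed)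
qed

text \<open>Independent of the representative, as the ideal contains only combinations of paths of length at least two.\<close>

definition arrow_coeff :: "arrow \<Rightarrow> 'k quot \<Rightarrow> 'k" where
  "arrow_coeff \<alpha> x = Poly_Mapping.lookup (SOME f. f \<in> x) (src \<alpha>, [\<alpha>])"

lemma arrow_coeff_class:
  assumes "f \<in> carrier path_algebra"
  shows "arrow_coeff \<alpha> (lam_class q f) = Poly_Mapping.lookup f (src \<alpha>, [\<alpha>])"
proof -
  have "f \<in> lam_class q f"
    unfolding lam_class_def by (rule I.a_rcos_self [OF assms])
  then have "(SOME g. g \<in> lam_class q f) \<in> lam_class q f"
    by (rule someI)
  then obtain i where "i \<in> rel_ideal q" "(SOME g. g \<in> lam_class q f) = i + f"
    unfolding lam_class_def by (auto simp: a_r_coset_def' path_algebra_simps(5))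
  then show ?thesis
    using rel_ideal_subset_long_paths [of q] by (auto simp: arrow_coeff_def lookup_add long_paths_def)
qed

lemma arrow_coeff_add:
  "\<lbrakk>x \<in> carrier L; y \<in> carrier L\<rbrakk> \<Longrightarrow> arrow_coeff \<alpha> (x \<oplus>\<^bsub>L\<^esub> y) = arrow_coeff \<alpha> x + arrow_coeff \<alpha> y"
  by (elim carrier_LamE)
    (simp add: class_add arrow_coeff_class lookup_add P.a_closed [unfolded path_algebra_simps(5)])

lemma arrow_coeff_arrow: "arrow_coeff \<alpha> (lam_arrow q \<beta>) = (if \<alpha> = \<beta> then 1 else 0)"
  by (auto simp: lam_arrow_def arrow_coeff_class path_elem_closed) (auto simp: path_elem_def lookup_single when_def)

text \<open>Later arguments about balancing over \<Lambda>_0 rest on this rule: c1 e1 + c2 e2 acts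
  on whatever starts or ends at \<open>v\<close> as the scalar \<open>\<sigma> v\<close>, and it
  multiplies the coefficient of an arrow by \<open>\<sigma>\<close> at its source or target.
  Equations over \<Lambda>_0 thus become equations in the field.\<close>

lemma Lam0E:
  assumes "s \<in> Lam0 q"
  obtains \<sigma> where "s \<in> carrier L"
    "\<And>z v. \<lbrakk>z \<in> carrier L; lam_idem q v \<otimes>\<^bsub>L\<^esub> z = z\<rbrakk> \<Longrightarrow> s \<otimes>\<^bsub>L\<^esub> z = lam_smult q (\<sigma> v) z"
    "\<And>z v. \<lbrakk>z \<in> carrier L; z \<otimes>\<^bsub>L\<^esub> lam_idem q v = z\<rbrakk> \<Longrightarrow> z \<otimes>\<^bsub>L\<^esub> s = lam_smult q (\<sigma> v) z"
    "\<And>x \<alpha>. x \<in> carrier L \<Longrightarrow> arrow_coeff \<alpha> (s \<otimes>\<^bsub>L\<^esub> x) = \<sigma> (src \<alpha>) * arrow_coeff \<alpha> x"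
    "\<And>x \<alpha>. x \<in> carrier L \<Longrightarrow> arrow_coeff \<alpha> (x \<otimes>\<^bsub>L\<^esub> s) = \<sigma> (tgt \<alpha>) * arrow_coeff \<alpha> x"
proof -
  obtain c1 c2 where s: "s = lam_smult q c1 (lam_idem q V1) \<oplus>\<^bsub>L\<^esub> lam_smult q c2 (lam_idem q V2)"
    using assms by (auto simp: Lam0_def)
  define \<sigma> where "\<sigma> = (\<lambda>v. case v of V1 \<Rightarrow> c1 | V2 \<Rightarrow> c2)"
  let ?s = "Poly_Mapping.single (V1, []) c1 + Poly_Mapping.single (V2, []) c2 :: 'k pathalg"
  have s_closed: "s \<in> carrier L"
    by (simp add: s)
  have ps: "?s \<in> carrier path_algebra"
    unfolding path_algebra_simps
    by (auto dest!: subsetD [OF keys_add] simp: is_path_def split: if_splits)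
  have sc: "path_mult (path_scalar c) (path_elem v []) = Poly_Mapping.single (v, []) c" for c v
    by (rule poly_mapping_eqI) (auto simp: lookup_path_scalar_mult path_elem_def lookup_single when_def)
  have s': "s = lam_class q ?s"
    unfolding s lam_smult_def lam_scalar_def lam_idem_def
    by (simp add: class_mult class_add path_scalar_closed path_elem_closed path_mult_closed flip: sc)
  have smult_left: "s \<otimes>\<^bsub>L\<^esub> z = lam_smult q (\<sigma> v) z"
    if z: "z \<in> carrier L" "lam_idem q v \<otimes>\<^bsub>L\<^esub> z = z" for z v
  proof -
    have "s \<otimes>\<^bsub>L\<^esub> lam_idem q v = lam_smult q (\<sigma> v) (lam_idem q v)"
      by (cases v) (simp_all add: s \<sigma>_def L.l_distr smult_mult_left idem_mult)
    then have "s \<otimes>\<^bsub>L\<^esub> (lam_idem q v \<otimes>\<^bsub>L\<^esub> z) = lam_smult q (\<sigma> v) (lam_idem q v \<otimes>\<^bsub>L\<^esub> z)"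
      using z(1) s_closed by (simp add: smult_mult_left flip: L.m_assoc)
    with z show ?thesis
      by simp
  qed
  have smult_right: "z \<otimes>\<^bsub>L\<^esub> s = lam_smult q (\<sigma> v) z"
    if z: "z \<in> carrier L" "z \<otimes>\<^bsub>L\<^esub> lam_idem q v = z" for z v
  proof -
    have "lam_idem q v \<otimes>\<^bsub>L\<^esub> s = lam_smult q (\<sigma> v) (lam_idem q v)"
      by (cases v) (simp_all add: s \<sigma>_def L.r_distr smult_mult_right idem_mult)
    then have "(z \<otimes>\<^bsub>L\<^esub> lam_idem q v) \<otimes>\<^bsub>L\<^esub> s = lam_smult q (\<sigma> v) (z \<otimes>\<^bsub>L\<^esub> lam_idem q v)"
      using z(1) s_closed by (simp add: smult_mult_right L.m_assoc)
    with z show ?thesis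
      by simp
  qed
  have l: "arrow_coeff \<alpha> (s \<otimes>\<^bsub>L\<^esub> x) = \<sigma> (src \<alpha>) * arrow_coeff \<alpha> x" if x: "x \<in> carrier L" for x \<alpha>
  proof -
    obtain f where f: "f \<in> carrier path_algebra" "x = lam_class q f"
      using x by (rule carrier_LamE)
    have "arrow_coeff \<alpha> (s \<otimes>\<^bsub>L\<^esub> x) = Poly_Mapping.lookup (path_mult ?s f) (src \<alpha>, [\<alpha>])"
      by (simp add: s' f class_mult ps arrow_coeff_class path_mult_closed)
    also have "\<dots> = \<sigma> (src \<alpha>) * arrow_coeff \<alpha> x"
      by (cases \<alpha>) (simp_all add: f arrow_coeff_class path_mult_add_left lookup_add
          lookup_path_mult_vertex_left \<sigma>_def)
    finally show ?thesis .
  qed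
  have r: "arrow_coeff \<alpha> (x \<otimes>\<^bsub>L\<^esub> s) = \<sigma> (tgt \<alpha>) * arrow_coeff \<alpha> x" if x: "x \<in> carrier L" for x \<alpha>
  proof -
    obtain f where f: "f \<in> carrier path_algebra" "x = lam_class q f"
      using x by (rule carrier_LamE)
    have "arrow_coeff \<alpha> (x \<otimes>\<^bsub>L\<^esub> s) = Poly_Mapping.lookup (path_mult f ?s) (src \<alpha>, [\<alpha>])"
      by (simp add: s' f class_mult ps arrow_coeff_class path_mult_closed)
    also have "\<dots> = \<sigma> (tgt \<alpha>) * arrow_coeff \<alpha> x"
      by (cases \<alpha>) (simp_all add: f arrow_coeff_class path_mult_add_right lookup_add
          lookup_path_mult_vertex_right \<sigma>_def path_end_def)
    finally show ?thesis .
  qed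
  show ?thesis
    by (rule that [OF s_closed smult_left smult_right l r])
qed

lemma Scal_subset_Lam0: "Scal q \<subseteq> Lam0 q"
  unfolding Scal_def Lam0_def using scalar_eq by blast

end

section \<open>The bar resolution\<close>

lemma hom_comp: "\<lbrakk>f \<in> hom G H; g \<in> hom H I\<rbrakk> \<Longrightarrow> (\<lambda>x. g (f x)) \<in> hom G I"
  using Group.hom_compose [of f G H g I] by (simp add: o_def)

lemma hom_pointwise_mult:
  assumes "comm_group H" "f \<in> hom G H" "g \<in> hom G H"
  shows "(\<lambda>x. f x \<otimes>\<^bsub>H\<^esub> g x) \<in> hom G H"
proof -
  interpret H: comm_group H by fact
  show ?thesis
    using hom_in_carrier [OF assms(2)] hom_in_carrier [OF assms(3)]
    by (intro homI) (simp_all add: hom_mult [OF assms(2)] hom_mult [OF assms(3)] H.m_ac)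
qed

context quiver_algebra
begin

lemma Lam0_closed: "s \<in> Lam0 q \<Longrightarrow> s \<in> carrier L"
  by (elim Lam0E)

lemma bar_gens_append:
  "us @ vs \<in> bar_gens q n \<longleftrightarrow> length us + length vs = n + 2 \<and> set us \<subseteq> carrier L \<and> set vs \<subseteq> carrier L"
  by (auto simp: bar_gens_def)

lemma presentation_bar: "presentation (bar_gens q n) (bar_rels q n)"
proof
  fix r assume "r \<in> bar_rels q n"
  then show "Poly_Mapping.keys r \<subseteq> bar_gens q n"
    unfolding bar_rels_def
    by (auto dest!: subsetD [OF keys_diff] simp: keys_frag_of bar_gens_append Lam0_closed)
qed

lemma Bar_simps:
  "carrier (Bar q n) = carrier (pres_group (bar_gens q n) (bar_rels q n))"
  "monoid.mult (Bar q n) = monoid.mult (pres_group (bar_gens q n) (bar_rels q n))"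
  "one (Bar q n) = one (pres_group (bar_gens q n) (bar_rels q n))"
  by (simp_all add: Bar_def bar_group_def)

lemma hom_Bar: "hom (Bar q n) G = hom (pres_group (bar_gens q n) (bar_rels q n)) G"
  by (simp add: hom_def Bar_simps)

lemma hom_into_Bar: "hom G (Bar q n) = hom G (pres_group (bar_gens q n) (bar_rels q n))"
  by (simp add: hom_def Bar_simps)

lemma comm_group_Bar: "comm_group (Bar q n)"
  by (rule comm_group_cong [OF presentation.comm_group_pres [OF presentation_bar]]) (simp_all add: Bar_simps)

lemma bar_pure_closed: "xs \<in> bar_gens q n \<Longrightarrow> bar_pure q n xs \<in> carrier (Bar q n)"
  unfolding bar_pure_def Bar_simps
  by (rule presentation.pres_class_closed [OF presentation_bar]) (simp add: keys_frag_of)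

lemma bar_pure_add:
  assumes "us @ [x] @ vs \<in> bar_gens q n" "y \<in> carrier L"
  shows "bar_pure q n (us @ [x \<oplus>\<^bsub>L\<^esub> y] @ vs) =
         bar_pure q n (us @ [x] @ vs) \<otimes>\<^bsub>Bar q n\<^esub> bar_pure q n (us @ [y] @ vs)"
  unfolding bar_pure_def Bar_simps
proof (rule presentation.pres_class_add_eqI [OF presentation_bar])
  show "frag_of (us @ [x \<oplus>\<^bsub>L\<^esub> y] @ vs) - frag_of (us @ [x] @ vs) - frag_of (us @ [y] @ vs) \<in> bar_rels q n"
    using assms unfolding bar_rels_def by blast
qed (use assms in \<open>auto simp: bar_gens_append\<close>)

lemma bar_pure_balanced:
  assumes "us @ [x, y] @ vs \<in> bar_gens q n" "s \<in> Lam0 q"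
  shows "bar_pure q n (us @ [x \<otimes>\<^bsub>L\<^esub> s, y] @ vs) = bar_pure q n (us @ [x, s \<otimes>\<^bsub>L\<^esub> y] @ vs)"
  unfolding bar_pure_def
proof (rule presentation.pres_class_eqI [OF presentation_bar])
  show "frag_of (us @ [x \<otimes>\<^bsub>L\<^esub> s, y] @ vs) - frag_of (us @ [x, s \<otimes>\<^bsub>L\<^esub> y] @ vs) \<in> bar_rels q n"
    using assms unfolding bar_rels_def by blast
qed (use assms Lam0_closed in \<open>auto simp: bar_gens_append keys_frag_of\<close>)

lemma Bar_hom_eqI:
  assumes "group G" "f \<in> hom (Bar q n) G" "g \<in> hom (Bar q n) G"
    "\<And>xs. xs \<in> bar_gens q n \<Longrightarrow> f (bar_pure q n xs) = g (bar_pure q n xs)"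
    "T \<in> carrier (Bar q n)"
  shows "f T = g T"
  using assms unfolding hom_Bar unfolding bar_pure_def Bar_simps
  by (elim presentation.pres_hom_eqI [OF presentation_bar]) auto

lemma
  assumes G: "comm_group G"
    and closed: "\<And>xs. xs \<in> bar_gens q n \<Longrightarrow> \<beta> xs \<in> carrier G"
    and add: "\<And>us x y vs. \<lbrakk>us @ [x] @ vs \<in> bar_gens q n; y \<in> carrier L\<rbrakk> \<Longrightarrow>
        \<beta> (us @ [x \<oplus>\<^bsub>L\<^esub> y] @ vs) = \<beta> (us @ [x] @ vs) \<otimes>\<^bsub>G\<^esub> \<beta> (us @ [y] @ vs)"
    and balanced: "\<And>us x s y vs. \<lbrakk>us @ [x, y] @ vs \<in> bar_gens q n; s \<in> Lam0 q\<rbrakk> \<Longrightarrow>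
        \<beta> (us @ [x \<otimes>\<^bsub>L\<^esub> s, y] @ vs) = \<beta> (us @ [x, s \<otimes>\<^bsub>L\<^esub> y] @ vs)"
  shows Bar_lift_hom: "pres_lift G \<beta> \<in> hom (Bar q n) G"
    and Bar_lift_pure: "xs \<in> bar_gens q n \<Longrightarrow> pres_lift G \<beta> (bar_pure q n xs) = \<beta> xs"
proof -
  interpret G: comm_group G by (rule G)
  have pi: "\<beta> \<in> bar_gens q n \<rightarrow> carrier G"
    using closed by auto
  have vanish: "frag_ext G \<beta> r = \<one>\<^bsub>G\<^esub>" if r: "r \<in> bar_rels q n" for r
  proof -
    consider (add) us x y vs where "us @ [x] @ vs \<in> bar_gens q n" "y \<in> carrier L"
        "r = frag_of (us @ [x \<oplus>\<^bsub>L\<^esub> y] @ vs) - frag_of (us @ [x] @ vs) - frag_of (us @ [y] @ vs)"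
      | (balanced) us x s y vs where "us @ [x, y] @ vs \<in> bar_gens q n" "s \<in> Lam0 q"
        "r = frag_of (us @ [x \<otimes>\<^bsub>L\<^esub> s, y] @ vs) - frag_of (us @ [x, s \<otimes>\<^bsub>L\<^esub> y] @ vs)"
      using r unfolding bar_rels_def by blast
    then show ?thesis
    proof cases
      case add
      show ?thesis
        unfolding add(3)
        by (rule G.frag_ext_additive_rel)
          (use add assms(3) [OF add(1,2)] in \<open>auto intro!: closed simp: bar_gens_append\<close>)
    next
      case balanced
      show ?thesis
        unfolding balanced(3)
        by (rule G.frag_ext_balanced_rel)
          (use balanced assms(4) [OF balanced(1,2)] in \<open>auto intro!: closed simp: bar_gens_append Lam0_closed\<close>)
    qed
  qed
  show "pres_lift G \<beta> \<in> hom (Bar q n) G"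
    unfolding hom_Bar by (rule presentation.pres_lift_hom [OF presentation_bar G pi vanish])
  show "pres_lift G \<beta> (bar_pure q n xs) = \<beta> xs" if "xs \<in> bar_gens q n"
    unfolding bar_pure_def by (rule presentation.pres_lift_gen [OF presentation_bar G pi vanish that])
qed

lemma bar_gens_Cons: "x # xs \<in> bar_gens q n \<longleftrightarrow> x \<in> carrier L \<and> length xs = n + 1 \<and> set xs \<subseteq> carrier L"
  by (auto simp: bar_gens_def)

text \<open>Only the first factor changes, so a relation is affected only if it involves that
  factor; there distributivity or associativity of \<Lambda> turns it into another relation.\<close>

lemma
  assumes l: "l \<in> carrier L"
  shows Bar_lact_hom: "lact (Bar q n) l \<in> hom (Bar q n) (Bar q n)"
    and Bar_lact_pure: "xs \<in> bar_gens q n \<Longrightarrow>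
           lact (Bar q n) l (bar_pure q n xs) = bar_pure q n ((l \<otimes>\<^bsub>L\<^esub> hd xs) # tl xs)"
proof -
  let ?\<beta> = "\<lambda>xs. bar_pure q n ((l \<otimes>\<^bsub>L\<^esub> hd xs) # tl xs)"
  have eq: "lact (Bar q n) l = pres_lift (pres_group (bar_gens q n) (bar_rels q n)) ?\<beta>"
    by (simp add: Bar_def bar_group_def)
  have closed: "(l \<otimes>\<^bsub>L\<^esub> hd xs) # tl xs \<in> bar_gens q n" if "xs \<in> bar_gens q n" for xs
    using that l by (cases xs) (auto simp: bar_gens_def)
  have add: "?\<beta> (us @ [x \<oplus>\<^bsub>L\<^esub> y] @ vs) = ?\<beta> (us @ [x] @ vs) \<otimes>\<^bsub>Bar q n\<^esub> ?\<beta> (us @ [y] @ vs)"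
    if "us @ [x] @ vs \<in> bar_gens q n" "y \<in> carrier L" for us x y vs
  proof (cases us)
    case Nil
    then show ?thesis
      using that l bar_pure_add [of "[]" "l \<otimes>\<^bsub>L\<^esub> x" vs n "l \<otimes>\<^bsub>L\<^esub> y"]
      by (simp add: bar_gens_Cons L.r_distr)
  next
    case (Cons u us')
    then show ?thesis
      using that l bar_pure_add [of "(l \<otimes>\<^bsub>L\<^esub> u) # us'" x vs n y] by (simp add: bar_gens_Cons)
  qed
  have bal: "?\<beta> (us @ [x \<otimes>\<^bsub>L\<^esub> s, y] @ vs) = ?\<beta> (us @ [x, s \<otimes>\<^bsub>L\<^esub> y] @ vs)"
    if "us @ [x, y] @ vs \<in> bar_gens q n" "s \<in> Lam0 q" for us x s y vs
  proof (cases us)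
    case Nil
    then show ?thesis
      using that l bar_pure_balanced [of "[]" "l \<otimes>\<^bsub>L\<^esub> x" y vs n s]
      by (simp add: bar_gens_Cons L.m_assoc Lam0_closed)
  next
    case (Cons u us')
    then show ?thesis
      using that l bar_pure_balanced [of "(l \<otimes>\<^bsub>L\<^esub> u) # us'" x y vs n s] by (simp add: bar_gens_Cons)
  qed
  note facts = presentation.comm_group_pres [OF presentation_bar] bar_pure_closed [unfolded Bar_simps]
    closed add [unfolded Bar_simps] bal
  show "lact (Bar q n) l \<in> hom (Bar q n) (Bar q n)"
    unfolding eq hom_into_Bar by (rule Bar_lift_hom) (rule facts facts(2) [OF closed] | assumption)+
  show "lact (Bar q n) l (bar_pure q n xs) = ?\<beta> xs" if "xs \<in> bar_gens q n"
    unfolding eq by (rule Bar_lift_pure) (rule facts facts(2) [OF closed] that | assumption)+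
qed

text \<open>The mirror image at the last factor, with the lists split from the right.\<close>

lemma
  assumes l: "l \<in> carrier L"
  shows Bar_ract_hom: "(\<lambda>t. ract (Bar q n) t l) \<in> hom (Bar q n) (Bar q n)"
    and Bar_ract_pure: "xs \<in> bar_gens q n \<Longrightarrow>
           ract (Bar q n) (bar_pure q n xs) l = bar_pure q n (butlast xs @ [last xs \<otimes>\<^bsub>L\<^esub> l])"
proof -
  let ?\<beta> = "\<lambda>xs. bar_pure q n (butlast xs @ [last xs \<otimes>\<^bsub>L\<^esub> l])"
  have eq: "ract (Bar q n) t l = pres_lift (pres_group (bar_gens q n) (bar_rels q n)) ?\<beta> t" for t
    by (simp add: Bar_def bar_group_def)
  have closed: "butlast xs @ [last xs \<otimes>\<^bsub>L\<^esub> l] \<in> bar_gens q n" if "xs \<in> bar_gens q n" for xs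
    using that l by (cases xs rule: rev_cases) (auto simp: bar_gens_def)
  have add: "?\<beta> (us @ [x \<oplus>\<^bsub>L\<^esub> y] @ vs) = ?\<beta> (us @ [x] @ vs) \<otimes>\<^bsub>Bar q n\<^esub> ?\<beta> (us @ [y] @ vs)"
    if "us @ [x] @ vs \<in> bar_gens q n" "y \<in> carrier L" for us x y vs
  proof (cases vs rule: rev_cases)
    case Nil
    then show ?thesis
      using that l bar_pure_add [of us "x \<otimes>\<^bsub>L\<^esub> l" "[]" n "y \<otimes>\<^bsub>L\<^esub> l"]
      by (simp add: bar_gens_append L.l_distr)
  next
    case (snoc vs' v)
    then show ?thesis
      using that l bar_pure_add [of us x "vs' @ [v \<otimes>\<^bsub>L\<^esub> l]" n y]
      by (simp add: bar_gens_append butlast_append)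
  qed
  have bal: "?\<beta> (us @ [x \<otimes>\<^bsub>L\<^esub> s, y] @ vs) = ?\<beta> (us @ [x, s \<otimes>\<^bsub>L\<^esub> y] @ vs)"
    if "us @ [x, y] @ vs \<in> bar_gens q n" "s \<in> Lam0 q" for us x s y vs
  proof (cases vs rule: rev_cases)
    case Nil
    then show ?thesis
      using that l bar_pure_balanced [of us x "y \<otimes>\<^bsub>L\<^esub> l" "[]" n s]
      by (simp add: bar_gens_append L.m_assoc Lam0_closed butlast_append)
  next
    case (snoc vs' v)
    then show ?thesis
      using that l bar_pure_balanced [of us x y "vs' @ [v \<otimes>\<^bsub>L\<^esub> l]" n s]
      by (simp add: bar_gens_append butlast_append)
  qed
  note facts = presentation.comm_group_pres [OF presentation_bar] bar_pure_closed [unfolded Bar_simps]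
    closed add [unfolded Bar_simps] bal
  show "(\<lambda>t. ract (Bar q n) t l) \<in> hom (Bar q n) (Bar q n)"
    unfolding eq hom_into_Bar by (rule Bar_lift_hom) (rule facts facts(2) [OF closed] | assumption)+
  show "ract (Bar q n) (bar_pure q n xs) l = ?\<beta> xs" if "xs \<in> bar_gens q n"
    unfolding eq by (rule Bar_lift_pure) (rule facts facts(2) [OF closed] that | assumption)+
qed

text \<open>Both actions touch only the outer factors, so the inner ones are kept as one block
  \<open>ys\<close>.\<close>

lemma bar_gens_hd_last:
  assumes "xs \<in> bar_gens q n"
  obtains x ys y where "xs = x # ys @ [y]" "x \<in> carrier L" "y \<in> carrier L" "length ys = n" "set ys \<subseteq> carrier L"
proof -
  obtain x zs where "xs = x # zs" "length zs = n + 1"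
    using assms by (cases xs) (auto simp: bar_gens_def)
  moreover from this obtain ys y where "zs = ys @ [y]"
    by (cases zs rule: rev_cases) auto
  ultimately show ?thesis
    using assms that by (auto simp: bar_gens_def)
qed

text \<open>Each law equates two group homomorphisms in \<open>x\<close>, so comparison on pure
  tensors is enough.\<close>

lemma bimodule_on_Bar: "bimodule_on L (Bar q n)"
proof (intro bimodule_on.intro bimodule_on_axioms.intro L.ring_axioms comm_group_Bar Bar_lact_hom Bar_ract_hom)
  let ?B = "Bar q n"
  have B: "group ?B"
    using comm_group_Bar by (simp add: comm_group.axioms(2))
  fix l l' x assume ll: "l \<in> carrier L" "l' \<in> carrier L" and x: "x \<in> carrier ?B"
  show "lact ?B (l \<oplus>\<^bsub>L\<^esub> l') x = lact ?B l x \<otimes>\<^bsub>?B\<^esub> lact ?B l' x"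
  proof (rule Bar_hom_eqI [OF B Bar_lact_hom [OF L.a_closed [OF ll]] hom_pointwise_mult [OF comm_group_Bar Bar_lact_hom [OF ll(1)] Bar_lact_hom [OF ll(2)]] _ x])
    fix xs assume xs: "xs \<in> bar_gens q n"
    then obtain x ys y where "xs = x # ys @ [y]" "x \<in> carrier L" "y \<in> carrier L" "length ys = n" "set ys \<subseteq> carrier L"
      by (rule bar_gens_hd_last)
    then show "lact ?B (l \<oplus>\<^bsub>L\<^esub> l') (bar_pure q n xs) = lact ?B l (bar_pure q n xs) \<otimes>\<^bsub>?B\<^esub> lact ?B l' (bar_pure q n xs)"
      using ll xs bar_pure_add [of "[]" "l \<otimes>\<^bsub>L\<^esub> x" "ys @ [y]" n "l' \<otimes>\<^bsub>L\<^esub> x"]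
      by (simp add: Bar_lact_pure L.l_distr bar_gens_Cons)
  qed
  show "ract ?B x (l \<oplus>\<^bsub>L\<^esub> l') = ract ?B x l \<otimes>\<^bsub>?B\<^esub> ract ?B x l'"
  proof (rule Bar_hom_eqI [OF B Bar_ract_hom [OF L.a_closed [OF ll]] hom_pointwise_mult [OF comm_group_Bar Bar_ract_hom [OF ll(1)] Bar_ract_hom [OF ll(2)]] _ x])
    fix xs assume xs: "xs \<in> bar_gens q n"
    then obtain x ys y where "xs = x # ys @ [y]" "x \<in> carrier L" "y \<in> carrier L" "length ys = n" "set ys \<subseteq> carrier L"
      by (rule bar_gens_hd_last)
    then show "ract ?B (bar_pure q n xs) (l \<oplus>\<^bsub>L\<^esub> l') = ract ?B (bar_pure q n xs) l \<otimes>\<^bsub>?B\<^esub> ract ?B (bar_pure q n xs) l'"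
      using ll xs bar_pure_add [of "x # ys" "y \<otimes>\<^bsub>L\<^esub> l" "[]" n "y \<otimes>\<^bsub>L\<^esub> l'"]
      by (simp add: Bar_ract_pure L.r_distr bar_gens_Cons)
  qed
  show "lact ?B (l \<otimes>\<^bsub>L\<^esub> l') x = lact ?B l (lact ?B l' x)"
  proof (rule Bar_hom_eqI [OF B Bar_lact_hom [OF L.m_closed [OF ll]] hom_comp [OF Bar_lact_hom [OF ll(2)] Bar_lact_hom [OF ll(1)]] _ x])
    fix xs assume xs: "xs \<in> bar_gens q n"
    then obtain x ys y where "xs = x # ys @ [y]" "x \<in> carrier L" "y \<in> carrier L" "length ys = n" "set ys \<subseteq> carrier L"
      by (rule bar_gens_hd_last)
    then show "lact ?B (l \<otimes>\<^bsub>L\<^esub> l') (bar_pure q n xs) = lact ?B l (lact ?B l' (bar_pure q n xs))"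
      using ll xs by (simp add: Bar_lact_pure L.m_assoc bar_gens_Cons)
  qed
  show "ract ?B x (l \<otimes>\<^bsub>L\<^esub> l') = ract ?B (ract ?B x l) l'"
  proof (rule Bar_hom_eqI [OF B Bar_ract_hom [OF L.m_closed [OF ll]] hom_comp [OF Bar_ract_hom [OF ll(1)] Bar_ract_hom [OF ll(2)]] _ x])
    fix xs assume xs: "xs \<in> bar_gens q n"
    then obtain x ys y where "xs = x # ys @ [y]" "x \<in> carrier L" "y \<in> carrier L" "length ys = n" "set ys \<subseteq> carrier L"
      by (rule bar_gens_hd_last)
    then show "ract ?B (bar_pure q n xs) (l \<otimes>\<^bsub>L\<^esub> l') = ract ?B (ract ?B (bar_pure q n xs) l) l'"
      using ll xs by (simp add: Bar_ract_pure L.m_assoc bar_gens_Cons)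
  qed
  show "lact ?B l (ract ?B x l') = ract ?B (lact ?B l x) l'"
  proof (rule Bar_hom_eqI [OF B hom_comp [OF Bar_ract_hom [OF ll(2)] Bar_lact_hom [OF ll(1)]] hom_comp [OF Bar_lact_hom [OF ll(1)] Bar_ract_hom [OF ll(2)]] _ x])
    fix xs assume xs: "xs \<in> bar_gens q n"
    then obtain x ys y where "xs = x # ys @ [y]" "x \<in> carrier L" "y \<in> carrier L" "length ys = n" "set ys \<subseteq> carrier L"
      by (rule bar_gens_hd_last)
    then show "lact ?B l (ract ?B (bar_pure q n xs) l') = ract ?B (lact ?B l (bar_pure q n xs)) l'"
      using ll xs by (simp add: Bar_ract_pure Bar_lact_pure L.m_assoc bar_gens_Cons)
  qed
qed

section \<open>Homomorphisms out of the minimal resolution\<close>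

lemma Scal_closed: "s \<in> Scal q \<Longrightarrow> s \<in> carrier L"
  using Scal_subset_Lam0 Lam0_closed by blast

lemma Scal_commute: "\<lbrakk>s \<in> Scal q; x \<in> carrier L\<rbrakk> \<Longrightarrow> x \<otimes>\<^bsub>L\<^esub> s = s \<otimes>\<^bsub>L\<^esub> x"
  by (auto simp: Scal_def scalar_commute)

text \<open>Idempotency turns membership into an equation, being fixed by the idempotent, so that
  closure and stability can be checked by rewriting.\<close>

lemma proj_simps:
  "x \<in> carrier (left_proj q v) \<longleftrightarrow> x \<in> carrier L \<and> x \<otimes>\<^bsub>L\<^esub> lam_idem q v = x"
  "x \<in> carrier (right_proj q v) \<longleftrightarrow> x \<in> carrier L \<and> lam_idem q v \<otimes>\<^bsub>L\<^esub> x = x"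
  "monoid.mult (left_proj q v) = add L" "monoid.mult (right_proj q v) = add L"
  "one (left_proj q v) = zero L" "one (right_proj q v) = zero L"
  "lact (left_proj q v) = monoid.mult L" "lact (right_proj q v) = monoid.mult L"
  "ract (left_proj q v) = monoid.mult L" "ract (right_proj q v) = monoid.mult L"
proof -
  have "x \<otimes>\<^bsub>L\<^esub> lam_idem q v \<otimes>\<^bsub>L\<^esub> lam_idem q v = x \<otimes>\<^bsub>L\<^esub> lam_idem q v"
    "lam_idem q v \<otimes>\<^bsub>L\<^esub> (lam_idem q v \<otimes>\<^bsub>L\<^esub> x) = lam_idem q v \<otimes>\<^bsub>L\<^esub> x" if "x \<in> carrier L" for x
    using that by (simp_all add: L.m_assoc idem_mult) (simp add: idem_mult flip: L.m_assoc)
  then show "x \<in> carrier (left_proj q v) \<longleftrightarrow> x \<in> carrier L \<and> x \<otimes>\<^bsub>L\<^esub> lam_idem q v = x"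
    "x \<in> carrier (right_proj q v) \<longleftrightarrow> x \<in> carrier L \<and> lam_idem q v \<otimes>\<^bsub>L\<^esub> x = x"
    by (auto simp: left_proj_def right_proj_def)
qed (simp_all add: left_proj_def right_proj_def regular_def)

lemma comm_group_left_proj: "comm_group (left_proj q v)"
proof (rule comm_groupI; unfold proj_simps)
  fix x assume "x \<in> carrier L \<and> x \<otimes>\<^bsub>L\<^esub> lam_idem q v = x"
  then show "\<exists>y\<in>carrier (left_proj q v). y \<oplus>\<^bsub>L\<^esub> x = \<zero>\<^bsub>L\<^esub>"
    by (intro bexI [of _ "\<ominus>\<^bsub>L\<^esub> x"]) (auto simp: proj_simps L.l_neg L.l_minus)
qed (auto simp: L.a_ac L.l_distr)

lemma comm_group_right_proj: "comm_group (right_proj q v)"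
proof (rule comm_groupI; unfold proj_simps)
  fix x assume "x \<in> carrier L \<and> lam_idem q v \<otimes>\<^bsub>L\<^esub> x = x"
  then show "\<exists>y\<in>carrier (right_proj q v). y \<oplus>\<^bsub>L\<^esub> x = \<zero>\<^bsub>L\<^esub>"
    by (intro bexI [of _ "\<ominus>\<^bsub>L\<^esub> x"]) (auto simp: proj_simps L.l_neg L.r_minus)
qed (auto simp: L.a_ac L.r_distr)

abbreviation T :: "vertex \<Rightarrow> vertex \<Rightarrow> ('k quot, (('k quot \<times> 'k quot) \<Rightarrow>\<^sub>0 int) set) bimodule" where
  "T v w \<equiv> tensor (Scal q) (left_proj q v) (right_proj q w)"

abbreviation pure_T where
  "pure_T v w \<equiv> pure_tensor (Scal q) (left_proj q v) (right_proj q w)"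

text \<open>Stability holds because scalars are central and hence pass the idempotent.\<close>

sublocale T: tensor_data "Scal q" "left_proj q v" "right_proj q w" for v w
proof (rule tensor_data.intro)
  show "ract (left_proj q v) x s \<in> carrier (left_proj q v)"
    if "x \<in> carrier (left_proj q v)" "s \<in> Scal q" for x s
  proof -
    have "x \<otimes>\<^bsub>L\<^esub> s \<otimes>\<^bsub>L\<^esub> lam_idem q v = s \<otimes>\<^bsub>L\<^esub> (x \<otimes>\<^bsub>L\<^esub> lam_idem q v)"
      using that by (simp add: proj_simps(1) Scal_closed Scal_commute L.m_assoc)
    then show ?thesis
      using that by (simp add: proj_simps Scal_closed Scal_commute)
  qed
  show "lact (right_proj q w) s y \<in> carrier (right_proj q w)"
    if "y \<in> carrier (right_proj q w)" "s \<in> Scal q" for y s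
  proof -
    have "lam_idem q w \<otimes>\<^bsub>L\<^esub> (s \<otimes>\<^bsub>L\<^esub> y) = s \<otimes>\<^bsub>L\<^esub> (lam_idem q w \<otimes>\<^bsub>L\<^esub> y)"
      using that Scal_commute [of s "lam_idem q w"] L.m_assoc [of "lam_idem q w" s y]
        L.m_assoc [of s "lam_idem q w" y]
      by (simp add: proj_simps(2) Scal_closed)
    then show ?thesis
      using that by (simp add: proj_simps Scal_closed)
  qed
qed (rule comm_group_left_proj comm_group_right_proj)+

lemma T_lact_hom: "l \<in> carrier L \<Longrightarrow> lact (T v w) l \<in> hom (T v w) (T v w)"
  by (rule T.tensor_lact_hom)
    (auto simp: hom_def proj_simps L.r_distr L.m_assoc Scal_closed)

lemma T_lact_pure:
  "\<lbrakk>l \<in> carrier L; x \<in> carrier (left_proj q v); y \<in> carrier (right_proj q w)\<rbrakk> \<Longrightarrow>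
     lact (T v w) l (pure_T v w x y) = pure_T v w (l \<otimes>\<^bsub>L\<^esub> x) y"
  by (subst T.tensor_lact_pure)
    (auto simp: hom_def proj_simps L.r_distr L.m_assoc Scal_closed)

lemma T_ract_hom: "l \<in> carrier L \<Longrightarrow> (\<lambda>t. ract (T v w) t l) \<in> hom (T v w) (T v w)"
  by (rule T.tensor_ract_hom)
    (auto simp: hom_def proj_simps L.l_distr L.m_assoc Scal_closed simp flip: L.m_assoc)

lemma T_ract_pure:
  "\<lbrakk>l \<in> carrier L; x \<in> carrier (left_proj q v); y \<in> carrier (right_proj q w)\<rbrakk> \<Longrightarrow>
     ract (T v w) (pure_T v w x y) l = pure_T v w x (y \<otimes>\<^bsub>L\<^esub> l)"
  by (subst T.tensor_ract_pure)
    (auto simp: hom_def proj_simps L.l_distr L.m_assoc Scal_closed simp flip: L.m_assoc)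

section \<open>The components of the resolution and its bimodule generators\<close>

abbreviation K_comp :: "nat \<Rightarrow> nat \<Rightarrow> ('k quot, (('k quot \<times> 'k quot) \<Rightarrow>\<^sub>0 int) set) bimodule" where
  "K_comp n i \<equiv> T (f_org n i) (f_end n i)"

lemma group_T: "group (T v w)"
  using T.comm_group_tensor by (rule comm_group.axioms(2))

lemma comm_group_K: "comm_group (K q n)"
  unfolding K_def by (rule comm_group_bimod_sum) (rule T.comm_group_tensor)

lemma K_simps:
  "x \<in> carrier (K q n) \<longleftrightarrow> x \<in> (\<Pi>\<^sub>E i\<in>{0..n+1}. carrier (K_comp n i))"
  "x \<otimes>\<^bsub>K q n\<^esub> y = (\<lambda>i\<in>{0..n+1}. x i \<otimes>\<^bsub>K_comp n i\<^esub> y i)"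
  "lact (K q n) l x = (\<lambda>i\<in>{0..n+1}. lact (K_comp n i) l (x i))"
  "ract (K q n) x l = (\<lambda>i\<in>{0..n+1}. ract (K_comp n i) (x i) l)"
  by (simp_all add: K_def bimod_sum_simps)

lemma K_lact_closed: "\<lbrakk>l \<in> carrier L; x \<in> carrier (K q n)\<rbrakk> \<Longrightarrow> lact (K q n) l x \<in> carrier (K q n)"
  by (auto simp: K_simps PiE_iff intro!: hom_in_carrier [OF T_lact_hom])

lemma K_ract_closed: "\<lbrakk>l \<in> carrier L; x \<in> carrier (K q n)\<rbrakk> \<Longrightarrow> ract (K q n) x l \<in> carrier (K q n)"
  by (auto simp: K_simps PiE_iff intro!: hom_in_carrier [OF T_ract_hom])

lemma tensor_data_K: "tensor_data (carrier L) (K q m) (K q n)"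
  by (intro tensor_data.intro comm_group_K K_lact_closed K_ract_closed)

lemma idem_in_proj: "lam_idem q v \<in> carrier (left_proj q v)" "lam_idem q v \<in> carrier (right_proj q v)"
  by (simp_all add: proj_simps idem_mult)

lemma eps_eq: "eps q n i = sum_inj {0..n+1} (K_comp n) i (pure_T (f_org n i) (f_end n i) (lam_idem q (f_org n i)) (lam_idem q (f_end n i)))"
  by (simp add: eps_def sum_inj_def)

lemma eps_closed: "i \<le> n + 1 \<Longrightarrow> eps q n i \<in> carrier (K q n)"
  unfolding eps_eq K_def
  by (intro hom_in_carrier [OF sum_inj_hom [of _ "K_comp n" i]] group_T T.pure_tensor_closed idem_in_proj)

text \<open>The \<open>eps q n i\<close> generate \<open>K q n\<close> as a bimodule: the pure
  tensor of \<open>u\<close> and \<open>v\<close> in component \<open>j\<close> is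
  \<open>eps q n j\<close> multiplied by \<open>u\<close> on the left and \<open>v\<close> on the
  right.\<close>

lemma K_hom_eqI:
  assumes N: "group N" and f: "f \<in> bimod_hom L (K q n) N" and g: "g \<in> bimod_hom L (K q n) N"
    and eq: "\<And>i. i \<le> n + 1 \<Longrightarrow> f (eps q n i) = g (eps q n i)"
    and x: "x \<in> carrier (K q n)"
  shows "f x = g x"
proof -
  have homs: "f \<in> hom (bimod_sum {0..n+1} (K_comp n)) N" "g \<in> hom (bimod_sum {0..n+1} (K_comp n)) N"
    using f g by (auto simp: bimod_hom_def K_def)
  show ?thesis
  proof (rule bimod_sum_hom_eqI [OF _ group_T N homs _ x [unfolded K_def]])
    fix j t assume j: "j \<in> {0..n+1}" and t: "t \<in> carrier (K_comp n j)"
    have inj: "sum_inj {0..n+1} (K_comp n) j \<in> hom (K_comp n j) (bimod_sum {0..n+1} (K_comp n))"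
      by (rule sum_inj_hom) (rule group_T)
    show "f (sum_inj {0..n+1} (K_comp n) j t) = g (sum_inj {0..n+1} (K_comp n) j t)"
    proof (rule T.tensor_hom_eqI [OF N hom_comp [OF inj homs(1)] hom_comp [OF inj homs(2)] _ t])
      fix u v assume u: "u \<in> carrier (left_proj q (f_org n j))" and v: "v \<in> carrier (right_proj q (f_end n j))"
      have uv: "u \<in> carrier L" "v \<in> carrier L"
        using u v by (simp_all add: proj_simps)
      have uv_idem: "u \<otimes>\<^bsub>L\<^esub> lam_idem q (f_org n j) = u" "lam_idem q (f_end n j) \<otimes>\<^bsub>L\<^esub> v = v"
        using u v by (simp_all add: proj_simps)
      \<comment> \<open>The other components of \<open>eps q n j\<close> are zero and stay zero
        under both actions.\<close>
      have one: "ract (T v' w) \<one>\<^bsub>T v' w\<^esub> v = \<one>\<^bsub>T v' w\<^esub>" "lact (T v' w) u \<one>\<^bsub>T v' w\<^esub> = \<one>\<^bsub>T v' w\<^esub>" for v' w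
        using hom_one [OF T_ract_hom [OF uv(2)]] hom_one [OF T_lact_hom [OF uv(1)]] group_T by auto
      have "ract (K q n) (eps q n j) v = sum_inj {0..n+1} (K_comp n) j (pure_T (f_org n j) (f_end n j) (lam_idem q (f_org n j)) v)"
        using v uv j by (auto simp: K_simps eps_eq sum_inj_def fun_eq_iff one T_ract_pure idem_in_proj uv_idem)
      then have pure: "lact (K q n) u (ract (K q n) (eps q n j) v) =
          sum_inj {0..n+1} (K_comp n) j (pure_T (f_org n j) (f_end n j) u v)"
        using u v uv j by (auto simp: K_simps sum_inj_def fun_eq_iff one T_lact_pure idem_in_proj uv_idem)
      have "h (lact (K q n) u (ract (K q n) (eps q n j) v)) = lact N u (ract N (h (eps q n j)) v)"
        if "h \<in> bimod_hom L (K q n) N" for h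
        using that uv j eps_closed [of j n] K_ract_closed by (auto simp: bimod_hom_def)
      note act = this
      show "f (sum_inj {0..n+1} (K_comp n) j (pure_T (f_org n j) (f_end n j) u v)) =
            g (sum_inj {0..n+1} (K_comp n) j (pure_T (f_org n j) (f_end n j) u v))"
        unfolding pure [symmetric] using act [OF f] act [OF g] eq j by simp
    qed
  qed simp
qed

text \<open>The map taking u \<otimes> v to u (g i) v is balanced over the scalars only if they act
  on \<open>g i\<close> equally from both sides. A bimodule over \<Lambda> as a mere ring does not
  guarantee this, hence the assumption \<open>g_scalar\<close>.\<close>

context
  fixes N :: "('k quot, 'm) bimodule" and g :: "nat \<Rightarrow> 'm" and n :: nat
  assumes N: "bimodule_on L N"
    and g_closed: "\<And>i. i \<le> n + 1 \<Longrightarrow> g i \<in> carrier N"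
    and g_scalar: "\<And>i s. \<lbrakk>i \<le> n + 1; s \<in> Scal q\<rbrakk> \<Longrightarrow> lact N s (g i) = ract N (g i) s"
begin

interpretation N: bimodule_on L N by (rule N)
interpretation NG: comm_group N by (rule N.bimod_group)

lemma
  assumes i: "i \<le> n + 1"
  shows K_component_hom: "pres_lift N (\<lambda>(u, v). ract N (lact N u (g i)) v) \<in> hom (T v w) N"
    and K_component_pure: "\<lbrakk>x \<in> carrier (left_proj q v); y \<in> carrier (right_proj q w)\<rbrakk> \<Longrightarrow>
      pres_lift N (\<lambda>(u, v). ract N (lact N u (g i)) v) (pure_T v w x y) = ract N (lact N x (g i)) y"
proof -
  have bal: "ract N (lact N (x \<otimes>\<^bsub>L\<^esub> s) (g i)) y = ract N (lact N x (g i)) (s \<otimes>\<^bsub>L\<^esub> y)"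
    if "x \<in> carrier L" "y \<in> carrier L" "s \<in> Scal q" for x s y
    using that i g_closed [OF i] Scal_closed
    by (simp add: N.lact_mult N.ract_mult g_scalar N.lact_ract N.lact_closed)
  have add: "ract N (lact N (x \<oplus>\<^bsub>L\<^esub> x') (g i)) y = ract N (lact N x (g i)) y \<otimes>\<^bsub>N\<^esub> ract N (lact N x' (g i)) y"
    if "x \<in> carrier L" "x' \<in> carrier L" "y \<in> carrier L" for x x' y
    using that g_closed [OF i] by (simp add: N.lact_add N.lact_closed hom_mult [OF N.ract_hom])
  note facts = N.bimod_group bal add N.ract_add N.lact_closed N.ract_closed g_closed [OF i]
  show "pres_lift N (\<lambda>(u, v). ract N (lact N u (g i)) v) \<in> hom (T v w) N"
    by (rule T.tensor_lift_hom) (auto simp: proj_simps facts)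
  show "pres_lift N (\<lambda>(u, v). ract N (lact N u (g i)) v) (pure_T v w x y) = ract N (lact N x (g i)) y"
    if "x \<in> carrier (left_proj q v)" "y \<in> carrier (right_proj q w)"
    by (rule T.tensor_lift_pure) (use that in \<open>auto simp: proj_simps facts\<close>)
qed

lemma K_component_lact:
  assumes i: "i \<le> n + 1" and l: "l \<in> carrier L" and t: "t \<in> carrier (T v w)"
  shows "pres_lift N (\<lambda>(u, v). ract N (lact N u (g i)) v) (lact (T v w) l t) =
         lact N l (pres_lift N (\<lambda>(u, v). ract N (lact N u (g i)) v) t)"
proof (rule T.tensor_hom_eqI [OF NG.is_group hom_comp [OF T_lact_hom [OF l] K_component_hom [OF i]]
        hom_comp [OF K_component_hom [OF i] N.lact_hom [OF l]] _ t])
  fix x y assume xy: "x \<in> carrier (left_proj q v)" "y \<in> carrier (right_proj q w)"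
  then have "l \<otimes>\<^bsub>L\<^esub> x \<in> carrier (left_proj q v)"
    using l by (simp add: proj_simps L.m_assoc)
  then show "pres_lift N (\<lambda>(u, v). ract N (lact N u (g i)) v) (lact (T v w) l (pure_T v w x y)) =
      lact N l (pres_lift N (\<lambda>(u, v). ract N (lact N u (g i)) v) (pure_T v w x y))"
    using xy i l g_closed [OF i]
    by (simp add: T_lact_pure K_component_pure) (simp add: proj_simps N.lact_mult N.lact_ract N.lact_closed)
qed

lemma K_component_ract:
  assumes i: "i \<le> n + 1" and l: "l \<in> carrier L" and t: "t \<in> carrier (T v w)"
  shows "pres_lift N (\<lambda>(u, v). ract N (lact N u (g i)) v) (ract (T v w) t l) =
         ract N (pres_lift N (\<lambda>(u, v). ract N (lact N u (g i)) v) t) l"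
proof (rule T.tensor_hom_eqI [OF NG.is_group hom_comp [OF T_ract_hom [OF l] K_component_hom [OF i]]
        hom_comp [OF K_component_hom [OF i] N.ract_hom [OF l]] _ t])
  fix x y assume xy: "x \<in> carrier (left_proj q v)" "y \<in> carrier (right_proj q w)"
  then have "y \<otimes>\<^bsub>L\<^esub> l \<in> carrier (right_proj q w)"
    using l by (simp add: proj_simps flip: L.m_assoc)
  then show "pres_lift N (\<lambda>(u, v). ract N (lact N u (g i)) v) (ract (T v w) (pure_T v w x y) l) =
      ract N (pres_lift N (\<lambda>(u, v). ract N (lact N u (g i)) v) (pure_T v w x y)) l"
    using xy i l g_closed [OF i]
    by (simp add: T_ract_pure K_component_pure) (simp add: proj_simps N.ract_mult N.lact_closed)
qed

lemma K_component_closed: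
  "\<lbrakk>x \<in> carrier (K q n); i \<le> n + 1\<rbrakk> \<Longrightarrow>
     pres_lift N (\<lambda>(u, v). ract N (lact N u (g i)) v) (x i) \<in> carrier N"
  by (rule hom_in_carrier [OF K_component_hom]) (auto simp: K_simps PiE_iff)

lemma K_extend_bimod_hom: "K_extend q n N g \<in> bimod_hom L (K q n) N"
  unfolding bimod_hom_def
proof (intro CollectI conjI ballI)
  show "K_extend q n N g \<in> hom (K q n) N"
  proof (rule homI)
    fix x y assume xy: "x \<in> carrier (K q n)" "y \<in> carrier (K q n)"
    show "K_extend q n N g x \<in> carrier N"
      unfolding K_extend_def using xy by (intro NG.finprod_closed) (auto intro: K_component_closed)
    have "K_extend q n N g (x \<otimes>\<^bsub>K q n\<^esub> y) =
        finprod N (\<lambda>i. pres_lift N (\<lambda>(u, v). ract N (lact N u (g i)) v) (x i) \<otimes>\<^bsub>N\<^esub>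
          pres_lift N (\<lambda>(u, v). ract N (lact N u (g i)) v) (y i)) {0..n+1}"
      unfolding K_extend_def using xy K_component_closed
      by (intro NG.finprod_cong' refl)
        (auto simp: K_simps PiE_iff hom_mult [OF K_component_hom])
    also have "\<dots> = K_extend q n N g x \<otimes>\<^bsub>N\<^esub> K_extend q n N g y"
      unfolding K_extend_def using xy by (intro NG.finprod_multf) (auto intro: K_component_closed)
    finally show "K_extend q n N g (x \<otimes>\<^bsub>K q n\<^esub> y) = K_extend q n N g x \<otimes>\<^bsub>N\<^esub> K_extend q n N g y" .
  qed
  fix l x assume l: "l \<in> carrier L" and x: "x \<in> carrier (K q n)"
  have closed: "(\<lambda>i. pres_lift N (\<lambda>(u, v). ract N (lact N u (g i)) v) (x i)) \<in> {0..n+1} \<rightarrow> carrier N"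
    using x K_component_closed by auto
  show "K_extend q n N g (lact (K q n) l x) = lact N l (K_extend q n N g x)"
    unfolding K_extend_def hom_finprod [OF N.bimod_group N.bimod_group N.lact_hom [OF l] closed]
    using x l closed
    by (intro NG.finprod_cong' refl) (auto simp: K_simps K_component_lact PiE_iff intro!: N.lact_closed)
  show "K_extend q n N g (ract (K q n) x l) = ract N (K_extend q n N g x) l"
    unfolding K_extend_def hom_finprod [OF N.bimod_group N.bimod_group N.ract_hom [OF l] closed]
    using x l closed
    by (intro NG.finprod_cong' refl) (auto simp: K_simps K_component_ract PiE_iff intro!: N.ract_closed)
qed

text \<open>\<open>g i\<close> is not assumed to lie in o(f) N t(f), so the idempotents making up
  the generator remain in the value.\<close>

lemma K_extend_eps:
  assumes i: "i \<le> n + 1"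
  shows "K_extend q n N g (eps q n i) = ract N (lact N (lam_idem q (f_org n i)) (g i)) (lam_idem q (f_end n i))"
proof -
  let ?v = "\<lambda>i. ract N (lact N (lam_idem q (f_org n i)) (g i)) (lam_idem q (f_end n i))"
  have one: "pres_lift N (\<lambda>(u, v). ract N (lact N u (g j)) v) \<one>\<^bsub>T v w\<^esub> = \<one>\<^bsub>N\<^esub>" if "j \<le> n + 1" for j v w
    using hom_one [OF K_component_hom [OF that] group_T NG.is_group] .
  have closed: "?v j \<in> carrier N" if "j \<le> n + 1" for j
    using that by (intro N.ract_closed N.lact_closed g_closed) auto
  have "K_extend q n N g (eps q n i) = finprod N (\<lambda>j. if i = j then ?v j else \<one>\<^bsub>N\<^esub>) {0..n+1}"
    unfolding K_extend_def using i closed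
    by (intro NG.finprod_cong' refl) (auto simp: eps_def one K_component_pure idem_in_proj)
  also have "\<dots> = ?v i"
    using i closed by (intro NG.finprod_singleton) auto
  finally show ?thesis .
qed

end

end

section \<open>Coefficients of the elements \<open>f n i\<close>\<close>

text \<open>The word is read from its end, following the recursion for \<open>f n i\<close>.\<close>

fun word_coeff :: "'k::field \<Rightarrow> nat \<Rightarrow> arrow list \<Rightarrow> 'k" where
  "word_coeff q i [] = (if i = 0 then 1 else 0)"
| "word_coeff q i (Arr_a # u) = (- q) ^ i * word_coeff q i u"
| "word_coeff q i (Arr_b # u) = (if i = 0 then 0 else word_coeff q (i - 1) u)"
| "word_coeff q i (Arr_c # u) = 0"

text \<open>For \<open>i \<le> n\<close> the elements \<open>f n i\<close> are built from the
  letters \<open>a\<close> and \<open>b\<close> alone.\<close>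

lemma word_coeff_c: "Arr_c \<in> set u \<Longrightarrow> word_coeff q i u = 0"
  by (induction q i u rule: word_coeff.induct) auto

lemma word_coeff_0: "word_coeff q 0 u = (if u = replicate (length u) Arr_a then 1 else 0)"
proof (induction u)
  case (Cons x u)
  then show ?case
    by (cases x) auto
qed simp

text \<open>Only a letter \<open>b\<close> lowers the index, one unit at a time, and the index must
  reach zero by the end of the word.\<close>

lemma word_coeff_short: "length u < i \<Longrightarrow> word_coeff q i u = 0"
  by (induction q i u rule: word_coeff.induct) auto

lemma word_coeff_top: "word_coeff q (length u) u = (if u = replicate (length u) Arr_b then 1 else 0)"
proof (induction u)
  case (Cons x u)
  then show ?case
    by (cases x) (auto simp: word_coeff_short)
qed simp

text \<open>From degree two on, \<open>f_elem\<close> gives the first row and the row of pure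
  \<open>b\<close> outright and not by recursion; these formulas match them with
  \<open>word_coeff\<close>.\<close>

lemma word_coeff_rev:
  assumes "length w = k"
  shows "word_coeff q 0 (rev w) = (if w = replicate k Arr_a then 1 else 0)"
    and "word_coeff q k (rev w) = (if w = replicate k Arr_b then 1 else 0)"
proof -
  have "rev w = replicate k x \<longleftrightarrow> w = replicate k x" for x
    by (metis rev_replicate rev_rev_ident)
  with assms word_coeff_0 [of q "rev w"] word_coeff_top [of q "rev w"]
  show "word_coeff q 0 (rev w) = (if w = replicate k Arr_a then 1 else 0)"
    and "word_coeff q k (rev w) = (if w = replicate k Arr_b then 1 else 0)"
    by simp_all
qed

lemma lookup_path_elem: "Poly_Mapping.lookup (path_elem v xs) p = (if p = (v, xs) then 1 else 0)"
  by (auto simp: path_elem_def lookup_single when_def)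

text \<open>Blocks are read at once: letters \<open>b\<close> lower the index, and in the next lemma
  each letter \<open>a\<close> met at index \<open>i\<close> contributes \<open>(- q) ^ i\<close>.
  The powers of \<open>- q\<close> in the product formula come from these two rules.\<close>

lemma word_coeff_bs: "word_coeff q i (replicate t Arr_b @ u) = (if t \<le> i then word_coeff q (i - t) u else 0)"
  by (induction t arbitrary: i) auto

lemma word_coeff_as: "word_coeff q i (replicate t Arr_a @ u) = (- q) ^ (i * t) * word_coeff q i u"
  by (induction t) (auto simp: power_add mult.assoc)

lemma path_end_no_c: "Arr_c \<notin> set w \<Longrightarrow> path_end (V1, w) = V1"
proof (cases w rule: rev_cases)
  case (snoc w' x)
  assume "Arr_c \<notin> set w"
  with snoc show ?thesis
    by (cases x) (auto simp: path_end_def)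
qed (simp add: path_end_def)

lemma lookup_path_mult_arrow:
  "Poly_Mapping.lookup (path_mult f (path_elem V1 [\<alpha>])) (v, w) =
     (if w \<noteq> [] \<and> last w = \<alpha> \<and> path_end (v, butlast w) = V1 then Poly_Mapping.lookup f (v, butlast w) else 0)"
proof (induction f rule: pathalg_induct)
  case (single p c)
  show ?case
    by (cases p; cases w rule: rev_cases)
      (auto simp: path_mult_single path_prod_def path_elem_def lookup_single when_def)
qed (auto simp: path_mult_add_left lookup_add)

lemma lookup_f_elem:
  "i \<le> n \<Longrightarrow> Poly_Mapping.lookup (f_elem q n i) (v, w) =
     (if v = V1 \<and> length w = n then word_coeff q i (rev w) else 0)"
proof (induction q n i arbitrary: v w rule: f_elem.induct)
  case (1 q i)
  then show ?case
    by (auto simp: path_elem_def lookup_single when_def)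
next
  case (2 q i)
  then consider "i = 0" | "i = 1"
    by linarith
  then show ?case
    by cases (auto simp: lookup_path_elem word_coeff_rev split: if_splits)
next
  case (3 q n i)
  consider "i = 0" | "i = Suc (Suc n)" | "0 < i" "i \<le> Suc n"
    using "3.prems" by linarith
  then show ?case
  proof cases
    case 1
    then show ?thesis
      by (auto simp: lookup_path_elem word_coeff_rev(1) [of _ "Suc (Suc n)"] simp del: replicate.simps)
  next
    case 2
    then show ?thesis
      by (auto simp: lookup_path_elem word_coeff_rev(2) simp del: replicate.simps)
  next
    case 3
    \<comment> \<open>An arrow \<open>a\<close> or \<open>b\<close> can be appended only to a path
      ending at vertex 1; a word from vertex 1 that ends elsewhere contains \<open>c\<close> and has
      coefficient zero anyway.\<close>
    have path_ends: "path_end (V1, w') = V1 \<or> word_coeff q j (rev w') = 0" for w' j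
      using path_end_no_c [of w'] word_coeff_c [of "rev w'" q j] by auto
    show ?thesis
    proof (cases w rule: rev_cases)
      case Nil
      with 3 show ?thesis
        by (simp add: lookup_add lookup_path_scalar_mult lookup_path_mult_arrow)
    next
      case (snoc w' x)
      with 3 "3.IH" path_ends [of w' i] path_ends [of w' "i - 1"] show ?thesis
        by (cases x) (auto simp: lookup_add lookup_path_scalar_mult lookup_path_mult_arrow)
    qed
  qed
qed

section \<open>The words dual to the elements \<open>f n i\<close>\<close>

lemma f_elem_last:
  "f_elem q n (Suc n) = (if n = 0 then path_elem V2 [] else path_elem V1 (replicate (n - 1) Arr_a @ [Arr_c]))"
  by (cases "(q, n, Suc n)" rule: f_elem.cases) auto

lemma f_elem_keys:
  assumes "p \<in> Poly_Mapping.keys (f_elem q n i)" "i \<le> n + 1"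
  shows "length (snd p) = n"
proof (cases "i = n + 1")
  case True
  with assms show ?thesis
    by (auto simp: f_elem_last path_elem_def split: if_splits)
next
  case False
  with assms show ?thesis
    by (cases p) (auto simp: in_keys_iff lookup_f_elem split: if_splits)
qed

text \<open>For \<open>m = 0\<close> both words are empty and stand for the two vertices; only
  \<open>f_org 0 i\<close> separates them, which is why words are looked up together with their
  origins.\<close>

definition dual_word :: "nat \<Rightarrow> nat \<Rightarrow> arrow list" where
  "dual_word m i =
     (if i \<le> m then replicate (m - i) Arr_a @ replicate i Arr_b
      else if m = 0 then [] else replicate (m - 1) Arr_a @ [Arr_c])"

lemma length_dual_word [simp]: "length (dual_word m i) = m"
  by (auto simp: dual_word_def)

lemma set_dual_word: "i \<le> m \<Longrightarrow> Arr_c \<notin> set (dual_word m i)"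
  by (auto simp: dual_word_def)

lemma chain_from_no_c: "Arr_c \<notin> set w \<Longrightarrow> chain_from V1 w"
proof (induction w)
  case (Cons x w)
  then show ?case
    by (cases x) auto
qed simp

lemma chain_from_dual_word: "chain_from (f_org m i) (dual_word m i)"
proof (cases "i \<le> m \<or> m = 0")
  case True
  then show ?thesis
    using chain_from_no_c [OF set_dual_word [of i m]] by (cases "m = 0") (auto simp: dual_word_def f_org_def)
next
  case False
  then show ?thesis
    by (auto simp: dual_word_def f_org_def chain_from_append path_end_no_c intro!: chain_from_no_c)
qed

lemma path_end_dual_word: "i \<le> m + 1 \<Longrightarrow> path_end (f_org m i, dual_word m i) = f_end m i"
  using path_end_no_c [OF set_dual_word [of i m]]
  by (cases "i \<le> m") (auto simp: f_org_def f_end_def dual_word_def path_end_def split: if_splits)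

lemma lookup_f_elem_dual:
  assumes "i \<le> m + 1" "j \<le> m + 1"
  shows "Poly_Mapping.lookup (f_elem q m i) (f_org m j, dual_word m j) = (if i = j then 1 else 0)"
proof (cases "i = m + 1")
  case True
  have "dual_word m j \<noteq> replicate (m - 1) Arr_a @ [Arr_c]" if "j \<le> m"
    using set_dual_word [OF that] by (metis in_set_conv_decomp)
  moreover have "j = m + 1" if "\<not> j \<le> m"
    using that assms by simp
  ultimately show ?thesis
    using True by (cases "j \<le> m") (auto simp: f_elem_last lookup_path_elem f_org_def dual_word_def [of _ "Suc _"])
next
  case False
  then have i: "i \<le> m"
    using assms by simp
  show ?thesis
  proof (cases "j \<le> m")
    case True
    \<comment> \<open>The \<open>j\<close> letters \<open>b\<close> give zero if
      \<open>j > i\<close> and otherwise leave the index \<open>i - j\<close>; reading on through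
      the letters \<open>a\<close> gives zero unless this index is 0, and then they have weight
      1.\<close>
    have "word_coeff q i (rev (dual_word m j)) = (if i = j then 1 else 0)"
      using True i word_coeff_as [of q "i - j" "m - j" "[]"]
      by (auto simp: dual_word_def word_coeff_bs)
    with True i show ?thesis
      by (auto simp: lookup_f_elem f_org_def)
  next
    case False
    then have "j = m + 1"
      using assms by simp
    with i show ?thesis
      by (auto simp: lookup_f_elem f_org_def dual_word_def)
  qed
qed

text \<open>The condition on the ends matters for \<open>n = 0\<close>, \<open>j = 1\<close>, where
  the second word is empty and invisible in the concatenation: it forces \<open>i = m + 1\<close>,
  and there the coefficient is zero.\<close>

lemma lookup_f_elem_dual_append:
  assumes "k \<le> m + n" "i \<le> m + 1" "j \<le> n + 1" "f_end m i = f_org n j"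
  shows "Poly_Mapping.lookup (f_elem q (m + n) k) (f_org m i, dual_word m i @ dual_word n j) =
           (if i \<le> m \<and> j \<le> n \<and> i + j = k then (- q) ^ (i * (n - j)) else 0)"
proof (cases "i \<le> m \<and> j \<le> n")
  case True
  have "word_coeff q k (rev (dual_word m i @ dual_word n j)) =
      word_coeff q k (replicate j Arr_b @ replicate (n - j) Arr_a @ replicate i Arr_b @ replicate (m - i) Arr_a)"
    using True by (simp add: dual_word_def)
  \<comment> \<open>After \<open>j\<close> letters \<open>b\<close> the index is
    \<open>k - j\<close>. The later block of \<open>i\<close> letters \<open>b\<close> must bring it
    to zero, so it equals \<open>i\<close> while the \<open>n - j\<close> letters \<open>a\<close>
    are read.\<close>
  also have "\<dots> = (if i + j = k then (- q) ^ (i * (n - j)) else 0)"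
    using word_coeff_as [of q "k - j - i" "m - i" "[]"]
    by (auto simp: word_coeff_bs word_coeff_as)
  finally show ?thesis
    using True assms by (auto simp: lookup_f_elem f_org_def)
next
  case False
  \<comment> \<open>One of the two indices is the last one; either its word contains
    \<open>c\<close>, or \<open>m = 0\<close> and the path starts at vertex 2.\<close>
  with assms have "f_org m i = V2 \<or> Arr_c \<in> set (rev (dual_word m i @ dual_word n j))"
    by (auto simp: f_org_def f_end_def dual_word_def split: if_splits)
  with False assms show ?thesis
    using word_coeff_c [of "rev (dual_word m i @ dual_word n j)" q k] by (auto simp: lookup_f_elem)
qed

text \<open>For \<open>n \<ge> 1\<close> every \<open>f n j\<close> starts at vertex 1, so
  composability leaves \<open>i \<le> m\<close>. The final \<open>c\<close> then forces
  \<open>j = n + 1\<close>, and a^(m-i) b^i a^(n-1) is a power of \<open>a\<close> only for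
  \<open>i = 0\<close>.\<close>

lemma lookup_f_elem_last_dual_append:
  assumes "n \<ge> 1" "i \<le> m + 1" "j \<le> n + 1" "f_end m i = f_org n j"
  shows "Poly_Mapping.lookup (f_elem q (m + n) (m + n + 1)) (f_org m i, dual_word m i @ dual_word n j) =
           (if i = 0 \<and> j = n + 1 then 1 else 0)"
proof -
  have i: "i \<le> m"
    using assms by (auto simp: f_org_def f_end_def split: if_splits)
  show ?thesis
  proof (cases "j \<le> n")
    case True
    then have "Arr_c \<notin> set (dual_word m i @ dual_word n j)"
      using i set_dual_word by auto
    then have "dual_word m i @ dual_word n j \<noteq> replicate (m + n - 1) Arr_a @ [Arr_c]"
      by (metis in_set_conv_decomp)
    with True assms show ?thesis
      by (auto simp: f_elem_last path_elem_def lookup_single when_def)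
  next
    case False
    then have j: "j = n + 1"
      using assms by simp
    have "replicate (m + n - 1) Arr_a = replicate (m - i) Arr_a @ replicate i Arr_b @ replicate (n - 1) Arr_a \<longleftrightarrow> i = 0"
    proof
      assume eq: "replicate (m + n - 1) Arr_a = replicate (m - i) Arr_a @ replicate i Arr_b @ replicate (n - 1) Arr_a"
      have "set (replicate i Arr_b) \<subseteq> set (replicate (m + n - 1) Arr_a)"
        unfolding eq by auto
      then show "i = 0"
        by (cases "i = 0") (auto split: if_splits)
    next
      assume "i = 0"
      then show "replicate (m + n - 1) Arr_a = replicate (m - i) Arr_a @ replicate i Arr_b @ replicate (n - 1) Arr_a"
        using assms(1) by (simp flip: replicate_add)
    qed
    with i j assms show ?thesis
      by (auto simp: f_elem_last path_elem_def lookup_single when_def dual_word_def f_org_def)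
  qed
qed

section \<open>Extending cochains to the bar resolution\<close>

context quiver_algebra
begin

text \<open>The functional on the inner factors of a bar tensor that is dual to the word
  \<open>w\<close>.\<close>

definition word_eval :: "arrow list \<Rightarrow> 'k quot list \<Rightarrow> 'k" where
  "word_eval w ys = prod_list (map2 arrow_coeff w ys)"

lemma word_eval_simps [simp]:
  "word_eval [] ys = 1" "word_eval (\<alpha> # w) (y # ys) = arrow_coeff \<alpha> y * word_eval w ys"
  by (simp_all add: word_eval_def)

lemma word_eval_append:
  "length w = length ys \<Longrightarrow> word_eval (w @ w') (ys @ ys') = word_eval w ys * word_eval w' ys'"
  by (simp add: word_eval_def)

lemma word_eval_add:
  assumes "length w = length (us @ [x] @ vs)" "x \<in> carrier L" "y \<in> carrier L"
  shows "word_eval w (us @ [x \<oplus>\<^bsub>L\<^esub> y] @ vs) = word_eval w (us @ [x] @ vs) + word_eval w (us @ [y] @ vs)"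
  using assms
proof (induction us arbitrary: w)
  case Nil
  then show ?case
    by (cases w) (auto simp: arrow_coeff_add algebra_simps)
next
  case (Cons u us)
  then show ?case
    by (cases w) (auto simp: algebra_simps)
qed

text \<open>On the left \<open>s\<close> contributes \<open>\<sigma>\<close> at the target of one
  letter, on the right \<open>\<sigma>\<close> at the source of the next. These vertices coincide
  because \<open>w\<close> is a path.\<close>

lemma word_eval_balanced:
  assumes "length w = length (us @ [x, y] @ vs)" "chain_from v w" "x \<in> carrier L" "y \<in> carrier L" "s \<in> Lam0 q"
  shows "word_eval w (us @ [x \<otimes>\<^bsub>L\<^esub> s, y] @ vs) = word_eval w (us @ [x, s \<otimes>\<^bsub>L\<^esub> y] @ vs)"
  using assms
proof (induction us arbitrary: w v)
  case Nil
  then obtain \<alpha> \<beta> w' where "w = \<alpha> # \<beta> # w'" "src \<beta> = tgt \<alpha>"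
    by (auto simp: length_Suc_conv)
  with Nil show ?case
    by (elim Lam0E) (simp add: algebra_simps)
next
  case (Cons u us)
  then obtain \<alpha> w' where "w = \<alpha> # w'"
    by (cases w) auto
  with Cons.prems Cons.IH [of w' "tgt \<alpha>"] show ?case
    by simp
qed

lemma word_eval_arrows:
  "length w = length w' \<Longrightarrow> word_eval w (map (lam_arrow q) w') = (if w = w' then 1 else 0)"
  by (induction w w' rule: list_induct2) (auto simp: arrow_coeff_arrow)

text \<open>The values on \<open>eps q m i\<close>, for \<open>i \<le> m + 1\<close>, of an \<open>m\<close>-cochain.\<close>

definition cochain_values :: "nat \<Rightarrow> (nat \<Rightarrow> 'k quot) \<Rightarrow> bool" where
  "cochain_values m z \<longleftrightarrow>
     (\<forall>i\<le>m+1. z i \<in> carrier L \<and> lam_idem q (f_org m i) \<otimes>\<^bsub>L\<^esub> z i = z i \<and> z i \<otimes>\<^bsub>L\<^esub> lam_idem q (f_end m i) = z i)"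

text \<open>The extended cochain on the inner factors alone; \<open>bar_value\<close> adds the outer
  factors as multipliers on both sides.\<close>

definition mid_value :: "nat \<Rightarrow> (nat \<Rightarrow> 'k quot) \<Rightarrow> 'k quot list \<Rightarrow> 'k quot" where
  "mid_value m z ys = (\<Oplus>\<^bsub>L\<^esub>i\<in>{0..m+1}. lam_smult q (word_eval (dual_word m i) ys) (z i))"

definition bar_value :: "nat \<Rightarrow> (nat \<Rightarrow> 'k quot) \<Rightarrow> 'k quot list \<Rightarrow> 'k quot" where
  "bar_value m z xs = hd xs \<otimes>\<^bsub>L\<^esub> mid_value m z (butlast (tl xs)) \<otimes>\<^bsub>L\<^esub> last xs"

definition bar_ext :: "nat \<Rightarrow> (nat \<Rightarrow> 'k quot) \<Rightarrow> 'k bcarr \<Rightarrow> 'k quot" where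
  "bar_ext m z = pres_lift (regular L) (bar_value m z)"

context
  fixes m :: nat and z :: "nat \<Rightarrow> 'k quot"
  assumes z: "cochain_values m z"
begin

lemma values_closed: "i \<le> m + 1 \<Longrightarrow> z i \<in> carrier L"
  using z by (simp add: cochain_values_def)

lemma values_funcset: "(\<lambda>i. lam_smult q (c i) (z i)) \<in> {0..m+1} \<rightarrow> carrier L"
  using values_closed by auto

lemma mid_value_closed [simp]: "mid_value m z ys \<in> carrier L"
  unfolding mid_value_def by (rule L.finsum_closed [OF values_funcset])

lemma mid_value_add:
  assumes "length (us @ [x] @ vs) = m" "x \<in> carrier L" "y \<in> carrier L"
  shows "mid_value m z (us @ [x \<oplus>\<^bsub>L\<^esub> y] @ vs) = mid_value m z (us @ [x] @ vs) \<oplus>\<^bsub>L\<^esub> mid_value m z (us @ [y] @ vs)"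
  unfolding mid_value_def L.finsum_addf [OF values_funcset values_funcset, symmetric]
proof (rule L.finsum_cong' [OF refl])
  fix i assume "i \<in> {0..m+1}"
  moreover have "length (dual_word m i) = length (us @ [x] @ vs)"
    using assms(1) by simp
  ultimately show "lam_smult q (word_eval (dual_word m i) (us @ [x \<oplus>\<^bsub>L\<^esub> y] @ vs)) (z i) =
      lam_smult q (word_eval (dual_word m i) (us @ [x] @ vs)) (z i) \<oplus>\<^bsub>L\<^esub>
      lam_smult q (word_eval (dual_word m i) (us @ [y] @ vs)) (z i)"
    using assms(2,3) values_closed by (simp only: word_eval_add smult_add_left atLeastAtMost_iff)
qed (use values_closed in auto)

lemma mid_value_balanced:
  assumes "length (us @ [x, y] @ vs) = m" "x \<in> carrier L" "y \<in> carrier L" "s \<in> Lam0 q"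
  shows "mid_value m z (us @ [x \<otimes>\<^bsub>L\<^esub> s, y] @ vs) = mid_value m z (us @ [x, s \<otimes>\<^bsub>L\<^esub> y] @ vs)"
proof -
  have "word_eval (dual_word m i) (us @ [x \<otimes>\<^bsub>L\<^esub> s, y] @ vs) = word_eval (dual_word m i) (us @ [x, s \<otimes>\<^bsub>L\<^esub> y] @ vs)" for i
    using assms by (intro word_eval_balanced [OF _ chain_from_dual_word]) auto
  then show ?thesis
    by (simp add: mid_value_def)
qed

text \<open>\<open>s\<close> acts on \<open>z i\<close> as the scalar
  \<open>\<sigma> (f_org m i)\<close>. This vertex is the source of the first letter of
  \<open>dual_word m i\<close>, so the same factor appears when \<open>s\<close> enters the first
  inner entry.\<close>

lemma mid_value_left:
  assumes "length (y # ys) = m" "y \<in> carrier L" "s \<in> Lam0 q"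
  shows "s \<otimes>\<^bsub>L\<^esub> mid_value m z (y # ys) = mid_value m z ((s \<otimes>\<^bsub>L\<^esub> y) # ys)"
  using assms(3)
proof (elim Lam0E)
  fix \<sigma> assume s: "s \<in> carrier L"
    and l: "\<And>u v. \<lbrakk>u \<in> carrier L; lam_idem q v \<otimes>\<^bsub>L\<^esub> u = u\<rbrakk> \<Longrightarrow> s \<otimes>\<^bsub>L\<^esub> u = lam_smult q (\<sigma> v) u"
    and c: "\<And>x \<alpha>. x \<in> carrier L \<Longrightarrow> arrow_coeff \<alpha> (s \<otimes>\<^bsub>L\<^esub> x) = \<sigma> (src \<alpha>) * arrow_coeff \<alpha> x"
  have "s \<otimes>\<^bsub>L\<^esub> mid_value m z (y # ys) =
      (\<Oplus>\<^bsub>L\<^esub>i\<in>{0..m+1}. s \<otimes>\<^bsub>L\<^esub> lam_smult q (word_eval (dual_word m i) (y # ys)) (z i))"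
    unfolding mid_value_def by (rule L.finsum_rdistr [OF _ s values_funcset]) simp
  also have "\<dots> = mid_value m z ((s \<otimes>\<^bsub>L\<^esub> y) # ys)"
    unfolding mid_value_def
  proof (rule L.finsum_cong' [OF refl values_funcset])
    fix i assume i: "i \<in> {0..m+1}"
    have "length (dual_word m i) = length (y # ys)"
      using assms by simp
    then obtain \<alpha> w where w: "dual_word m i = \<alpha> # w"
      by (metis length_Suc_conv list.size(4) add.right_neutral add_Suc_right One_nat_def)
    have "src \<alpha> = f_org m i"
      using chain_from_dual_word [of m i] w by simp
    moreover have "s \<otimes>\<^bsub>L\<^esub> z i = lam_smult q (\<sigma> (f_org m i)) (z i)"
      using z i by (intro l) (auto simp: cochain_values_def)
    ultimately show "s \<otimes>\<^bsub>L\<^esub> lam_smult q (word_eval (dual_word m i) (y # ys)) (z i) =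
        lam_smult q (word_eval (dual_word m i) ((s \<otimes>\<^bsub>L\<^esub> y) # ys)) (z i)"
      using i s assms values_closed by (simp add: w c smult_mult_right smult_smult mult_ac)
  qed
  finally show ?thesis .
qed

text \<open>The counterpart at the other end: the last letter of \<open>dual_word m i\<close> has
  target \<open>f_end m i\<close>, where \<open>z i\<close> ends.\<close>

lemma mid_value_right:
  assumes "length (ys @ [y]) = m" "y \<in> carrier L" "s \<in> Lam0 q"
  shows "mid_value m z (ys @ [y]) \<otimes>\<^bsub>L\<^esub> s = mid_value m z (ys @ [y \<otimes>\<^bsub>L\<^esub> s])"
  using assms(3)
proof (elim Lam0E)
  fix \<sigma> assume s: "s \<in> carrier L"
    and r: "\<And>u v. \<lbrakk>u \<in> carrier L; u \<otimes>\<^bsub>L\<^esub> lam_idem q v = u\<rbrakk> \<Longrightarrow> u \<otimes>\<^bsub>L\<^esub> s = lam_smult q (\<sigma> v) u"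
    and c: "\<And>x \<alpha>. x \<in> carrier L \<Longrightarrow> arrow_coeff \<alpha> (x \<otimes>\<^bsub>L\<^esub> s) = \<sigma> (tgt \<alpha>) * arrow_coeff \<alpha> x"
  have "mid_value m z (ys @ [y]) \<otimes>\<^bsub>L\<^esub> s =
      (\<Oplus>\<^bsub>L\<^esub>i\<in>{0..m+1}. lam_smult q (word_eval (dual_word m i) (ys @ [y])) (z i) \<otimes>\<^bsub>L\<^esub> s)"
    unfolding mid_value_def by (rule L.finsum_ldistr [OF _ s values_funcset]) simp
  also have "\<dots> = mid_value m z (ys @ [y \<otimes>\<^bsub>L\<^esub> s])"
    unfolding mid_value_def
  proof (rule L.finsum_cong' [OF refl values_funcset])
    fix i assume i: "i \<in> {0..m+1}"
    obtain \<alpha> w where w: "dual_word m i = w @ [\<alpha>]"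
      using assms length_dual_word [of m i] by (cases "dual_word m i" rule: rev_cases) auto
    then have len: "length w = length ys"
      using assms length_dual_word [of m i] by simp
    have "tgt \<alpha> = f_end m i"
      using path_end_dual_word [of i m] w i by (simp add: path_end_def)
    moreover have "z i \<otimes>\<^bsub>L\<^esub> s = lam_smult q (\<sigma> (f_end m i)) (z i)"
      using z i by (intro r) (auto simp: cochain_values_def)
    ultimately show "lam_smult q (word_eval (dual_word m i) (ys @ [y])) (z i) \<otimes>\<^bsub>L\<^esub> s =
        lam_smult q (word_eval (dual_word m i) (ys @ [y \<otimes>\<^bsub>L\<^esub> s])) (z i)"
      using i s assms values_closed len
      by (simp add: w c word_eval_append smult_mult_left smult_smult mult_ac)
  qed
  finally show ?thesis .
qed

text \<open>With no inner factors \<open>s\<close> has to pass the whole value. In degree 0 each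
  \<open>z i\<close> starts and ends at the same vertex, so \<open>s\<close> acts on both sides as
  the same scalar.\<close>

lemma mid_value_central:
  assumes "m = 0" "s \<in> Lam0 q"
  shows "s \<otimes>\<^bsub>L\<^esub> mid_value m z [] = mid_value m z [] \<otimes>\<^bsub>L\<^esub> s"
  using assms(2)
proof (elim Lam0E)
  fix \<sigma> assume s: "s \<in> carrier L"
    and l: "\<And>u v. \<lbrakk>u \<in> carrier L; lam_idem q v \<otimes>\<^bsub>L\<^esub> u = u\<rbrakk> \<Longrightarrow> s \<otimes>\<^bsub>L\<^esub> u = lam_smult q (\<sigma> v) u"
    and r: "\<And>u v. \<lbrakk>u \<in> carrier L; u \<otimes>\<^bsub>L\<^esub> lam_idem q v = u\<rbrakk> \<Longrightarrow> u \<otimes>\<^bsub>L\<^esub> s = lam_smult q (\<sigma> v) u"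
  have "s \<otimes>\<^bsub>L\<^esub> z i = z i \<otimes>\<^bsub>L\<^esub> s" if i: "i \<le> m + 1" for i
  proof -
    have "f_org m i = f_end m i"
      using assms(1) i by (auto simp: f_org_def f_end_def)
    then show ?thesis
      using z i l [of "z i" "f_org m i"] r [of "z i" "f_end m i"] by (auto simp: cochain_values_def)
  qed
  then have "(\<Oplus>\<^bsub>L\<^esub>i\<in>{0..m+1}. s \<otimes>\<^bsub>L\<^esub> lam_smult q (word_eval (dual_word m i) []) (z i)) =
      (\<Oplus>\<^bsub>L\<^esub>i\<in>{0..m+1}. lam_smult q (word_eval (dual_word m i) []) (z i) \<otimes>\<^bsub>L\<^esub> s)"
    using s values_closed by (intro L.finsum_cong') (auto simp: smult_mult_left smult_mult_right)
  then show ?thesis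
    unfolding mid_value_def
    using L.finsum_rdistr [OF _ s values_funcset] L.finsum_ldistr [OF _ s values_funcset] by simp
qed

text \<open>The relation moving \<open>s\<close> occurs in four positions: between the two outer
  factors (only for \<open>m = 0\<close>), behind the first, before the last, or between two inner
  factors. They are settled by \<open>mid_value_central\<close>, \<open>mid_value_left\<close>,
  \<open>mid_value_right\<close> and \<open>mid_value_balanced\<close>.\<close>

lemma
  shows bar_ext_hom: "bar_ext m z \<in> hom (Bar q m) (regular L)"
    and bar_ext_pure: "xs \<in> bar_gens q m \<Longrightarrow> bar_ext m z (bar_pure q m xs) = bar_value m z xs"
proof -
  have closed: "bar_value m z xs \<in> carrier (regular L)" if "xs \<in> bar_gens q m" for xs
    using that by (elim bar_gens_hd_last) (simp add: bar_value_def regular_simps)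
  have add: "bar_value m z (us @ [x \<oplus>\<^bsub>L\<^esub> y] @ vs) =
      bar_value m z (us @ [x] @ vs) \<otimes>\<^bsub>regular L\<^esub> bar_value m z (us @ [y] @ vs)"
    if g: "us @ [x] @ vs \<in> bar_gens q m" and y: "y \<in> carrier L" for us x y vs
  proof (cases us)
    case Nil
    then obtain vs' v where "vs = vs' @ [v]"
      using g by (cases vs rule: rev_cases) (auto simp: bar_gens_def)
    with Nil g y show ?thesis
      by (simp add: bar_gens_append bar_gens_Cons regular_simps bar_value_def L.l_distr)
  next
    case (Cons u us')
    note us = Cons
    show ?thesis
    proof (cases vs rule: rev_cases)
      case Nil
      with us g y show ?thesis
        by (simp add: bar_gens_append bar_gens_Cons regular_simps bar_value_def L.r_distr)
    next
      case (snoc vs' v)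
      with us g y mid_value_add [of us' x vs' y] show ?thesis
        by (simp add: bar_gens_append bar_gens_Cons regular_simps bar_value_def L.r_distr L.l_distr butlast_append)
    qed
  qed
  have bal: "bar_value m z (us @ [x \<otimes>\<^bsub>L\<^esub> s, y] @ vs) = bar_value m z (us @ [x, s \<otimes>\<^bsub>L\<^esub> y] @ vs)"
    if g: "us @ [x, y] @ vs \<in> bar_gens q m" and s: "s \<in> Lam0 q" for us x s y vs
  proof (cases us)
    case Nil
    note us = Nil
    show ?thesis
    proof (cases vs rule: rev_cases)
      case Nil
      with us g have m: "m = 0" and xy: "x \<in> carrier L" "y \<in> carrier L"
        by (auto simp: bar_gens_def)
      have "x \<otimes>\<^bsub>L\<^esub> s \<otimes>\<^bsub>L\<^esub> mid_value m z [] \<otimes>\<^bsub>L\<^esub> y = x \<otimes>\<^bsub>L\<^esub> (s \<otimes>\<^bsub>L\<^esub> mid_value m z []) \<otimes>\<^bsub>L\<^esub> y"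
        using xy s by (simp add: L.m_assoc Lam0_closed)
      also have "\<dots> = x \<otimes>\<^bsub>L\<^esub> mid_value m z [] \<otimes>\<^bsub>L\<^esub> (s \<otimes>\<^bsub>L\<^esub> y)"
        using xy s by (simp add: mid_value_central [OF m] L.m_assoc Lam0_closed)
      finally show ?thesis
        using us Nil by (simp add: bar_value_def)
    next
      case (snoc vs' v)
      then have xy: "x \<in> carrier L" "y \<in> carrier L" "v \<in> carrier L" "length (y # vs') = m"
        using us g by (auto simp: bar_gens_def)
      then show ?thesis
        using us snoc s mid_value_left [of y vs' s]
        by (simp add: bar_value_def butlast_append L.m_assoc Lam0_closed flip: L.m_assoc)
          (simp add: L.m_assoc Lam0_closed)
    qed
  next
    case (Cons u us')
    note us = Cons
    show ?thesis
    proof (cases vs rule: rev_cases)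
      case Nil
      then have xy: "x \<in> carrier L" "y \<in> carrier L" "u \<in> carrier L" "length (us' @ [x]) = m"
        using us g by (auto simp: bar_gens_def)
      then show ?thesis
        using us Nil s
        by (simp add: bar_value_def butlast_append L.m_assoc Lam0_closed flip: mid_value_right)
    next
      case (snoc vs' v)
      with us g s mid_value_balanced [of us' x y vs' s] show ?thesis
        by (simp add: bar_gens_append bar_gens_Cons bar_value_def butlast_append)
    qed
  qed
  show "bar_ext m z \<in> hom (Bar q m) (regular L)"
    unfolding bar_ext_def by (rule Bar_lift_hom [OF L.comm_group_regular closed add bal])
  show "bar_ext m z (bar_pure q m xs) = bar_value m z xs" if "xs \<in> bar_gens q m"
    unfolding bar_ext_def by (rule Bar_lift_pure [OF L.comm_group_regular closed add bal that])
qed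

lemma bar_ext_bimod_hom: "bar_ext m z \<in> bimod_hom L (Bar q m) (regular L)"
proof -
  interpret R: bimodule_on L "regular L"
    by (rule L.bimodule_on_regular)
  have G: "group (regular L)"
    using L.comm_group_regular by (rule comm_group.axioms(2))
  have "bar_ext m z (lact (Bar q m) l x) = l \<otimes>\<^bsub>L\<^esub> bar_ext m z x"
    if l: "l \<in> carrier L" and x: "x \<in> carrier (Bar q m)" for l x
  proof (rule Bar_hom_eqI [OF G hom_comp [OF Bar_lact_hom [OF l] bar_ext_hom]
        hom_comp [OF bar_ext_hom R.lact_hom [OF l, unfolded regular_simps]] _ x])
    fix xs assume xs: "xs \<in> bar_gens q m"
    then show "bar_ext m z (lact (Bar q m) l (bar_pure q m xs)) = l \<otimes>\<^bsub>L\<^esub> bar_ext m z (bar_pure q m xs)"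
      using l by (elim bar_gens_hd_last)
        (simp add: Bar_lact_pure bar_ext_pure bar_gens_Cons bar_value_def L.m_assoc)
  qed
  moreover have "bar_ext m z (ract (Bar q m) x l) = bar_ext m z x \<otimes>\<^bsub>L\<^esub> l"
    if l: "l \<in> carrier L" and x: "x \<in> carrier (Bar q m)" for l x
  proof (rule Bar_hom_eqI [OF G hom_comp [OF Bar_ract_hom [OF l] bar_ext_hom]
        hom_comp [OF bar_ext_hom R.ract_hom [OF l, unfolded regular_simps]] _ x])
    fix xs assume xs: "xs \<in> bar_gens q m"
    then show "bar_ext m z (ract (Bar q m) (bar_pure q m xs) l) = bar_ext m z (bar_pure q m xs) \<otimes>\<^bsub>L\<^esub> l"
      using l by (elim bar_gens_hd_last)
        (simp add: Bar_ract_pure bar_ext_pure bar_gens_Cons bar_value_def L.m_assoc)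
  qed
  ultimately show ?thesis
    using bar_ext_hom by (simp add: bimod_hom_def regular_simps)
qed

end

end

lemma (in ring) finsum_swap:
  assumes "finite A" "\<And>i j. \<lbrakk>i \<in> A; j \<in> B\<rbrakk> \<Longrightarrow> f i j \<in> carrier R"
  shows "(\<Oplus>i\<in>A. \<Oplus>j\<in>B. f i j) = (\<Oplus>j\<in>B. \<Oplus>i\<in>A. f i j)"
  using assms
proof (induction A rule: finite_induct)
  case (insert a A)
  then have "(\<Oplus>i\<in>insert a A. \<Oplus>j\<in>B. f i j) = (\<Oplus>j\<in>B. f a j) \<oplus> (\<Oplus>j\<in>B. \<Oplus>i\<in>A. f i j)"
    by (subst finsum_insert) (auto intro!: finsum_closed)
  also have "\<dots> = (\<Oplus>j\<in>B. f a j \<oplus> (\<Oplus>i\<in>A. f i j))"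
    using insert.prems by (intro finsum_addf [symmetric]) (auto intro!: finsum_closed)
  also have "\<dots> = (\<Oplus>j\<in>B. \<Oplus>i\<in>insert a A. f i j)"
    using insert.hyps insert.prems by (intro finsum_cong') (auto intro!: finsum_closed)
  finally show ?case .
qed simp

lemma
  assumes M: "tensor_data (carrier L) M N" "tensor_data (carrier L) M' N'"
    and f: "f \<in> bimod_hom L M M'" and g: "g \<in> bimod_hom L N N'"
  shows bimod_tensor_map_hom:
      "tensor_map (carrier L) M' N' f g \<in> hom (tensor (carrier L) M N) (tensor (carrier L) M' N')"
    and bimod_tensor_map_pure: "\<lbrakk>x \<in> carrier M; y \<in> carrier N\<rbrakk> \<Longrightarrow>
      tensor_map (carrier L) M' N' f g (pure_tensor (carrier L) M N x y) =
      pure_tensor (carrier L) M' N' (f x) (g y)"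
  using f g tensor_data.tensor_map_hom [OF M, of f g] tensor_data.tensor_map_pure [OF M, of f g]
  by (auto simp: bimod_hom_def)

lemma bimod_hom_comp:
  assumes "f \<in> bimod_hom L M N" "g \<in> bimod_hom L N N'"
  shows "(\<lambda>x. g (f x)) \<in> bimod_hom L M N'"
proof -
  have "f x \<in> carrier N" if "x \<in> carrier M" for x
    using assms(1) that by (auto simp: bimod_hom_def dest: hom_in_carrier)
  then show ?thesis
    using assms by (auto simp: bimod_hom_def intro: hom_comp)
qed

context quiver_algebra
begin

section \<open>The embedding of the minimal resolution\<close>

abbreviation path_list :: "'k \<Rightarrow> path \<Rightarrow> 'k quot list" where
  "path_list c p \<equiv> lam_smult q c (lam_idem q (fst p)) # map (lam_arrow q) (snd p) @ [\<one>\<^bsub>L\<^esub>]"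

lemma path_list_gens: "length (snd p) = n \<Longrightarrow> path_list c p \<in> bar_gens q n"
  by (auto simp: bar_gens_def)

text \<open>A scalar crosses one tensor sign at a time by balancing, and each inner factor by
  centrality.\<close>

lemma bar_pure_slide:
  assumes "us @ [x] @ vs @ [y] \<in> bar_gens q n" "s \<in> Scal q"
  shows "bar_pure q n (us @ [x \<otimes>\<^bsub>L\<^esub> s] @ vs @ [y]) = bar_pure q n (us @ [x] @ vs @ [s \<otimes>\<^bsub>L\<^esub> y])"
  using assms(1)
proof (induction vs arbitrary: us x)
  case Nil
  then show ?case
    using bar_pure_balanced [of us x y "[]" n s] assms(2) Scal_subset_Lam0 by auto
next
  case (Cons v vs)
  have "bar_pure q n (us @ [x \<otimes>\<^bsub>L\<^esub> s, v] @ vs @ [y]) = bar_pure q n (us @ [x, s \<otimes>\<^bsub>L\<^esub> v] @ vs @ [y])"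
    using Cons.prems assms(2) Scal_subset_Lam0 by (intro bar_pure_balanced) auto
  also have "\<dots> = bar_pure q n ((us @ [x]) @ [v \<otimes>\<^bsub>L\<^esub> s] @ vs @ [y])"
    using Cons.prems assms(2) by (simp add: Scal_commute bar_gens_append)
  also have "\<dots> = bar_pure q n ((us @ [x]) @ [v] @ vs @ [s \<otimes>\<^bsub>L\<^esub> y])"
    using Cons.prems by (intro Cons.IH) simp
  finally show ?case
    by simp
qed

context
  fixes n :: nat and f :: "'k pathalg"
  assumes len: "\<And>p. p \<in> Poly_Mapping.keys f \<Longrightarrow> length (snd p) = n"
begin

lemma bar_of_f_funcset:
  "(\<lambda>p. bar_pure q n (path_list (Poly_Mapping.lookup f p) p)) \<in> Poly_Mapping.keys f \<rightarrow> carrier (Bar q n)"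
  using len by (auto intro!: bar_pure_closed path_list_gens)

lemma bar_of_f_closed: "bar_of_f q n f \<in> carrier (Bar q n)"
proof -
  interpret B: comm_group "Bar q n"
    by (rule comm_group_Bar)
  show ?thesis
    unfolding bar_of_f_def by (rule B.finprod_closed [OF bar_of_f_funcset])
qed

lemma hom_bar_of_f:
  assumes "comm_group G" "h \<in> hom (Bar q n) G"
  shows "h (bar_of_f q n f) =
    finprod G (\<lambda>p. h (bar_pure q n (path_list (Poly_Mapping.lookup f p) p))) (Poly_Mapping.keys f)"
  unfolding bar_of_f_def by (rule hom_finprod [OF comm_group_Bar assms bar_of_f_funcset])

text \<open>This is the condition \<open>g_scalar\<close> for \<open>iota\<close>: in the bar
  bimodule the two scalar actions agree because the scalar slides through all factors.\<close>

lemma bar_of_f_scalar: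
  assumes s: "s \<in> Scal q"
  shows "lact (Bar q n) s (bar_of_f q n f) = ract (Bar q n) (bar_of_f q n f) s"
proof -
  interpret B: comm_group "Bar q n"
    by (rule comm_group_Bar)
  have sL: "s \<in> carrier L"
    by (rule Scal_closed [OF s])
  have eq: "lact (Bar q n) s (bar_pure q n (path_list c p)) = ract (Bar q n) (bar_pure q n (path_list c p)) s"
    if "length (snd p) = n" for c p
    using path_list_gens [OF that, of c] sL s
      bar_pure_slide [of "[]" "lam_smult q c (lam_idem q (fst p))" "map (lam_arrow q) (snd p)" "\<one>\<^bsub>L\<^esub>" n s]
    by (simp add: Bar_lact_pure Bar_ract_pure Scal_commute butlast_append)
  show ?thesis
    unfolding hom_bar_of_f [OF comm_group_Bar Bar_lact_hom [OF sL]]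
      hom_bar_of_f [OF comm_group_Bar Bar_ract_hom [OF sL]]
    using len eq
    by (intro B.finprod_cong' refl)
      (auto intro!: hom_in_carrier [OF Bar_ract_hom [OF sL]] bar_pure_closed path_list_gens)
qed

end

lemma iota_bimod_hom: "iota q n \<in> bimod_hom L (K q n) (Bar q n)"
  unfolding iota_def
  by (rule K_extend_bimod_hom [OF bimodule_on_Bar])
    (auto intro!: bar_of_f_closed bar_of_f_scalar dest: f_elem_keys)

lemma iota_eps:
  assumes "i \<le> n + 1"
  shows "iota q n (eps q n i) =
    ract (Bar q n) (lact (Bar q n) (lam_idem q (f_org n i)) (bar_of_f q n (f_elem q n i))) (lam_idem q (f_end n i))"
  unfolding iota_def
  by (rule K_extend_eps [OF bimodule_on_Bar _ _ assms])
    (auto intro!: bar_of_f_closed bar_of_f_scalar dest: f_elem_keys)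

lemma eps_idem:
  assumes "i \<le> n + 1"
  shows "lact (K q n) (lam_idem q (f_org n i)) (eps q n i) = eps q n i"
    and "ract (K q n) (eps q n i) (lam_idem q (f_end n i)) = eps q n i"
proof -
  have one: "ract (T v w) \<one>\<^bsub>T v w\<^esub> (lam_idem q u) = \<one>\<^bsub>T v w\<^esub>"
    "lact (T v w) (lam_idem q u) \<one>\<^bsub>T v w\<^esub> = \<one>\<^bsub>T v w\<^esub>" for u v w
    using hom_one [OF T_ract_hom [OF idem_closed]] hom_one [OF T_lact_hom [OF idem_closed]] group_T by auto
  show "lact (K q n) (lam_idem q (f_org n i)) (eps q n i) = eps q n i"
    "ract (K q n) (eps q n i) (lam_idem q (f_end n i)) = eps q n i"
    by (auto simp: K_simps eps_eq sum_inj_def fun_eq_iff one T_lact_pure T_ract_pure idem_in_proj idem_mult)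
qed

lemma cochain_values_eps:
  assumes "\<phi> \<in> bimod_hom L (K q m) (regular L)"
  shows "cochain_values m (\<lambda>i. \<phi> (eps q m i))"
  unfolding cochain_values_def
proof (intro allI impI conjI)
  fix i assume i: "i \<le> m + 1"
  note eps = eps_closed [OF i, of ]
  show "\<phi> (eps q m i) \<in> carrier L"
    using assms hom_in_carrier [OF _ eps] by (fastforce simp: bimod_hom_def regular_simps)
  have "lam_idem q (f_org m i) \<otimes>\<^bsub>L\<^esub> \<phi> (eps q m i) = \<phi> (lact (K q m) (lam_idem q (f_org m i)) (eps q m i))"
    using assms eps by (simp add: bimod_hom_def regular_simps)
  then show "lam_idem q (f_org m i) \<otimes>\<^bsub>L\<^esub> \<phi> (eps q m i) = \<phi> (eps q m i)"
    using i by (simp add: eps_idem)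
  have "\<phi> (eps q m i) \<otimes>\<^bsub>L\<^esub> lam_idem q (f_end m i) = \<phi> (ract (K q m) (eps q m i) (lam_idem q (f_end m i)))"
    using assms eps by (simp add: bimod_hom_def regular_simps)
  then show "\<phi> (eps q m i) \<otimes>\<^bsub>L\<^esub> lam_idem q (f_end m i) = \<phi> (eps q m i)"
    using i by (simp add: eps_idem)
qed

lemma sum_keys_delta:
  "(\<Sum>p\<in>Poly_Mapping.keys f. Poly_Mapping.lookup f p * (if p = r then 1 else 0)) = Poly_Mapping.lookup (f :: 'k pathalg) r"
  by (simp add: if_distrib in_keys_iff cong: if_cong)

lemma regular_finprod: "finprod (regular L) f A = finsum L f A"
  by (simp add: finprod_def finsum_def regular_simps)

text \<open>The idempotent tests the origin and the arrows test the letters; in degree 0, where the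
  word is empty, the idempotent decides alone.\<close>

lemma mid_value_arrows:
  assumes z: "cochain_values m z" and w: "length w = m"
  shows "lam_idem q v \<otimes>\<^bsub>L\<^esub> mid_value m z (map (lam_arrow q) w) =
    (\<Oplus>\<^bsub>L\<^esub>i\<in>{0..m+1}. lam_smult q (if (v, w) = (f_org m i, dual_word m i) then 1 else 0) (z i))"
  unfolding mid_value_def L.finsum_rdistr [OF finite_atLeastAtMost idem_closed values_funcset [OF z]]
proof (rule L.finsum_cong' [OF refl values_funcset [OF z]])
  fix i assume i: "i \<in> {0..m+1}"
  have zi: "z i \<in> carrier L" "lam_idem q (f_org m i) \<otimes>\<^bsub>L\<^esub> z i = z i"
    using z i by (auto simp: cochain_values_def)
  have "lam_idem q v \<otimes>\<^bsub>L\<^esub> z i = (if v = f_org m i then z i else \<zero>\<^bsub>L\<^esub>)"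
    using L.m_assoc [of "lam_idem q v" "lam_idem q (f_org m i)" "z i"] zi by (auto simp: idem_mult)
  then show "lam_idem q v \<otimes>\<^bsub>L\<^esub> lam_smult q (word_eval (dual_word m i) (map (lam_arrow q) w)) (z i) =
      lam_smult q (if (v, w) = (f_org m i, dual_word m i) then 1 else 0) (z i)"
    using zi w by (auto simp: smult_mult_right word_eval_arrows)
qed

text \<open>After expanding over the support of \<open>f\<close> and exchanging the sums, the sum
  over paths contains a Kronecker delta that extracts one coefficient.\<close>

lemma bar_ext_bar_of_f:
  assumes z: "cochain_values m z" and len: "\<And>p. p \<in> Poly_Mapping.keys f \<Longrightarrow> length (snd p) = m"
  shows "bar_ext m z (bar_of_f q m f) =
    (\<Oplus>\<^bsub>L\<^esub>i\<in>{0..m+1}. lam_smult q (Poly_Mapping.lookup f (f_org m i, dual_word m i)) (z i))"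
proof -
  note [simp] = mid_value_closed [OF z]
  have zc: "z i \<in> carrier L" if "i \<le> m + 1" for i
    using values_closed [OF z that] .
  let ?c = "\<lambda>p i. Poly_Mapping.lookup f p * (if p = (f_org m i, dual_word m i) then 1 else 0)"
  have "bar_ext m z (bar_of_f q m f) =
      (\<Oplus>\<^bsub>L\<^esub>p\<in>Poly_Mapping.keys f. bar_ext m z (bar_pure q m (path_list (Poly_Mapping.lookup f p) p)))"
    using hom_bar_of_f [OF len L.comm_group_regular bar_ext_hom [OF z]] by (simp add: regular_finprod)
  also have "\<dots> = (\<Oplus>\<^bsub>L\<^esub>p\<in>Poly_Mapping.keys f. \<Oplus>\<^bsub>L\<^esub>i\<in>{0..m+1}. lam_smult q (?c p i) (z i))"
  proof (rule L.finsum_cong' [OF refl])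
    fix p assume p: "p \<in> Poly_Mapping.keys f"
    have "bar_ext m z (bar_pure q m (path_list (Poly_Mapping.lookup f p) p)) =
        lam_smult q (Poly_Mapping.lookup f p) (lam_idem q (fst p) \<otimes>\<^bsub>L\<^esub> mid_value m z (map (lam_arrow q) (snd p)))"
      by (simp add: bar_ext_pure [OF z path_list_gens [OF len [OF p]]] bar_value_def smult_mult_left)
    also have "\<dots> = (\<Oplus>\<^bsub>L\<^esub>i\<in>{0..m+1}. lam_smult q (?c p i) (z i))"
      unfolding mid_value_arrows [OF z len [OF p]] smult_finsum [OF values_funcset [OF z]]
      using zc by (intro L.finsum_cong') (auto simp: smult_smult prod_eq_iff)
    finally show "bar_ext m z (bar_pure q m (path_list (Poly_Mapping.lookup f p) p)) =
        (\<Oplus>\<^bsub>L\<^esub>i\<in>{0..m+1}. lam_smult q (?c p i) (z i))" .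
  qed (use zc in \<open>auto intro!: L.finsum_closed\<close>)
  also have "\<dots> = (\<Oplus>\<^bsub>L\<^esub>i\<in>{0..m+1}. \<Oplus>\<^bsub>L\<^esub>p\<in>Poly_Mapping.keys f. lam_smult q (?c p i) (z i))"
    using zc by (intro L.finsum_swap) auto
  also have "\<dots> = (\<Oplus>\<^bsub>L\<^esub>i\<in>{0..m+1}. lam_smult q (Poly_Mapping.lookup f (f_org m i, dual_word m i)) (z i))"
    using zc by (intro L.finsum_cong') (auto simp del: mult_eq_0_iff simp flip: smult_sum simp: sum_keys_delta)
  finally show ?thesis .
qed

text \<open>Agreement on the generators is enough. There the duality of the words leaves a single
  cochain value, which absorbs the idempotents from \<open>iota_eps\<close>.\<close>

lemma bar_ext_iota:
  assumes \<phi>: "\<phi> \<in> bimod_hom L (K q m) (regular L)" and x: "x \<in> carrier (K q m)"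
  shows "bar_ext m (\<lambda>i. \<phi> (eps q m i)) (iota q m x) = \<phi> x"
proof (rule K_hom_eqI [OF _ bimod_hom_comp [OF iota_bimod_hom] \<phi> _ x])
  let ?z = "\<lambda>i. \<phi> (eps q m i)"
  have z: "cochain_values m ?z"
    by (rule cochain_values_eps [OF \<phi>])
  show "group (regular L)"
    using L.comm_group_regular by (rule comm_group.axioms(2))
  show "bar_ext m ?z \<in> bimod_hom L (Bar q m) (regular L)"
    by (rule bar_ext_bimod_hom [OF z])
  fix i assume i: "i \<le> m + 1"
  interpret B: bimodule_on L "Bar q m"
    by (rule bimodule_on_Bar)
  have len: "length (snd p) = m" if "p \<in> Poly_Mapping.keys (f_elem q m i)" for p
    using f_elem_keys [OF that i] .
  have b: "bar_of_f q m (f_elem q m i) \<in> carrier (Bar q m)"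
    by (rule bar_of_f_closed [OF len])
  have "bar_ext m ?z (bar_of_f q m (f_elem q m i)) = (\<Oplus>\<^bsub>L\<^esub>j\<in>{0..m+1}. if i = j then ?z j else \<zero>\<^bsub>L\<^esub>)"
  proof (subst bar_ext_bar_of_f [OF z])
    show "(\<Oplus>\<^bsub>L\<^esub>j\<in>{0..m+1}. lam_smult q (Poly_Mapping.lookup (f_elem q m i) (f_org m j, dual_word m j)) (?z j)) =
        (\<Oplus>\<^bsub>L\<^esub>j\<in>{0..m+1}. if i = j then ?z j else \<zero>\<^bsub>L\<^esub>)"
      using i values_closed [OF z] by (intro L.finsum_cong') (auto simp: lookup_f_elem_dual)
  qed (rule len)
  also have "\<dots> = ?z i"
    using i values_closed [OF z] by (intro L.finsum_singleton) auto
  finally show "bar_ext m ?z (iota q m (eps q m i)) = \<phi> (eps q m i)"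
    using bar_ext_bimod_hom [OF z] z i b B.lact_closed [OF idem_closed b]
    by (simp add: iota_eps bimod_hom_def regular_simps cochain_values_def)
qed

section \<open>The comultiplication of the bar resolution\<close>

lemma tensor_data_Bar: "tensor_data (carrier L) (Bar q m) (Bar q n)"
  by (rule bimodule_on_tensor_data [OF bimodule_on_Bar bimodule_on_Bar])

lemma tensor_data_regular: "tensor_data (carrier L) (regular L) (regular L)"
  by (rule bimodule_on_tensor_data [OF L.bimodule_on_regular L.bimodule_on_regular])

definition bar_split :: "nat \<Rightarrow> nat \<Rightarrow> 'k quot list \<Rightarrow> (('k bcarr \<times> 'k bcarr) \<Rightarrow>\<^sub>0 int) set" where
  "bar_split n r xs = pure_tensor (carrier L) (Bar q r) (Bar q (n - r))
     (bar_pure q r (take (r + 1) xs @ [\<one>\<^bsub>L\<^esub>])) (bar_pure q (n - r) (\<one>\<^bsub>L\<^esub> # drop (r + 1) xs))"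

context
  fixes n r :: nat
  assumes r: "r \<le> n"
begin

interpretation TB: tensor_data "carrier L" "Bar q r" "Bar q (n - r)"
  by (rule tensor_data_Bar)

lemma bar_split_gens:
  assumes "xs \<in> bar_gens q n"
  shows "take (r + 1) xs @ [\<one>\<^bsub>L\<^esub>] \<in> bar_gens q r" "\<one>\<^bsub>L\<^esub> # drop (r + 1) xs \<in> bar_gens q (n - r)"
  using assms r by (auto simp: bar_gens_def dest: in_set_takeD in_set_dropD)

lemma bar_split_closed:
  "xs \<in> bar_gens q n \<Longrightarrow> bar_split n r xs \<in> carrier (tensor (carrier L) (Bar q r) (Bar q (n - r)))"
  unfolding bar_split_def by (intro TB.pure_tensor_closed bar_pure_closed bar_split_gens)

lemma bar_split_add:
  assumes g: "us @ [x] @ vs \<in> bar_gens q n" and y: "y \<in> carrier L"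
  shows "bar_split n r (us @ [x \<oplus>\<^bsub>L\<^esub> y] @ vs) =
    bar_split n r (us @ [x] @ vs) \<otimes>\<^bsub>tensor (carrier L) (Bar q r) (Bar q (n - r))\<^esub> bar_split n r (us @ [y] @ vs)"
proof -
  have g': "us @ [y] @ vs \<in> bar_gens q n"
    using g y by (auto simp: bar_gens_append)
  note gens = bar_split_gens [OF g] bar_split_gens [OF g']
  note closed = gens [THEN bar_pure_closed]
  show ?thesis
  \<comment> \<open>The varying entry has position \<open>length us\<close>, and the left part takes
    \<open>r + 1\<close> entries, so it lies left of the cut exactly in this case.\<close>
  proof (cases "length us \<le> r")
    case True
    then have take: "take (r + 1) (us @ [w] @ vs) @ [\<one>\<^bsub>L\<^esub>] = us @ [w] @ (take (r - length us) vs @ [\<one>\<^bsub>L\<^esub>])"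
      and drop: "drop (r + 1) (us @ [w] @ vs) = drop (r - length us) vs" for w
      by (auto simp: Suc_diff_le)
    show ?thesis
      using TB.pure_tensor_add_left [OF closed(1,3,2)] bar_pure_add [OF gens(1) [unfolded take] y]
      unfolding bar_split_def take drop by simp
  next
    case False
    then have take: "take (r + 1) (us @ [w] @ vs) = take (r + 1) us"
      and drop: "\<one>\<^bsub>L\<^esub> # drop (r + 1) (us @ [w] @ vs) = (\<one>\<^bsub>L\<^esub> # drop (r + 1) us) @ [w] @ vs" for w
      by auto
    show ?thesis
      using TB.pure_tensor_add_right [OF closed(1,2,4)] bar_pure_add [OF gens(2) [unfolded drop] y]
      unfolding bar_split_def take drop by simp
  qed
qed

lemma bar_split_balanced:
  assumes g: "us @ [x, y] @ vs \<in> bar_gens q n" and s: "s \<in> Lam0 q"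
  shows "bar_split n r (us @ [x \<otimes>\<^bsub>L\<^esub> s, y] @ vs) = bar_split n r (us @ [x, s \<otimes>\<^bsub>L\<^esub> y] @ vs)"
proof -
  have sL: "s \<in> carrier L" and xy: "x \<in> carrier L" "y \<in> carrier L"
    using g s by (auto simp: Lam0_closed bar_gens_append)
  note gens = bar_split_gens [OF g]
  consider "length us < r" | "length us = r" | "r < length us"
    by linarith
  then show ?thesis
  proof cases
    case 1
    then have take: "take (r + 1) (us @ [w, w'] @ vs) @ [\<one>\<^bsub>L\<^esub>] = us @ [w, w'] @ (take (r - length us - 1) vs @ [\<one>\<^bsub>L\<^esub>])"
      and drop: "drop (r + 1) (us @ [w, w'] @ vs) = drop (r - length us - 1) vs" for w w'
      by (auto simp: Suc_diff_le take_Cons' drop_Cons')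
    show ?thesis
      using bar_pure_balanced [OF gens(1) [unfolded take] s]
      unfolding bar_split_def take drop by simp
  next
    \<comment> \<open>The cut separates \<open>x\<close> from \<open>y\<close>: \<open>s\<close>
      moves onto the unit closing the left part, crosses the tensor product over \<Lambda> as an
      action, and passes from the unit opening the right part to \<open>y\<close>.\<close>
    case 2
    then have take: "take (r + 1) (us @ [w, w'] @ vs) = us @ [w]"
      and drop: "drop (r + 1) (us @ [w, w'] @ vs) = w' # vs" for w w'
      by auto
    have gens': "us @ [x, \<one>\<^bsub>L\<^esub>] @ [] \<in> bar_gens q r" "\<one>\<^bsub>L\<^esub> # y # vs \<in> bar_gens q (n - r)"
      using gens unfolding take drop by simp_all
    have "bar_pure q r ((us @ [x \<otimes>\<^bsub>L\<^esub> s]) @ [\<one>\<^bsub>L\<^esub>]) = ract (Bar q r) (bar_pure q r (us @ [x, \<one>\<^bsub>L\<^esub>])) s"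
      using bar_pure_balanced [OF gens'(1) s] gens'(1) sL
      by (simp add: Bar_ract_pure butlast_append)
    moreover have "bar_pure q (n - r) (\<one>\<^bsub>L\<^esub> # (s \<otimes>\<^bsub>L\<^esub> y) # vs) = lact (Bar q (n - r)) s (bar_pure q (n - r) (\<one>\<^bsub>L\<^esub> # y # vs))"
      using bar_pure_balanced [of "[]" "\<one>\<^bsub>L\<^esub>" y vs "n - r" s] gens'(2) sL s
      by (simp add: Bar_lact_pure)
    ultimately show ?thesis
      unfolding bar_split_def take drop
      using TB.pure_tensor_balanced [OF bar_pure_closed sL bar_pure_closed [OF gens'(2)]] gens'(1) by simp
  next
    case 3
    then have take: "take (r + 1) (us @ [w, w'] @ vs) = take (r + 1) us"
      and drop: "\<one>\<^bsub>L\<^esub> # drop (r + 1) (us @ [w, w'] @ vs) = (\<one>\<^bsub>L\<^esub> # drop (r + 1) us) @ [w, w'] @ vs" for w w'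
      by auto
    show ?thesis
      using bar_pure_balanced [OF gens(2) [unfolded drop] s]
      unfolding bar_split_def take drop by simp
  qed
qed

end

lemma
  shows bar_comult_hom: "bar_comult q n \<in> hom (Bar q n) (tensor_square L (Bar q) n)"
    and bar_comult_pure: "xs \<in> bar_gens q n \<Longrightarrow>
      bar_comult q n (bar_pure q n xs) = (\<lambda>r\<in>{0..n}. bar_split n r xs)"
proof -
  let ?G = "tensor_square L (Bar q) n"
  have G: "comm_group ?G"
    unfolding tensor_square_def
    by (intro comm_group_bimod_sum tensor_data.comm_group_tensor tensor_data_Bar)
  have eq: "bar_comult q n = pres_lift ?G (\<lambda>xs. \<lambda>r\<in>{0..n}. bar_split n r xs)"
    by (simp add: bar_comult_def bar_split_def)
  have closed: "(\<lambda>r\<in>{0..n}. bar_split n r xs) \<in> carrier ?G" if "xs \<in> bar_gens q n" for xs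
    using that by (auto simp: tensor_square_def bar_split_closed bimod_sum_simps)
  have add: "(\<lambda>r\<in>{0..n}. bar_split n r (us @ [x \<oplus>\<^bsub>L\<^esub> y] @ vs)) =
      (\<lambda>r\<in>{0..n}. bar_split n r (us @ [x] @ vs)) \<otimes>\<^bsub>?G\<^esub> (\<lambda>r\<in>{0..n}. bar_split n r (us @ [y] @ vs))"
    if "us @ [x] @ vs \<in> bar_gens q n" "y \<in> carrier L" for us x y vs
    using bar_split_add [OF _ that] by (auto simp: tensor_square_def bimod_sum_simps fun_eq_iff)
  have bal: "(\<lambda>r\<in>{0..n}. bar_split n r (us @ [x \<otimes>\<^bsub>L\<^esub> s, y] @ vs)) = (\<lambda>r\<in>{0..n}. bar_split n r (us @ [x, s \<otimes>\<^bsub>L\<^esub> y] @ vs))"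
    if "us @ [x, y] @ vs \<in> bar_gens q n" "s \<in> Lam0 q" for us x s y vs
    using bar_split_balanced [OF _ that] by (auto simp: fun_eq_iff)
  show "bar_comult q n \<in> hom (Bar q n) ?G"
    unfolding eq by (rule Bar_lift_hom [OF G closed add bal])
  show "bar_comult q n (bar_pure q n xs) = (\<lambda>r\<in>{0..n}. bar_split n r xs)" if "xs \<in> bar_gens q n"
    unfolding eq by (rule Bar_lift_pure [OF G closed add bal that])
qed

section \<open>The cup product\<close>

lemma mult_map_hom: "mult_map q \<in> hom (tensor (carrier L) (regular L) (regular L)) (regular L)"
  unfolding mult_map_def
  by (rule tensor_data.tensor_lift_hom [OF tensor_data_regular L.comm_group_regular])
    (simp_all add: regular_simps L.l_distr L.r_distr L.m_assoc)

lemma mult_map_pure: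
  assumes "x \<in> carrier L" "y \<in> carrier L"
  shows "mult_map q (pure_tensor (carrier L) (regular L) (regular L) x y) = x \<otimes>\<^bsub>L\<^esub> y"
  unfolding mult_map_def
  by (rule tensor_data.tensor_lift_pure [OF tensor_data_regular L.comm_group_regular])
    (use assms in \<open>simp_all add: regular_simps L.l_distr L.r_distr L.m_assoc\<close>)

text \<open>\<open>cochain_tensor\<close> takes its sign as an integer multiple in an additive
  group, while the formulas for the cup product have it as a field element.\<close>

lemma regular_int_pow_sign:
  assumes "x \<in> carrier L"
  shows "x [^]\<^bsub>regular L\<^esub> ((-1) ^ k :: int) = lam_smult q ((-1) ^ k) x"
proof -
  interpret G: comm_group "regular L"
    by (rule L.comm_group_regular)
  have x: "x \<in> carrier (regular L)"
    using assms by (simp add: regular_simps)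
  have "lam_smult q (-1) x \<oplus>\<^bsub>L\<^esub> x = lam_smult q (-1 + 1) x"
    using assms by (simp only: smult_add_left smult_1)
  then have "inv\<^bsub>regular L\<^esub> x = lam_smult q (-1) x"
    using assms by (intro G.inv_equality) (simp_all add: regular_simps)
  then show ?thesis
    using assms x by (cases "even k") (simp_all add: G.int_pow_neg)
qed

text \<open>Only component \<open>m\<close> enters, since \<phi> \<otimes> \<mu> vanishes on the
  others. The sign is left out here and restored in \<open>cup_eps\<close>.\<close>

definition bar_pairing :: "nat \<Rightarrow> nat \<Rightarrow> (nat \<Rightarrow> 'k quot) \<Rightarrow> (nat \<Rightarrow> 'k quot) \<Rightarrow> 'k bcarr \<Rightarrow> 'k quot" where
  "bar_pairing m n y z x =
     mult_map q (tensor_map (carrier L) (regular L) (regular L) (bar_ext m y) (bar_ext n z) (bar_comult q (m + n) x m))"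

context
  fixes m n :: nat and y z :: "nat \<Rightarrow> 'k quot"
  assumes y: "cochain_values m y" and z: "cochain_values n z"
begin

lemma bar_pairing_hom: "bar_pairing m n y z \<in> hom (Bar q (m + n)) (regular L)"
proof -
  have "(\<lambda>x. bar_comult q (m + n) x m) \<in> hom (Bar q (m + n)) (tensor (carrier L) (Bar q m) (Bar q n))"
    using hom_comp [OF bar_comult_hom [of "m + n", unfolded tensor_square_def] bimod_sum_component_hom [of m]]
    by simp
  moreover have "tensor_map (carrier L) (regular L) (regular L) (bar_ext m y) (bar_ext n z)
      \<in> hom (tensor (carrier L) (Bar q m) (Bar q n)) (tensor (carrier L) (regular L) (regular L))"
    by (rule bimod_tensor_map_hom [OF tensor_data_Bar tensor_data_regular bar_ext_bimod_hom [OF y] bar_ext_bimod_hom [OF z]])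
  ultimately show ?thesis
    unfolding bar_pairing_def [abs_def] by (intro hom_comp [OF hom_comp mult_map_hom])
qed

text \<open>The units inserted at the cut are neutral, so the two inner blocks are evaluated side by
  side.\<close>

lemma bar_pairing_pure:
  assumes x: "x \<in> carrier L" "w \<in> carrier L" "length xs = m + n" "set xs \<subseteq> carrier L"
  shows "bar_pairing m n y z (bar_pure q (m + n) (x # xs @ [w])) =
    x \<otimes>\<^bsub>L\<^esub> (mid_value m y (take m xs) \<otimes>\<^bsub>L\<^esub> mid_value n z (drop m xs)) \<otimes>\<^bsub>L\<^esub> w"
proof -
  note [simp] = mid_value_closed [OF y] mid_value_closed [OF z]
  have g: "x # xs @ [w] \<in> bar_gens q (m + n)"
    using x by (auto simp: bar_gens_def)
  have g1: "x # take m xs @ [\<one>\<^bsub>L\<^esub>] \<in> bar_gens q m" and g2: "\<one>\<^bsub>L\<^esub> # drop m xs @ [w] \<in> bar_gens q n"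
    using x by (auto simp: bar_gens_def dest: in_set_takeD in_set_dropD)
  have "bar_comult q (m + n) (bar_pure q (m + n) (x # xs @ [w])) m =
      pure_tensor (carrier L) (Bar q m) (Bar q n) (bar_pure q m (x # take m xs @ [\<one>\<^bsub>L\<^esub>])) (bar_pure q n (\<one>\<^bsub>L\<^esub> # drop m xs @ [w]))"
    using x by (simp add: bar_comult_pure [OF g] bar_split_def)
  then have "bar_pairing m n y z (bar_pure q (m + n) (x # xs @ [w])) =
      mult_map q (pure_tensor (carrier L) (regular L) (regular L)
        (bar_value m y (x # take m xs @ [\<one>\<^bsub>L\<^esub>])) (bar_value n z (\<one>\<^bsub>L\<^esub> # drop m xs @ [w])))"
    unfolding bar_pairing_def
    by (simp add: bimod_tensor_map_pure [OF tensor_data_Bar tensor_data_regular bar_ext_bimod_hom [OF y] bar_ext_bimod_hom [OF z]]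
        bar_pure_closed [OF g1] bar_pure_closed [OF g2] bar_ext_pure [OF y g1] bar_ext_pure [OF z g2])
  then show ?thesis
    using x by (simp add: bar_value_def mult_map_pure L.m_assoc)
qed

text \<open>Allows the idempotents in \<open>iota_eps\<close> to be taken out of the
  pairing.\<close>

lemma bar_pairing_linear:
  assumes l: "l \<in> carrier L" "l' \<in> carrier L" and t: "t \<in> carrier (Bar q (m + n))"
  shows "bar_pairing m n y z (ract (Bar q (m + n)) (lact (Bar q (m + n)) l t) l') = l \<otimes>\<^bsub>L\<^esub> bar_pairing m n y z t \<otimes>\<^bsub>L\<^esub> l'"
proof -
  interpret R: bimodule_on L "regular L"
    by (rule L.bimodule_on_regular)
  have G: "group (regular L)"
    using L.comm_group_regular by (rule comm_group.axioms(2))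
  note [simp] = mid_value_closed [OF y] mid_value_closed [OF z]
  show ?thesis
  proof (rule Bar_hom_eqI [OF G hom_comp [OF hom_comp [OF Bar_lact_hom [OF l(1)] Bar_ract_hom [OF l(2)]] bar_pairing_hom]
        hom_comp [OF hom_comp [OF bar_pairing_hom R.lact_hom [OF l(1)]] R.ract_hom [OF l(2)], unfolded regular_simps] _ t])
    fix xs assume xs: "xs \<in> bar_gens q (m + n)"
    then show "bar_pairing m n y z (ract (Bar q (m + n)) (lact (Bar q (m + n)) l (bar_pure q (m + n) xs)) l') =
        l \<otimes>\<^bsub>L\<^esub> bar_pairing m n y z (bar_pure q (m + n) xs) \<otimes>\<^bsub>L\<^esub> l'"
      using l by (elim bar_gens_hd_last)
        (simp add: Bar_lact_pure Bar_ract_pure bar_pairing_pure bar_gens_Cons L.m_assoc)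
  qed
qed

text \<open>The analogue of \<open>bar_ext_bar_of_f\<close> for two factors. The origin of the
  second word is not tested by the coefficient; products that do not compose vanish by
  \<open>values_mult_eq_0\<close>.\<close>

lemma bar_pairing_bar_of_f:
  assumes len: "\<And>p. p \<in> Poly_Mapping.keys f \<Longrightarrow> length (snd p) = m + n"
  shows "bar_pairing m n y z (bar_of_f q (m + n) f) =
    (\<Oplus>\<^bsub>L\<^esub>i\<in>{0..m+1}. \<Oplus>\<^bsub>L\<^esub>j\<in>{0..n+1}.
       lam_smult q (Poly_Mapping.lookup f (f_org m i, dual_word m i @ dual_word n j)) (y i \<otimes>\<^bsub>L\<^esub> z j))"
proof -
  note [simp] = mid_value_closed [OF y] mid_value_closed [OF z]
  note yc = values_closed [OF y] and zc = values_closed [OF z]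
  let ?c = "\<lambda>p i j. Poly_Mapping.lookup f p * (if p = (f_org m i, dual_word m i @ dual_word n j) then 1 else 0)"
  have "bar_pairing m n y z (bar_of_f q (m + n) f) =
      (\<Oplus>\<^bsub>L\<^esub>p\<in>Poly_Mapping.keys f. bar_pairing m n y z (bar_pure q (m + n) (path_list (Poly_Mapping.lookup f p) p)))"
    using hom_bar_of_f [OF len L.comm_group_regular bar_pairing_hom] by (simp add: regular_finprod)
  also have "\<dots> = (\<Oplus>\<^bsub>L\<^esub>p\<in>Poly_Mapping.keys f. \<Oplus>\<^bsub>L\<^esub>i\<in>{0..m+1}. \<Oplus>\<^bsub>L\<^esub>j\<in>{0..n+1}. lam_smult q (?c p i j) (y i \<otimes>\<^bsub>L\<^esub> z j))"
  proof (rule L.finsum_cong' [OF refl])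
    fix p assume p: "p \<in> Poly_Mapping.keys f"
    let ?u = "map (lam_arrow q) (take m (snd p))" and ?v = "map (lam_arrow q) (drop m (snd p))"
    let ?a = "\<lambda>i. if (fst p, take m (snd p)) = (f_org m i, dual_word m i) then 1 else 0 :: 'k"
    let ?b = "\<lambda>j. word_eval (dual_word n j) ?v"
    have tl: "length (take m (snd p)) = m" "length (drop m (snd p)) = n"
      using len [OF p] by auto
    have b: "?b j = (if dual_word n j = drop m (snd p) then 1 else 0)" for j
      by (rule word_eval_arrows) (simp only: tl length_dual_word)
    \<comment> \<open>Both dual words have fixed length, so the cut at \<open>m\<close> is unique
      and the two Kronecker deltas combine into one for the concatenation.\<close>
    have ab: "Poly_Mapping.lookup f p * (?a i * ?b j) = ?c p i j" for i j
    proof -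
      have "snd p = dual_word m i @ dual_word n j \<longleftrightarrow> take m (snd p) = dual_word m i \<and> drop m (snd p) = dual_word n j"
        by (metis append_take_drop_id append_eq_append_conv tl(1) length_dual_word)
      then show ?thesis
        by (auto simp: b prod_eq_iff)
    qed
    have "bar_pairing m n y z (bar_pure q (m + n) (path_list (Poly_Mapping.lookup f p) p)) =
        lam_smult q (Poly_Mapping.lookup f p) ((lam_idem q (fst p) \<otimes>\<^bsub>L\<^esub> mid_value m y ?u) \<otimes>\<^bsub>L\<^esub> mid_value n z ?v)"
      using len [OF p]
      by (subst bar_pairing_pure) (auto simp: smult_mult_left L.m_assoc take_map drop_map)
    also have "(lam_idem q (fst p) \<otimes>\<^bsub>L\<^esub> mid_value m y ?u) \<otimes>\<^bsub>L\<^esub> mid_value n z ?v =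
        (\<Oplus>\<^bsub>L\<^esub>i\<in>{0..m+1}. lam_smult q (?a i) (y i) \<otimes>\<^bsub>L\<^esub> mid_value n z ?v)"
      unfolding mid_value_arrows [OF y tl(1)] using yc
      by (intro L.finsum_ldistr) auto
    also have "\<dots> = (\<Oplus>\<^bsub>L\<^esub>i\<in>{0..m+1}. \<Oplus>\<^bsub>L\<^esub>j\<in>{0..n+1}. lam_smult q (?a i * ?b j) (y i \<otimes>\<^bsub>L\<^esub> z j))"
    proof (rule L.finsum_cong' [OF refl])
      fix i assume i: "i \<in> {0..m+1}"
      have "lam_smult q (?a i) (y i) \<otimes>\<^bsub>L\<^esub> mid_value n z ?v =
          (\<Oplus>\<^bsub>L\<^esub>j\<in>{0..n+1}. lam_smult q (?a i) (y i) \<otimes>\<^bsub>L\<^esub> lam_smult q (?b j) (z j))"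
        unfolding mid_value_def using yc zc i by (intro L.finsum_rdistr) auto
      also have "\<dots> = (\<Oplus>\<^bsub>L\<^esub>j\<in>{0..n+1}. lam_smult q (?a i * ?b j) (y i \<otimes>\<^bsub>L\<^esub> z j))"
        using yc zc i
        by (intro L.finsum_cong' refl) (auto simp: smult_mult_left smult_mult_right smult_smult)
      finally show "lam_smult q (?a i) (y i) \<otimes>\<^bsub>L\<^esub> mid_value n z ?v =
          (\<Oplus>\<^bsub>L\<^esub>j\<in>{0..n+1}. lam_smult q (?a i * ?b j) (y i \<otimes>\<^bsub>L\<^esub> z j))" .
    qed (use yc zc in \<open>auto intro!: L.finsum_closed\<close>)
    also have "lam_smult q (Poly_Mapping.lookup f p) \<dots> =
        (\<Oplus>\<^bsub>L\<^esub>i\<in>{0..m+1}. \<Oplus>\<^bsub>L\<^esub>j\<in>{0..n+1}. lam_smult q (?c p i j) (y i \<otimes>\<^bsub>L\<^esub> z j))"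
    proof (subst smult_finsum)
      show "(\<Oplus>\<^bsub>L\<^esub>i\<in>{0..m+1}. lam_smult q (Poly_Mapping.lookup f p) (\<Oplus>\<^bsub>L\<^esub>j\<in>{0..n+1}. lam_smult q (?a i * ?b j) (y i \<otimes>\<^bsub>L\<^esub> z j))) =
          (\<Oplus>\<^bsub>L\<^esub>i\<in>{0..m+1}. \<Oplus>\<^bsub>L\<^esub>j\<in>{0..n+1}. lam_smult q (?c p i j) (y i \<otimes>\<^bsub>L\<^esub> z j))"
      proof (rule L.finsum_cong' [OF refl])
        fix i assume i: "i \<in> {0..m+1}"
        have "lam_smult q (Poly_Mapping.lookup f p) (\<Oplus>\<^bsub>L\<^esub>j\<in>{0..n+1}. lam_smult q (?a i * ?b j) (y i \<otimes>\<^bsub>L\<^esub> z j)) =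
            (\<Oplus>\<^bsub>L\<^esub>j\<in>{0..n+1}. lam_smult q (Poly_Mapping.lookup f p) (lam_smult q (?a i * ?b j) (y i \<otimes>\<^bsub>L\<^esub> z j)))"
          using yc zc i by (intro smult_finsum) auto
        also have "\<dots> = (\<Oplus>\<^bsub>L\<^esub>j\<in>{0..n+1}. lam_smult q (?c p i j) (y i \<otimes>\<^bsub>L\<^esub> z j))"
          unfolding ab [symmetric] using yc zc i by (intro L.finsum_cong' refl) (auto simp: smult_smult)
        finally show "lam_smult q (Poly_Mapping.lookup f p) (\<Oplus>\<^bsub>L\<^esub>j\<in>{0..n+1}. lam_smult q (?a i * ?b j) (y i \<otimes>\<^bsub>L\<^esub> z j)) =
            (\<Oplus>\<^bsub>L\<^esub>j\<in>{0..n+1}. lam_smult q (?c p i j) (y i \<otimes>\<^bsub>L\<^esub> z j))" .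
      qed (use yc zc in \<open>auto intro!: L.finsum_closed\<close>)
    qed (use yc zc in \<open>auto intro!: L.finsum_closed\<close>)
    finally show "bar_pairing m n y z (bar_pure q (m + n) (path_list (Poly_Mapping.lookup f p) p)) =
        (\<Oplus>\<^bsub>L\<^esub>i\<in>{0..m+1}. \<Oplus>\<^bsub>L\<^esub>j\<in>{0..n+1}. lam_smult q (?c p i j) (y i \<otimes>\<^bsub>L\<^esub> z j))" .
  qed (use yc zc in \<open>auto intro!: L.finsum_closed\<close>)
  also have "\<dots> = (\<Oplus>\<^bsub>L\<^esub>i\<in>{0..m+1}. \<Oplus>\<^bsub>L\<^esub>p\<in>Poly_Mapping.keys f. \<Oplus>\<^bsub>L\<^esub>j\<in>{0..n+1}. lam_smult q (?c p i j) (y i \<otimes>\<^bsub>L\<^esub> z j))"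
    using yc zc by (intro L.finsum_swap) (auto intro!: L.finsum_closed)
  also have "\<dots> = (\<Oplus>\<^bsub>L\<^esub>i\<in>{0..m+1}. \<Oplus>\<^bsub>L\<^esub>j\<in>{0..n+1}.
       lam_smult q (Poly_Mapping.lookup f (f_org m i, dual_word m i @ dual_word n j)) (y i \<otimes>\<^bsub>L\<^esub> z j))"
  proof (rule L.finsum_cong' [OF refl])
    fix i assume i: "i \<in> {0..m+1}"
    have "(\<Oplus>\<^bsub>L\<^esub>p\<in>Poly_Mapping.keys f. \<Oplus>\<^bsub>L\<^esub>j\<in>{0..n+1}. lam_smult q (?c p i j) (y i \<otimes>\<^bsub>L\<^esub> z j)) =
        (\<Oplus>\<^bsub>L\<^esub>j\<in>{0..n+1}. \<Oplus>\<^bsub>L\<^esub>p\<in>Poly_Mapping.keys f. lam_smult q (?c p i j) (y i \<otimes>\<^bsub>L\<^esub> z j))"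
      using yc zc i by (intro L.finsum_swap) auto
    also have "\<dots> = (\<Oplus>\<^bsub>L\<^esub>j\<in>{0..n+1}.
       lam_smult q (Poly_Mapping.lookup f (f_org m i, dual_word m i @ dual_word n j)) (y i \<otimes>\<^bsub>L\<^esub> z j))"
    proof (rule L.finsum_cong' [OF refl])
      fix j assume "j \<in> {0..n+1}"
      with i have "y i \<otimes>\<^bsub>L\<^esub> z j \<in> carrier L"
        using yc zc by simp
      then show "(\<Oplus>\<^bsub>L\<^esub>p\<in>Poly_Mapping.keys f. lam_smult q (?c p i j) (y i \<otimes>\<^bsub>L\<^esub> z j)) =
          lam_smult q (Poly_Mapping.lookup f (f_org m i, dual_word m i @ dual_word n j)) (y i \<otimes>\<^bsub>L\<^esub> z j)"
        by (simp only: smult_sum [symmetric] sum_keys_delta)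
    qed (use yc zc i in auto)
    finally show "(\<Oplus>\<^bsub>L\<^esub>p\<in>Poly_Mapping.keys f. \<Oplus>\<^bsub>L\<^esub>j\<in>{0..n+1}. lam_smult q (?c p i j) (y i \<otimes>\<^bsub>L\<^esub> z j)) =
        (\<Oplus>\<^bsub>L\<^esub>j\<in>{0..n+1}.
       lam_smult q (Poly_Mapping.lookup f (f_org m i, dual_word m i @ dual_word n j)) (y i \<otimes>\<^bsub>L\<^esub> z j))" .
  qed (use yc zc in \<open>auto intro!: L.finsum_closed\<close>)
  finally show ?thesis .
qed

text \<open>Distinct idempotents meet in the middle of the product. This covers the pairs excluded
  by the condition on the ends in the coefficient formulas.\<close>

lemma values_mult_eq_0:
  assumes "i \<le> m + 1" "j \<le> n + 1" "f_end m i \<noteq> f_org n j"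
  shows "y i \<otimes>\<^bsub>L\<^esub> z j = \<zero>\<^bsub>L\<^esub>"
proof -
  have "y i \<in> carrier L" "z j \<in> carrier L" "y i \<otimes>\<^bsub>L\<^esub> lam_idem q (f_end m i) = y i" "lam_idem q (f_org n j) \<otimes>\<^bsub>L\<^esub> z j = z j"
    using y z assms by (auto simp: cochain_values_def)
  then have "y i \<otimes>\<^bsub>L\<^esub> z j = y i \<otimes>\<^bsub>L\<^esub> (lam_idem q (f_end m i) \<otimes>\<^bsub>L\<^esub> lam_idem q (f_org n j)) \<otimes>\<^bsub>L\<^esub> z j"
    by (metis L.m_assoc L.m_closed idem_closed)
  with assms \<open>y i \<in> carrier L\<close> \<open>z j \<in> carrier L\<close> show ?thesis
    by (simp add: idem_mult)
qed

lemma bar_pairing_f_elem: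
  assumes k: "k \<le> m + n"
  shows "bar_pairing m n y z (bar_of_f q (m + n) (f_elem q (m + n) k)) =
    (\<Oplus>\<^bsub>L\<^esub>i\<in>{max 0 (k - n)..min m k}. lam_smult q ((- q) ^ (i * (n + i - k))) (y i \<otimes>\<^bsub>L\<^esub> z (k - i)))"
proof -
  note yc = values_closed [OF y] and zc = values_closed [OF z]
  let ?t = "\<lambda>i. lam_smult q ((- q) ^ (i * (n + i - k))) (y i \<otimes>\<^bsub>L\<^esub> z (k - i))"
  let ?I = "{max 0 (k - n)..min m k}"
  have "bar_pairing m n y z (bar_of_f q (m + n) (f_elem q (m + n) k)) =
    (\<Oplus>\<^bsub>L\<^esub>i\<in>{0..m+1}. \<Oplus>\<^bsub>L\<^esub>j\<in>{0..n+1}.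
       lam_smult q (Poly_Mapping.lookup (f_elem q (m + n) k) (f_org m i, dual_word m i @ dual_word n j)) (y i \<otimes>\<^bsub>L\<^esub> z j))"
    by (rule bar_pairing_bar_of_f) (rule f_elem_keys, assumption, use k in simp)
  also have "\<dots> = (\<Oplus>\<^bsub>L\<^esub>i\<in>{0..m+1}. if i \<in> ?I then ?t i else \<zero>\<^bsub>L\<^esub>)"
  proof (rule L.finsum_cong' [OF refl])
    fix i assume i: "i \<in> {0..m+1}"
    \<comment> \<open>For fixed \<open>i\<close> only \<open>j = k - i\<close> can contribute.
      Truncated subtraction would also admit \<open>j = 0\<close> for \<open>i > k\<close>, so
      membership of \<open>i\<close> in \<open>?I\<close> is kept as a second condition.\<close>
    have "(\<Oplus>\<^bsub>L\<^esub>j\<in>{0..n+1}.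
        lam_smult q (Poly_Mapping.lookup (f_elem q (m + n) k) (f_org m i, dual_word m i @ dual_word n j)) (y i \<otimes>\<^bsub>L\<^esub> z j)) =
        (\<Oplus>\<^bsub>L\<^esub>j\<in>{0..n+1}. if k - i = j then (if i \<in> ?I then ?t i else \<zero>\<^bsub>L\<^esub>) else \<zero>\<^bsub>L\<^esub>)"
    proof (rule L.finsum_cong' [OF refl])
      fix j assume j: "j \<in> {0..n+1}"
      show "lam_smult q (Poly_Mapping.lookup (f_elem q (m + n) k) (f_org m i, dual_word m i @ dual_word n j)) (y i \<otimes>\<^bsub>L\<^esub> z j) =
          (if k - i = j then (if i \<in> ?I then ?t i else \<zero>\<^bsub>L\<^esub>) else \<zero>\<^bsub>L\<^esub>)"
      proof (cases "f_end m i = f_org n j")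
        case False
        with values_mult_eq_0 [of i j] i j show ?thesis
          by auto
      next
        case True
        \<comment> \<open>\<open>?I\<close> collects the conditions \<open>i \<le> m\<close>,
          \<open>i \<le> k\<close> and \<open>k - i \<le> n\<close>; under them
          \<open>n + i - k\<close> is a true difference and equals \<open>n - j\<close>.\<close>
        have "i \<le> m \<and> j \<le> n \<and> i + j = k \<longleftrightarrow> k - i = j \<and> i \<in> ?I \<and> j \<le> n"
          by auto
        moreover have "n + i - k = n - j" if "i + j = k" "j \<le> n"
          using that by auto
        moreover have "y i \<otimes>\<^bsub>L\<^esub> z j \<in> carrier L"
          using i j yc zc by simp
        moreover have "j \<le> n" if "k - i = j" "i \<in> ?I"
          using that by auto
        ultimately show ?thesis
          using lookup_f_elem_dual_append [OF k _ _ True, of q] i j by auto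
      qed
    qed (use i yc zc in auto)
    also have "\<dots> = (if i \<in> ?I then ?t i else \<zero>\<^bsub>L\<^esub>)"
    proof (cases "i \<in> ?I")
      case True
      then have "k - i \<in> {0..n+1}"
        by auto
      moreover have "?t i \<in> carrier L"
        using True yc zc by auto
      ultimately show ?thesis
        using True L.finsum_singleton [of "k - i" "{0..n+1}" "\<lambda>_. ?t i"] by simp
    next
      case False
      then show ?thesis
        by (simp only: if_False if_cancel L.finsum_zero)
    qed
    finally show "(\<Oplus>\<^bsub>L\<^esub>j\<in>{0..n+1}.
        lam_smult q (Poly_Mapping.lookup (f_elem q (m + n) k) (f_org m i, dual_word m i @ dual_word n j)) (y i \<otimes>\<^bsub>L\<^esub> z j)) =
        (if i \<in> ?I then ?t i else \<zero>\<^bsub>L\<^esub>)" .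
  qed (use yc zc in auto)
  also have "\<dots> = (\<Oplus>\<^bsub>L\<^esub>i\<in>?I. ?t i)"
    using yc zc by (intro L.add.finprod_mono_neutral_cong_right) auto
  finally show ?thesis .
qed

text \<open>Cutting a^(m+n-1) c after \<open>m\<close> letters leaves the \<open>c\<close> in the
  second word because \<open>n \<ge> 1\<close>, so the only split is a^m followed by a^(n-1)
  c.\<close>

lemma bar_pairing_f_elem_last:
  assumes n: "n \<ge> 1"
  shows "bar_pairing m n y z (bar_of_f q (m + n) (f_elem q (m + n) (m + n + 1))) = y 0 \<otimes>\<^bsub>L\<^esub> z (n + 1)"
proof -
  note yc = values_closed [OF y] and zc = values_closed [OF z]
  let ?C = "\<lambda>i j. Poly_Mapping.lookup (f_elem q (m + n) (m + n + 1)) (f_org m i, dual_word m i @ dual_word n j)"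
  have "bar_pairing m n y z (bar_of_f q (m + n) (f_elem q (m + n) (m + n + 1))) =
    (\<Oplus>\<^bsub>L\<^esub>i\<in>{0..m+1}. \<Oplus>\<^bsub>L\<^esub>j\<in>{0..n+1}. lam_smult q (?C i j) (y i \<otimes>\<^bsub>L\<^esub> z j))"
    by (rule bar_pairing_bar_of_f) (rule f_elem_keys, assumption, simp)
  also have "\<dots> = (\<Oplus>\<^bsub>L\<^esub>i\<in>{0..m+1}. if 0 = i then y i \<otimes>\<^bsub>L\<^esub> z (n + 1) else \<zero>\<^bsub>L\<^esub>)"
  proof (rule L.finsum_cong' [OF refl])
    fix i assume i: "i \<in> {0..m+1}"
    have "(\<Oplus>\<^bsub>L\<^esub>j\<in>{0..n+1}. lam_smult q (?C i j) (y i \<otimes>\<^bsub>L\<^esub> z j)) =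
        (\<Oplus>\<^bsub>L\<^esub>j\<in>{0..n+1}. if n + 1 = j then (if 0 = i then y i \<otimes>\<^bsub>L\<^esub> z j else \<zero>\<^bsub>L\<^esub>) else \<zero>\<^bsub>L\<^esub>)"
    proof (rule L.finsum_cong' [OF refl])
      fix j assume j: "j \<in> {0..n+1}"
      have "y i \<otimes>\<^bsub>L\<^esub> z j \<in> carrier L"
        using i j yc zc by simp
      then show "lam_smult q (?C i j) (y i \<otimes>\<^bsub>L\<^esub> z j) =
          (if n + 1 = j then (if 0 = i then y i \<otimes>\<^bsub>L\<^esub> z j else \<zero>\<^bsub>L\<^esub>) else \<zero>\<^bsub>L\<^esub>)"
        using values_mult_eq_0 [of i j] lookup_f_elem_last_dual_append [OF n, of i m j q] i j
        by (cases "f_end m i = f_org n j") auto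
    qed (use i yc zc in auto)
    also have "\<dots> = (if 0 = i then y i \<otimes>\<^bsub>L\<^esub> z (n + 1) else \<zero>\<^bsub>L\<^esub>)"
      using i yc zc by (intro L.finsum_singleton) auto
    finally show "(\<Oplus>\<^bsub>L\<^esub>j\<in>{0..n+1}. lam_smult q (?C i j) (y i \<otimes>\<^bsub>L\<^esub> z j)) =
        (if 0 = i then y i \<otimes>\<^bsub>L\<^esub> z (n + 1) else \<zero>\<^bsub>L\<^esub>)" .
  qed (use yc zc in auto)
  also have "\<dots> = y 0 \<otimes>\<^bsub>L\<^esub> z (n + 1)"
    using yc zc by (intro L.finsum_singleton) auto
  finally show ?thesis .
qed

end

text \<open>Both sides are homomorphisms in \<open>t\<close>; on pure tensors they agree because
  each cochain is its extension composed with \<iota>.\<close>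

lemma mult_map_cochains:
  assumes \<phi>: "\<phi> \<in> bimod_hom L (K q m) (regular L)" and \<mu>: "\<mu> \<in> bimod_hom L (K q n) (regular L)"
    and t: "t \<in> carrier (tensor (carrier L) (K q m) (K q n))"
  shows "mult_map q (tensor_map (carrier L) (regular L) (regular L) \<phi> \<mu> t) =
    mult_map q (tensor_map (carrier L) (regular L) (regular L)
      (bar_ext m (\<lambda>i. \<phi> (eps q m i))) (bar_ext n (\<lambda>i. \<mu> (eps q n i)))
      (tensor_map (carrier L) (Bar q m) (Bar q n) (iota q m) (iota q n) t))"
proof -
  have G: "group (regular L)"
    using L.comm_group_regular by (rule comm_group.axioms(2))
  note y = cochain_values_eps [OF \<phi>] and z = cochain_values_eps [OF \<mu>]
  note A = tensor_data_K tensor_data_regular \<phi> \<mu>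
  note B = tensor_data_K tensor_data_Bar iota_bimod_hom iota_bimod_hom
  note C = tensor_data_Bar tensor_data_regular bar_ext_bimod_hom [OF y] bar_ext_bimod_hom [OF z]
  have closed: "iota q n x \<in> carrier (Bar q n)" if "x \<in> carrier (K q n)" for n x
    using that iota_bimod_hom [of n] by (auto simp: bimod_hom_def dest: hom_in_carrier)
  show ?thesis
    by (rule tensor_data.tensor_hom_eqI [OF tensor_data_K G hom_comp [OF bimod_tensor_map_hom [OF A] mult_map_hom]
          hom_comp [OF hom_comp [OF bimod_tensor_map_hom [OF B] bimod_tensor_map_hom [OF C]] mult_map_hom] _ t])
      (simp add: bimod_tensor_map_pure [OF A] bimod_tensor_map_pure [OF B] bimod_tensor_map_pure [OF C]
        closed bar_ext_iota [OF \<phi>] bar_ext_iota [OF \<mu>])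
qed

lemma cup_eps:
  assumes \<Delta>: "K_comult q \<Delta>"
    and \<phi>: "\<phi> \<in> bimod_hom L (K q m) (regular L)" and \<mu>: "\<mu> \<in> bimod_hom L (K q n) (regular L)"
    and k: "k \<le> m + n + 1"
  shows "cup q \<Delta> m n \<phi> \<mu> (eps q (m + n) k) = lam_smult q ((-1) ^ (m * n))
    (lam_idem q (f_org (m + n) k) \<otimes>\<^bsub>L\<^esub>
       bar_pairing m n (\<lambda>i. \<phi> (eps q m i)) (\<lambda>i. \<mu> (eps q n i)) (bar_of_f q (m + n) (f_elem q (m + n) k))
     \<otimes>\<^bsub>L\<^esub> lam_idem q (f_end (m + n) k))"
proof -
  note y = cochain_values_eps [OF \<phi>] and z = cochain_values_eps [OF \<mu>]
  note A = tensor_data_K tensor_data_regular \<phi> \<mu>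
  let ?e = "eps q (m + n) k" and ?S = "tensor (carrier L) (regular L) (regular L)"
  let ?t = "\<Delta> (m + n) ?e m" and ?\<phi>\<mu> = "tensor_map (carrier L) (regular L) (regular L) \<phi> \<mu>"
  have e: "?e \<in> carrier (K q (m + n))"
    by (rule eps_closed [OF k])
  have "\<Delta> (m + n) \<in> hom (K q (m + n)) (tensor_square L (K q) (m + n))"
    using \<Delta> by (simp add: K_comult_def bimod_hom_def)
  then have "\<Delta> (m + n) ?e \<in> carrier (tensor_square L (K q) (m + n))"
    using e by (rule hom_in_carrier)
  then have "?t \<in> carrier (tensor (carrier L) (K q m) (K q (m + n - m)))"
    unfolding tensor_square_def bimod_sum_simps by (rule PiE_mem) simp
  then have t: "?t \<in> carrier (tensor (carrier L) (K q m) (K q n))"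
    by simp
  have c: "?\<phi>\<mu> ?t \<in> carrier ?S"
    by (rule hom_in_carrier [OF bimod_tensor_map_hom [OF A] t])
  \<comment> \<open>The compatibility of \<Delta> with the bar comultiplication, read at component
    \<open>m\<close>; from here on \<Delta> can be eliminated.\<close>
  have "iota_square q (m + n) (\<Delta> (m + n) ?e) m = bar_comult q (m + n) (iota q (m + n) ?e) m"
    using \<Delta> e by (simp add: K_comult_def)
  then have \<iota>: "tensor_map (carrier L) (Bar q m) (Bar q n) (iota q m) (iota q n) ?t = bar_comult q (m + n) (iota q (m + n) ?e) m"
    by (simp add: iota_square_def)
  \<comment> \<open>The multiplication map commutes with integer powers, so the sign comes out as a
    scalar factor.\<close>
  have "cup q \<Delta> m n \<phi> \<mu> ?e = mult_map q (?\<phi>\<mu> ?t) [^]\<^bsub>regular L\<^esub> ((-1) ^ (n * m) :: int)"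
    unfolding cup_def cochain_tensor_def
    by (rule hom_int_pow [OF mult_map_hom c])
      (auto intro!: comm_group.axioms(2) tensor_data.comm_group_tensor tensor_data_regular L.comm_group_regular)
  also have "\<dots> = lam_smult q ((-1) ^ (m * n)) (mult_map q (?\<phi>\<mu> ?t))"
    using hom_in_carrier [OF mult_map_hom c]
    by (simp only: regular_int_pow_sign regular_simps mult.commute [of n m])
  also have "mult_map q (?\<phi>\<mu> ?t) = bar_pairing m n (\<lambda>i. \<phi> (eps q m i)) (\<lambda>i. \<mu> (eps q n i)) (iota q (m + n) ?e)"
    unfolding mult_map_cochains [OF \<phi> \<mu> t] \<iota> bar_pairing_def ..
  also have "\<dots> = lam_idem q (f_org (m + n) k) \<otimes>\<^bsub>L\<^esub>
       bar_pairing m n (\<lambda>i. \<phi> (eps q m i)) (\<lambda>i. \<mu> (eps q n i)) (bar_of_f q (m + n) (f_elem q (m + n) k))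
     \<otimes>\<^bsub>L\<^esub> lam_idem q (f_end (m + n) k)"
    unfolding iota_eps [OF k]
    by (rule bar_pairing_linear [OF y z idem_closed idem_closed]) (rule bar_of_f_closed, rule f_elem_keys [OF _ k])
  finally show ?thesis .
qed

text \<open>For \<open>k \<le> m + n\<close> the element \<open>f (m + n) k\<close> runs from vertex
  1 to vertex 1, as does every product in the sum, so the outer idempotents are absorbed. The
  boundary values \<open>k = 0\<close> and \<open>k = m + n\<close> are included.\<close>

lemma cup_eps_le:
  assumes \<Delta>: "K_comult q \<Delta>"
    and \<phi>: "\<phi> \<in> bimod_hom L (K q m) (regular L)" and \<mu>: "\<mu> \<in> bimod_hom L (K q n) (regular L)"
    and k: "k \<le> m + n"
  shows "cup q \<Delta> m n \<phi> \<mu> (eps q (m + n) k) = lam_smult q ((-1) ^ (m * n))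
    (\<Oplus>\<^bsub>L\<^esub>j\<in>{max 0 (k - n)..min m k}. lam_smult q ((- q) ^ (j * (n + j - k)))
       (\<phi> (eps q m j) \<otimes>\<^bsub>L\<^esub> \<mu> (eps q n (k - j))))"
proof -
  note y = cochain_values_eps [OF \<phi>] and z = cochain_values_eps [OF \<mu>]
  note yc = values_closed [OF y] and zc = values_closed [OF z]
  let ?I = "{max 0 (k - n)..min m k}"
  let ?t = "\<lambda>j. lam_smult q ((- q) ^ (j * (n + j - k))) (\<phi> (eps q m j) \<otimes>\<^bsub>L\<^esub> \<mu> (eps q n (k - j)))"
  let ?e = "lam_idem q V1"
  have ends: "f_org (m + n) k = V1" "f_end (m + n) k = V1"
    using k by (auto simp: f_org_def f_end_def)
  have tc: "?t j \<in> carrier L" if "j \<in> ?I" for j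
    using that yc zc by auto
  have fixed: "?e \<otimes>\<^bsub>L\<^esub> ?t j = ?t j" "?t j \<otimes>\<^bsub>L\<^esub> ?e = ?t j" if "j \<in> ?I" for j
  proof -
    \<comment> \<open>\<open>j \<le> m\<close> and \<open>k - j \<le> n\<close> keep both indices
      away from the last ones, the only ones that can involve vertex 2.\<close>
    have "f_org m j = V1" "f_end n (k - j) = V1" "j \<le> m + 1" "k - j \<le> n + 1"
      using that by (auto simp: f_org_def f_end_def)
    then have "?e \<otimes>\<^bsub>L\<^esub> \<phi> (eps q m j) = \<phi> (eps q m j)" "\<mu> (eps q n (k - j)) \<otimes>\<^bsub>L\<^esub> ?e = \<mu> (eps q n (k - j))"
      using y z unfolding cochain_values_def by metis+
    moreover have "\<phi> (eps q m j) \<in> carrier L" "\<mu> (eps q n (k - j)) \<in> carrier L"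
      using that yc zc by auto
    ultimately show "?e \<otimes>\<^bsub>L\<^esub> ?t j = ?t j" "?t j \<otimes>\<^bsub>L\<^esub> ?e = ?t j"
      by (simp_all add: smult_mult_left smult_mult_right L.m_assoc)
        (simp add: L.m_assoc [symmetric])
  qed
  have "?e \<otimes>\<^bsub>L\<^esub> (\<Oplus>\<^bsub>L\<^esub>j\<in>?I. ?t j) = (\<Oplus>\<^bsub>L\<^esub>j\<in>?I. ?t j)"
    using tc fixed(1) by (intro trans [OF L.finsum_rdistr L.finsum_cong'] refl funcsetI) simp_all
  moreover have "(\<Oplus>\<^bsub>L\<^esub>j\<in>?I. ?t j) \<otimes>\<^bsub>L\<^esub> ?e = (\<Oplus>\<^bsub>L\<^esub>j\<in>?I. ?t j)"
    using tc fixed(2) by (intro trans [OF L.finsum_ldistr L.finsum_cong'] refl funcsetI) simp_all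
  ultimately show ?thesis
    using cup_eps [OF \<Delta> \<phi> \<mu>, of k] k by (simp only: bar_pairing_f_elem [OF y z k] ends)
qed

lemma cup_eps_last:
  assumes \<Delta>: "K_comult q \<Delta>"
    and \<phi>: "\<phi> \<in> bimod_hom L (K q m) (regular L)" and \<mu>: "\<mu> \<in> bimod_hom L (K q n) (regular L)"
    and n: "n \<ge> 1"
  shows "cup q \<Delta> m n \<phi> \<mu> (eps q (m + n) (m + n + 1)) =
    lam_smult q ((-1) ^ (m * n)) (\<phi> (eps q m 0) \<otimes>\<^bsub>L\<^esub> \<mu> (eps q n (n + 1)))"
proof -
  note y = cochain_values_eps [OF \<phi>] and z = cochain_values_eps [OF \<mu>]
  \<comment> \<open>For \<open>n \<ge> 1\<close> the total degree is positive, so the last element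
    starts at vertex 1, as \<open>f m 0\<close> does.\<close>
  have ends: "f_org (m + n) (m + n + 1) = f_org m 0" "f_end (m + n) (m + n + 1) = f_end n (n + 1)"
    using n by (auto simp: f_org_def f_end_def)
  have "lam_idem q (f_org m 0) \<otimes>\<^bsub>L\<^esub> \<phi> (eps q m 0) = \<phi> (eps q m 0)" "\<phi> (eps q m 0) \<in> carrier L"
    using y by (auto simp: cochain_values_def)
  moreover have "\<mu> (eps q n (n + 1)) \<otimes>\<^bsub>L\<^esub> lam_idem q (f_end n (n + 1)) = \<mu> (eps q n (n + 1))" "\<mu> (eps q n (n + 1)) \<in> carrier L"
    using z by (auto simp: cochain_values_def)
  ultimately have "lam_idem q (f_org m 0) \<otimes>\<^bsub>L\<^esub> (\<phi> (eps q m 0) \<otimes>\<^bsub>L\<^esub> \<mu> (eps q n (n + 1))) \<otimes>\<^bsub>L\<^esub> lam_idem q (f_end n (n + 1)) =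
      \<phi> (eps q m 0) \<otimes>\<^bsub>L\<^esub> \<mu> (eps q n (n + 1))"
    by (metis L.m_assoc L.m_closed idem_closed)
  then show ?thesis
    using cup_eps [OF \<Delta> \<phi> \<mu>, of "m + n + 1"] by (simp only: bar_pairing_f_elem_last [OF y z n] ends order_refl)
qed

end

theorem proposition1p4:
  fixes q :: "'k::field" and m n :: nat
    and \<phi> \<mu> :: "'k kcarr \<Rightarrow> 'k quot"
    and \<Delta> :: "nat \<Rightarrow> 'k kcarr \<Rightarrow> nat \<Rightarrow> (('k kcarr \<times> 'k kcarr) \<Rightarrow>\<^sub>0 int) set"
  assumes "K_comult q \<Delta>"
    and "cocycle q m \<phi>"
    and "cocycle q n \<mu>"
  shows
    "cup q \<Delta> m n \<phi> \<mu> (eps q (m + n) 0)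
       = lam_smult q ((-1) ^ (m * n)) (\<phi> (eps q m 0) \<otimes>\<^bsub>Lam q\<^esub> \<mu> (eps q n 0))
     \<and> (\<forall>k. 0 < k \<and> k < m + n \<longrightarrow>
          cup q \<Delta> m n \<phi> \<mu> (eps q (m + n) k)
            = lam_smult q ((-1) ^ (m * n))
                (\<Oplus>\<^bsub>Lam q\<^esub>j\<in>{max 0 (k - n)..min m k}.
                   lam_smult q ((- q) ^ (j * (n + j - k)))
                     (\<phi> (eps q m j) \<otimes>\<^bsub>Lam q\<^esub> \<mu> (eps q n (k - j)))))
     \<and> cup q \<Delta> m n \<phi> \<mu> (eps q (m + n) (m + n))
         = lam_smult q ((-1) ^ (m * n)) (\<phi> (eps q m m) \<otimes>\<^bsub>Lam q\<^esub> \<mu> (eps q n n))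
     \<and> (n \<ge> 1 \<longrightarrow>
          cup q \<Delta> m n \<phi> \<mu> (eps q (m + n) (m + n + 1))
            = lam_smult q ((-1) ^ (m * n)) (\<phi> (eps q m 0) \<otimes>\<^bsub>Lam q\<^esub> \<mu> (eps q n (n + 1))))"
proof -
  interpret quiver_algebra q .
  have \<phi>: "\<phi> \<in> bimod_hom L (K q m) (regular L)" and \<mu>: "\<mu> \<in> bimod_hom L (K q n) (regular L)"
    using assms by (auto simp: cocycle_def)
  note closed = values_closed [OF cochain_values_eps [OF \<phi>]] values_closed [OF cochain_values_eps [OF \<mu>]]
  note le = cup_eps_le [OF assms(1) \<phi> \<mu>]
  \<comment> \<open>At \<open>k = 0\<close> and \<open>k = m + n\<close> the range of the sum
    shrinks to \<open>j = 0\<close> and \<open>j = m\<close> respectively, each with exponent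
    0.\<close>
  have "cup q \<Delta> m n \<phi> \<mu> (eps q (m + n) 0)
       = lam_smult q ((-1) ^ (m * n)) (\<phi> (eps q m 0) \<otimes>\<^bsub>L\<^esub> \<mu> (eps q n 0))"
    using le [of 0] closed by (simp add: L.finsum_insert)
  moreover have "cup q \<Delta> m n \<phi> \<mu> (eps q (m + n) (m + n))
         = lam_smult q ((-1) ^ (m * n)) (\<phi> (eps q m m) \<otimes>\<^bsub>L\<^esub> \<mu> (eps q n n))"
    using le [of "m + n"] closed by (simp add: L.finsum_insert)
  ultimately show ?thesis
    using le cup_eps_last [OF assms(1) \<phi> \<mu>] by simp
qed

end
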